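(* Let $K$ be a commutative ring and $n\ge 4$. The Jacobian group $\Sigma$ of the Grassmann algebra $\Lambda_n(K)$ is a unipotent affine group over $K$ of dimension $$\dim(\Sigma)=\begin{cases}(n-1)2^{n-1}-n^2+2 & \text{if } n \text{ is even},\\ (n-1)2^{n-1}-n^2+1 & \text{if } n\text{ is odd},\end{cases}$$ over $K$, i.e. the algebra of regular functions on $\Sigma$ is a polynomial algebra in $\dim(\Sigma)$ variables over $K$.
   Context: $\Lambda_n=\Lambda_n(K)$ is the Grassmann (exterior) $K$-algebra generated freely over $K$ by $x_1,\dots,x_n$ subject to $x_i^2=0$ and $x_ix_j=-x_jx_i$ ($i\ne j$). It is a free $K$-module with basis $x^\alpha=x_{i_1}\cdots x_{i_k}$, $\alpha=\{i_1<\dots<i_k\}\subseteq\{1,\dots,n\}$, graded by $|\alpha|$; $\Lambda_{n,d}$ is the degree $d$ component, $\mathfrak m=(x_1,\dots,x_n)=\bigoplus_{d\ge1}\Lambda_{n,d}$, and $\Lambda_n^{ev}$, $\Lambda_n^{od}$ are the sums of the components of even, respectively odd, degree. $\Gamma$ is the group of all $K$-algebra automorphisms $\sigma$ of $\Lambda_n$ such that $\sigma(x_i)-x_i\in\Lambda_n^{od}\cap\mathfrak m^3$ for all $i$. The left skew derivation $\partial/\partial x_j$ is the $K$-linear map $\Lambda_n\to\Lambda_n$ with $\frac{\partial x_k}{\partial x_j}=\delta_{jk}$ and $\frac{\partial (ab)}{\partial x_j}=\frac{\partial a}{\partial x_j}b+(-1)^i a\frac{\partial b}{\partial x_j}$ for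 $a\in\Lambda_{n,i}$, $b\in \Lambda_n$. For $\sigma\in\Gamma$ the Jacobian is $\mathcal J(\sigma)=\det\left(\frac{\partial\sigma(x_i)}{\partial x_j}\right)$ (the entries lie in $\Lambda_n^{ev}$, hence are central). The Jacobian group is $\Sigma=\{\sigma\in\Gamma\mid\mathcal J(\sigma)=1\}$, which is a subgroup of $\Gamma$. $\Gamma$ is regarded as an algebraic group over $K$ whose underlying variety is the affine space with coordinates the coefficients of the monomials $x^\alpha$ ($|\alpha|\ge3$ odd) in the elements $\sigma(x_i)-x_i$, $1\le i\le n$; subsets given by polynomial equations over $K$ in these coordinates are closed subvarieties (understood, as usual for schemes over a ring, compatibly with replacing $K$ by commutative $K$-algebras). An algebraic variety or algebraic group over $K$ is called affine if its algebra of regular functions is a polynomial algebra $K[t_1,\dots,t_d]$; then $d$ is called its dimension. *)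

theory Defs
  imports
    "HOL-Algebra.QuotRing"
    "HOL-Algebra.Ideal_Product"
    "HOL-Combinatorics.Permutations"
    "HOL-Library.Poly_Mapping"
begin

section \<open>The Grassmann algebra\<close>

text \<open>
  An element of the Grassmann algebra on \<open>x\<^sub>1, \<dots>, x\<^sub>n\<close> is the family of its coefficients with respect
  to the basis \<open>x\<^sup>\<alpha>\<close>, where \<open>\<alpha> \<subseteq> {1..n}\<close> and the factors of \<open>x\<^sup>\<alpha>\<close> are taken in increasing order.
  For disjoint \<open>\<alpha>\<close> and \<open>\<beta>\<close> the defining relations give \<open>x\<^sup>\<alpha> x\<^sup>\<beta> = gsign \<alpha> \<beta> x\<^sup>\<alpha>\<^sup>\<union>\<^sup>\<beta>\<close>,
  where the sign counts the transpositions needed to sort the factors;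
  if \<open>\<alpha>\<close> and \<open>\<beta>\<close> meet, the product is zero.
\<close>

definition gsign :: "nat set \<Rightarrow> nat set \<Rightarrow> 'a::comm_ring_1" where
  "gsign \<alpha> \<beta> = (- 1) ^ card {(i, j). i \<in> \<alpha> \<and> j \<in> \<beta> \<and> j < i}"

definition gmonom :: "nat set \<Rightarrow> nat set \<Rightarrow> 'a::comm_ring_1" where
  "gmonom \<alpha> = (\<lambda>\<beta>. if \<beta> = \<alpha> then 1 else 0)"

definition grassmann :: "nat \<Rightarrow> (nat set \<Rightarrow> 'a::comm_ring_1) ring" where
  "grassmann n =
    \<lparr>carrier = {a. \<forall>\<alpha>. \<not> \<alpha> \<subseteq> {1..n} \<longrightarrow> a \<alpha> = 0},
     monoid.mult = (\<lambda>a b \<gamma>. \<Sum>\<alpha>\<in>Pow \<gamma>. gsign \<alpha> (\<gamma> - \<alpha>) * a \<alpha> * b (\<gamma> - \<alpha>)),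
     one = gmonom {},
     zero = (\<lambda>\<alpha>. 0),
     add = (\<lambda>a b \<alpha>. a \<alpha> + b \<alpha>)\<rparr>"

definition gscale :: "'a \<Rightarrow> (nat set \<Rightarrow> 'a) \<Rightarrow> (nat set \<Rightarrow> 'a::comm_ring_1)" where
  "gscale c a = (\<lambda>\<alpha>. c * a \<alpha>)"

abbreviation gvar :: "nat \<Rightarrow> nat set \<Rightarrow> 'a::comm_ring_1" where
  "gvar i \<equiv> gmonom {i}"

definition ghomogeneous :: "nat \<Rightarrow> nat \<Rightarrow> (nat set \<Rightarrow> 'a::comm_ring_1) set" where
  "ghomogeneous n d = {a \<in> carrier (grassmann n). \<forall>\<alpha>. a \<alpha> \<noteq> 0 \<longrightarrow> card \<alpha> = d}"

definition godd :: "nat \<Rightarrow> (nat set \<Rightarrow> 'a::comm_ring_1) set" where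
  "godd n = {a \<in> carrier (grassmann n). \<forall>\<alpha>. a \<alpha> \<noteq> 0 \<longrightarrow> odd (card \<alpha>)}"

definition gmax :: "nat \<Rightarrow> (nat set \<Rightarrow> 'a::comm_ring_1) set" where
  "gmax n = {a \<in> carrier (grassmann n). a {} = 0}"

definition gmax_cubed :: "nat \<Rightarrow> (nat set \<Rightarrow> 'a::comm_ring_1) set" where
  "gmax_cubed n = ideal_prod (grassmann n) (gmax n) (ideal_prod (grassmann n) (gmax n) (gmax n))"


section \<open>The group \<open>\<Gamma>\<close> and the Jacobian\<close>

text \<open>
  Maps on the Grassmann algebra are taken extensional, i.e. undefined outside the carrier,
  so that equality of maps is equality on the carrier.
\<close>

definition grassmann_aut :: "nat \<Rightarrow> ((nat set \<Rightarrow> 'a::comm_ring_1) \<Rightarrow> (nat set \<Rightarrow> 'a)) set" where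
  "grassmann_aut n =
    {\<sigma> \<in> extensional (carrier (grassmann n)).
       \<sigma> \<in> ring_iso (grassmann n) (grassmann n) \<and>
       (\<forall>c. \<forall>a\<in>carrier (grassmann n). \<sigma> (gscale c a) = gscale c (\<sigma> a))}"

definition Gamma_group :: "nat \<Rightarrow> ((nat set \<Rightarrow> 'a::comm_ring_1) \<Rightarrow> (nat set \<Rightarrow> 'a)) set" where
  "Gamma_group n =
    {\<sigma> \<in> grassmann_aut n. \<forall>i\<in>{1..n}.
       \<sigma> (gvar i) \<ominus>\<^bsub>grassmann n\<^esub> gvar i \<in> godd n \<inter> gmax_cubed n}"

definition is_left_skew_derivation ::
    "nat \<Rightarrow> nat \<Rightarrow> ((nat set \<Rightarrow> 'a::comm_ring_1) \<Rightarrow> (nat set \<Rightarrow> 'a)) \<Rightarrow> bool" where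
  "is_left_skew_derivation n j D \<longleftrightarrow>
     D \<in> carrier (grassmann n) \<rightarrow>\<^sub>E carrier (grassmann n) \<and>
     (\<forall>a\<in>carrier (grassmann n). \<forall>b\<in>carrier (grassmann n).
        D (a \<oplus>\<^bsub>grassmann n\<^esub> b) = D a \<oplus>\<^bsub>grassmann n\<^esub> D b) \<and>
     (\<forall>c. \<forall>a\<in>carrier (grassmann n). D (gscale c a) = gscale c (D a)) \<and>
     (\<forall>k\<in>{1..n}. D (gvar k) = (if k = j then \<one>\<^bsub>grassmann n\<^esub> else \<zero>\<^bsub>grassmann n\<^esub>)) \<and>
     (\<forall>i. \<forall>a\<in>ghomogeneous n i. \<forall>b\<in>carrier (grassmann n).
        D (a \<otimes>\<^bsub>grassmann n\<^esub> b) =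
          D a \<otimes>\<^bsub>grassmann n\<^esub> b \<oplus>\<^bsub>grassmann n\<^esub> gscale ((- 1) ^ i) (a \<otimes>\<^bsub>grassmann n\<^esub> D b))"

definition skew_deriv :: "nat \<Rightarrow> nat \<Rightarrow> (nat set \<Rightarrow> 'a::comm_ring_1) \<Rightarrow> (nat set \<Rightarrow> 'a)" where
  "skew_deriv n j = (THE D. is_left_skew_derivation n j D)"

text \<open>
  The factors of each term of the determinant are multiplied in the order of the rows;
  for the Jacobian matrix the entries are even, hence central, and the order is immaterial.
\<close>

definition gdet :: "nat \<Rightarrow> (nat \<Rightarrow> nat \<Rightarrow> nat set \<Rightarrow> 'a::comm_ring_1) \<Rightarrow> (nat set \<Rightarrow> 'a)" where
  "gdet n A = (\<lambda>\<alpha>. \<Sum>p | p permutes {1..n}.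
     of_int (sign p) *
     foldr (\<lambda>i b. A i (p i) \<otimes>\<^bsub>grassmann n\<^esub> b) [1..<Suc n] \<one>\<^bsub>grassmann n\<^esub> \<alpha>)"

definition Jacobian ::
    "nat \<Rightarrow> ((nat set \<Rightarrow> 'a::comm_ring_1) \<Rightarrow> (nat set \<Rightarrow> 'a)) \<Rightarrow> (nat set \<Rightarrow> 'a)" where
  "Jacobian n \<sigma> = gdet n (\<lambda>i j. skew_deriv n j (\<sigma> (gvar i)))"

text \<open>The coordinates on \<open>\<Gamma>\<close>: the coefficients of \<open>x\<^sup>\<alpha>\<close> in \<open>\<sigma>(x\<^sub>i) - x\<^sub>i\<close>, for odd \<open>|\<alpha>| \<ge> 3\<close>.\<close>

definition Gamma_index :: "nat \<Rightarrow> (nat \<times> nat set) set" where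
  "Gamma_index n = {(i, \<alpha>). i \<in> {1..n} \<and> \<alpha> \<subseteq> {1..n} \<and> odd (card \<alpha>) \<and> 3 \<le> card \<alpha>}"

definition Gamma_coords ::
    "nat \<Rightarrow> ((nat set \<Rightarrow> 'a::comm_ring_1) \<Rightarrow> (nat set \<Rightarrow> 'a)) \<Rightarrow> nat \<times> nat set \<Rightarrow> 'a" where
  "Gamma_coords n \<sigma> =
     (\<lambda>(i, \<alpha>)\<in>Gamma_index n. (\<sigma> (gvar i) \<ominus>\<^bsub>grassmann n\<^esub> gvar i) \<alpha>)"

text \<open>
  \<open>Gamma_coords n\<close> is a bijection from \<open>\<Gamma>\<close> onto all families indexed by \<open>Gamma_index n\<close>,
  over every commutative ring; \<open>Gamma_point n c\<close> is the element of \<open>\<Gamma>\<close> with coordinates \<open>c\<close>.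
\<close>

definition Gamma_point ::
    "nat \<Rightarrow> (nat \<times> nat set \<Rightarrow> 'a) \<Rightarrow> ((nat set \<Rightarrow> 'a::comm_ring_1) \<Rightarrow> (nat set \<Rightarrow> 'a))" where
  "Gamma_point n c = the_inv_into (Gamma_group n) (Gamma_coords n) (restrict c (Gamma_index n))"


section \<open>Polynomial algebras\<close>

type_synonym ('v, 'k) mpoly = "('v \<Rightarrow>\<^sub>0 nat) \<Rightarrow>\<^sub>0 'k"

definition mconst :: "'k \<Rightarrow> ('v, 'k::comm_ring_1) mpoly" where
  "mconst c = Poly_Mapping.single 0 c"

definition mvar :: "'v \<Rightarrow> ('v, 'k::comm_ring_1) mpoly" where
  "mvar v = Poly_Mapping.single (Poly_Mapping.single v 1) 1"

text \<open>The polynomial algebra in the variables from a subset \<open>V\<close> of the type of all variables.\<close>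

definition mpoly_ring :: "'v set \<Rightarrow> ('v, 'k::comm_ring_1) mpoly ring" where
  "mpoly_ring V =
    \<lparr>carrier = {p. \<forall>m\<in>Poly_Mapping.keys p. Poly_Mapping.keys m \<subseteq> V},
     monoid.mult = (*), one = 1, zero = 0, add = (+)\<rparr>"

text \<open>The value of a polynomial at \<open>g\<close>, with coefficients transported along \<open>f\<close>.\<close>

definition meval :: "('k \<Rightarrow> 'r) \<Rightarrow> ('v \<Rightarrow> 'r) \<Rightarrow> ('v, 'k::comm_ring_1) mpoly \<Rightarrow> 'r::comm_ring_1" where
  "meval f g p =
     (\<Sum>m\<in>Poly_Mapping.keys p. f (Poly_Mapping.lookup p m) *
        (\<Prod>v\<in>Poly_Mapping.keys m. g v ^ Poly_Mapping.lookup m v))"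

definition msubst :: "('v \<Rightarrow> ('w, 'k) mpoly) \<Rightarrow> ('v, 'k::comm_ring_1) mpoly \<Rightarrow> ('w, 'k) mpoly" where
  "msubst g = meval mconst g"

definition mrename :: "('v \<Rightarrow> 'w) \<Rightarrow> ('v, 'k::comm_ring_1) mpoly \<Rightarrow> ('w, 'k) mpoly" where
  "mrename r = msubst (\<lambda>v. mvar (r v))"


section \<open>Closed subschemes of affine space with a multiplication\<close>

text \<open>
  The affine space over \<open>K\<close> with coordinates \<open>vars X\<close>, in it the closed subscheme cut out by
  \<open>eqs X\<close>, and a morphism given by the polynomials \<open>mul X v\<close>: the coordinate \<open>v\<close> of the product of
  two points, where \<open>Inl w\<close> and \<open>Inr w\<close> are the coordinates of the first and the second point.
  Regular functions on the two- and threefold product of the scheme with itself are the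
  polynomials in two, respectively three, sets of variables modulo the equations for each factor.
\<close>

record (overloaded) ('v, 'k) mult_scheme =
  vars :: "'v set"
  eqs :: "(('v \<Rightarrow>\<^sub>0 nat) \<Rightarrow>\<^sub>0 'k::comm_ring_1) set"
  mul :: "'v \<Rightarrow> (('v + 'v \<Rightarrow>\<^sub>0 nat) \<Rightarrow>\<^sub>0 'k)"

definition vanishing1 :: "('v, 'k::comm_ring_1) mult_scheme \<Rightarrow> ('v, 'k) mpoly set" where
  "vanishing1 X = Idl\<^bsub>mpoly_ring (vars X)\<^esub> (eqs X)"

definition vanishing2 :: "('v, 'k::comm_ring_1) mult_scheme \<Rightarrow> ('v + 'v, 'k) mpoly set" where
  "vanishing2 X = Idl\<^bsub>mpoly_ring (vars X <+> vars X)\<^esub> (mrename Inl ` eqs X \<union> mrename Inr ` eqs X)"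

definition vanishing3 :: "('v, 'k::comm_ring_1) mult_scheme \<Rightarrow> (('v + 'v) + 'v, 'k) mpoly set" where
  "vanishing3 X = Idl\<^bsub>mpoly_ring ((vars X <+> vars X) <+> vars X)\<^esub>
     (mrename (Inl \<circ> Inl) ` eqs X \<union> mrename (Inl \<circ> Inr) ` eqs X \<union> mrename Inr ` eqs X)"

definition regular_functions :: "('v, 'k::comm_ring_1) mult_scheme \<Rightarrow> ('v, 'k) mpoly set ring" where
  "regular_functions X = mpoly_ring (vars X) Quot vanishing1 X"

text \<open>
  Group schemes: the multiplication restricts to the closed subscheme, and on it is associative and
  has a unit (a \<open>K\<close>-point \<open>e\<close>) and an inverse morphism (given by polynomials \<open>s\<close>).
\<close>

definition algebraic_group :: "('v, 'k::comm_ring_1) mult_scheme \<Rightarrow> bool" where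
  "algebraic_group X \<longleftrightarrow>
     finite (vars X) \<and>
     eqs X \<subseteq> carrier (mpoly_ring (vars X)) \<and>
     (\<forall>v\<in>vars X. mul X v \<in> carrier (mpoly_ring (vars X <+> vars X))) \<and>
     (\<forall>f\<in>eqs X. msubst (mul X) f \<in> vanishing2 X) \<and>
     (\<forall>v\<in>vars X.
        msubst (case_sum (\<lambda>w. mrename Inl (mul X w)) (\<lambda>w. mvar (Inr w))) (mul X v) -
        msubst (case_sum (\<lambda>w. mvar (Inl (Inl w))) (\<lambda>w. mrename (case_sum (Inl \<circ> Inr) Inr) (mul X w)))
          (mul X v)
        \<in> vanishing3 X) \<and>
     (\<exists>e. (\<forall>f\<in>eqs X. meval (\<lambda>c. c) e f = 0) \<and>
       (\<forall>v\<in>vars X.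
          msubst (case_sum (\<lambda>w. mconst (e w)) mvar) (mul X v) - mvar v \<in> vanishing1 X \<and>
          msubst (case_sum mvar (\<lambda>w. mconst (e w))) (mul X v) - mvar v \<in> vanishing1 X) \<and>
       (\<exists>s. (\<forall>v\<in>vars X. s v \<in> carrier (mpoly_ring (vars X))) \<and>
          (\<forall>f\<in>eqs X. msubst s f \<in> vanishing1 X) \<and>
          (\<forall>v\<in>vars X.
             msubst (case_sum s mvar) (mul X v) - mconst (e v) \<in> vanishing1 X \<and>
             msubst (case_sum mvar s) (mul X v) - mconst (e v) \<in> vanishing1 X)))"

text \<open>
  Homomorphisms are given by the polynomials \<open>\<phi> w\<close> for the coordinates of the image point;
  closed immersions are those whose comorphism on regular functions is surjective.
\<close>

definition group_scheme_hom ::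
    "('v, 'k::comm_ring_1) mult_scheme \<Rightarrow> ('w, 'k) mult_scheme \<Rightarrow> ('w \<Rightarrow> ('v, 'k) mpoly) \<Rightarrow> bool" where
  "group_scheme_hom X Y \<phi> \<longleftrightarrow>
     (\<forall>w\<in>vars Y. \<phi> w \<in> carrier (mpoly_ring (vars X))) \<and>
     (\<forall>f\<in>eqs Y. msubst \<phi> f \<in> vanishing1 X) \<and>
     (\<forall>w\<in>vars Y.
        msubst (mul X) (\<phi> w) -
        msubst (case_sum (\<lambda>u. mrename Inl (\<phi> u)) (\<lambda>u. mrename Inr (\<phi> u))) (mul Y w)
        \<in> vanishing2 X)"

definition closed_immersion_hom ::
    "('v, 'k::comm_ring_1) mult_scheme \<Rightarrow> ('w, 'k) mult_scheme \<Rightarrow> ('w \<Rightarrow> ('v, 'k) mpoly) \<Rightarrow> bool" where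
  "closed_immersion_hom X Y \<phi> \<longleftrightarrow>
     group_scheme_hom X Y \<phi> \<and>
     (\<forall>p\<in>carrier (mpoly_ring (vars X)). \<exists>q\<in>carrier (mpoly_ring (vars Y)).
        msubst \<phi> q - p \<in> vanishing1 X)"

text \<open>The group of upper unitriangular \<open>N \<times> N\<close> matrices; the coordinates are the entries above the diagonal.\<close>

definition unitriangular :: "nat \<Rightarrow> (nat \<times> nat, 'k::comm_ring_1) mult_scheme" where
  "unitriangular N =
    \<lparr>vars = {(a, b). a < b \<and> b < N},
     eqs = {},
     mul = (\<lambda>(a, b). mvar (Inl (a, b)) + mvar (Inr (a, b)) +
        (\<Sum>c\<in>{a<..<b}. mvar (Inl (a, c)) * mvar (Inr (c, b))))\<rparr>"

text \<open>
  An algebraic group is unipotent if it is isomorphic to a closed subgroup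
  of some group of upper unitriangular matrices.
\<close>

definition unipotent_group :: "('v, 'k::comm_ring_1) mult_scheme \<Rightarrow> bool" where
  "unipotent_group X \<longleftrightarrow>
     algebraic_group X \<and> (\<exists>N \<phi>. closed_immersion_hom X (unitriangular N) \<phi>)"

text \<open>The regular functions form, as a \<open>K\<close>-algebra, a polynomial algebra in \<open>d\<close> variables.\<close>

definition affine_of_dimension :: "('v, 'k::comm_ring_1) mult_scheme \<Rightarrow> nat \<Rightarrow> bool" where
  "affine_of_dimension X d \<longleftrightarrow>
     (\<exists>h \<in> ring_iso (regular_functions X) (mpoly_ring {1..d} :: (nat, 'k) mpoly ring).
        \<forall>c. h (vanishing1 X +>\<^bsub>mpoly_ring (vars X)\<^esub> mconst c) = mconst c)"


section \<open>The Jacobian group\<close>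

text \<open>
  The universal element of \<open>\<Gamma>\<close> is the automorphism, over the polynomial algebra, whose coordinates
  are the variables. The equation \<open>\<J>(\<sigma>) = 1\<close> in the coordinates of \<open>\<sigma>\<close> is the family of the
  coefficients of \<open>\<J>(\<sigma>) - 1\<close> for this universal \<open>\<sigma>\<close>. The multiplication of \<open>\<Gamma>\<close> in coordinates is
  obtained by composing the two universal elements with independent coordinates.
\<close>

definition Jacobian_group :: "nat \<Rightarrow> (nat \<times> nat set, 'k::comm_ring_1) mult_scheme" where
  "Jacobian_group n =
    \<lparr>vars = Gamma_index n,
     eqs = {(Jacobian n (Gamma_point n mvar) \<ominus>\<^bsub>grassmann n\<^esub> \<one>\<^bsub>grassmann n\<^esub>) \<alpha> | \<alpha>. \<alpha> \<subseteq> {1..n}},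
     mul = Gamma_coords n
       (compose (carrier (grassmann n))
          (Gamma_point n (\<lambda>v. mvar (Inl v))) (Gamma_point n (\<lambda>v. mvar (Inr v))))\<rparr>"

end

theory Submission
  imports Defs "Jordan_Normal_Form.Determinant"
begin

text \<open>
  A point of \<open>\<Gamma>\<close> is a family of odd elements \<open>y\<^sub>i = x\<^sub>i +\<close> (terms of degree at least 3).
  Removing its coordinates one at a time, in order of increasing degree, writes the automorphism as
  a product of elementary ones, \<open>f \<mapsto> f + b \<partial>f/\<partial>x\<^sub>i\<close> with \<open>b\<close> a multiple of a monomial.
  Hence \<open>\<Gamma>\<close> is a group, and with the cocycle rule \<open>\<J>(\<sigma>\<tau>) = \<J>(\<sigma>) \<sigma>(\<J>(\<tau>))\<close> the equation
  \<open>\<J> = 1\<close> defines a subgroup over every base ring; applied to the universal points this gives the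
  group scheme axioms. It is unipotent because \<open>\<Gamma>\<close> acts unitriangularly on the monomial basis.

  To lowest order \<open>\<J>(\<sigma>) - 1\<close> is the divergence \<open>\<Sum>\<^sub>i \<partial>(y\<^sub>i - x\<^sub>i)/\<partial>x\<^sub>i\<close>. So for even
  \<open>\<alpha> \<noteq> {}\<close> with \<open>\<alpha> \<noteq> {1..n}\<close> the equation at \<open>x\<^sup>\<alpha>\<close> is solved for the coordinate \<open>(i, \<alpha> \<union> {i})\<close>, where
  \<open>i = min ({1..n} - \<alpha>)\<close>, and recursion on \<open>|\<alpha>|\<close> leaves the remaining coordinates free. For even \<open>n\<close>
  the equation at \<open>x\<^sub>1 \<cdots> x\<^sub>n\<close> follows from the others: the Berezin integral satisfies
  \<open>\<integral> \<J>(\<sigma>)\<inverse> \<sigma>(f) = \<integral> f\<close>, a property checked on elementary automorphisms, and \<open>f = 1\<close> shows that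
  \<open>\<J>(\<sigma>)\<inverse>\<close> has no term \<open>x\<^sub>1 \<cdots> x\<^sub>n\<close>.
\<close>

section \<open>The Grassmann algebra as a type\<close>

text \<open>\<open>K\<close> may be finite, may have nilpotents and zero divisors, and 2 need not be
  invertible. So the equations cannot be studied through \<open>K\<close>-points, no division is
  possible, and squares of odd elements have to be shown zero directly. Points are therefore treated
  over an arbitrary commutative ring and the scheme axioms are obtained over polynomial rings; the
  condition J = 1 over a quotient ring is expressed as membership of all coefficients of J - 1 in an
  ideal. Each equation is solved for a coordinate that occurs linearly with a coefficient
  \<open>gsign\<close>, that is 1 or -1. The equation at x_1 ... x_n with n even has no such
  coordinate: a derivative with respect to x_i has no term containing x_i, so the divergence never
  reaches this coefficient, and only a global argument can dispose of it. The count is n (2^(n-1) -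
  n) coordinates, for each i the odd subsets except the singletons, minus one for each of the
  2^(n-1) even subsets other than {} and, for n even, {1..n}.\<close>

lemma gsign_empty [simp]: "gsign {} \<beta> = 1" "gsign \<alpha> {} = 1"
  by (simp_all add: gsign_def)

lemma gsign_Un_left:
  assumes "finite \<alpha>" "finite \<alpha>'" "finite \<beta>" "\<alpha> \<inter> \<alpha>' = {}"
  shows "gsign (\<alpha> \<union> \<alpha>') \<beta> = gsign \<alpha> \<beta> * gsign \<alpha>' \<beta>"
proof -
  let ?S = "\<lambda>\<alpha>. {(i, j). i \<in> \<alpha> \<and> j \<in> \<beta> \<and> j < i}"
  have fin: "finite (?S \<alpha>)" if "finite \<alpha>" for \<alpha>
    by (rule finite_subset[of _ "\<alpha> \<times> \<beta>"]) (use assms that in auto)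
  have "card (?S (\<alpha> \<union> \<alpha>')) = card (?S \<alpha> \<union> ?S \<alpha>')" by (rule arg_cong[of _ _ card]) auto
  also have "\<dots> = card (?S \<alpha>) + card (?S \<alpha>')"
    by (rule card_Un_disjoint) (use assms fin in auto)
  finally show ?thesis by (simp add: gsign_def power_add)
qed

lemma gsign_Un_right:
  assumes "finite \<alpha>" "finite \<beta>" "finite \<beta>'" "\<beta> \<inter> \<beta>' = {}"
  shows "gsign \<alpha> (\<beta> \<union> \<beta>') = gsign \<alpha> \<beta> * gsign \<alpha> \<beta>'"
proof -
  let ?S = "\<lambda>\<beta>. {(i, j). i \<in> \<alpha> \<and> j \<in> \<beta> \<and> j < i}"
  have fin: "finite (?S \<beta>)" if "finite \<beta>" for \<beta>
    by (rule finite_subset[of _ "\<alpha> \<times> \<beta>"]) (use assms that in auto)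
  have "card (?S (\<beta> \<union> \<beta>')) = card (?S \<beta> \<union> ?S \<beta>')" by (rule arg_cong[of _ _ card]) auto
  also have "\<dots> = card (?S \<beta>) + card (?S \<beta>')"
    by (rule card_Un_disjoint) (use assms fin in auto)
  finally show ?thesis by (simp add: gsign_def power_add)
qed

lemma gsign_square [simp]: "gsign \<alpha> \<beta> * gsign \<alpha> \<beta> = 1"
  by (simp add: gsign_def power_mult_distrib[symmetric])

lemma gsign_square' [simp]: "gsign \<alpha> \<beta> * (gsign \<alpha> \<beta> * c) = c"
  by (simp add: mult.assoc[symmetric])

text \<open>Since the sets are disjoint, each pair in \<alpha> \<times> \<beta> is an inversion for
  exactly one of the two orders, so the two inversion counts add up to
  \<open>card \<alpha> * card \<beta>\<close>.\<close>

lemma gsign_swap: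
  assumes "finite \<alpha>" "finite \<beta>" "\<alpha> \<inter> \<beta> = {}"
  shows "gsign \<beta> \<alpha> = (- 1) ^ (card \<alpha> * card \<beta>) * gsign \<alpha> \<beta>"
proof -
  let ?S = "\<lambda>\<alpha> \<beta>. {(i, j). i \<in> \<alpha> \<and> j \<in> \<beta> \<and> j < (i::nat)}"
  have ne: "i \<noteq> j" if "i \<in> \<alpha>" "j \<in> \<beta>" for i j
    using assms(3) that by auto
  have "(i, j) \<in> (\<lambda>(i, j). (j, i)) ` ?S \<beta> \<alpha> \<union> ?S \<alpha> \<beta>" if "i \<in> \<alpha>" "j \<in> \<beta>" for i j
  proof (cases "j < i")
    case False
    then have "(j, i) \<in> ?S \<beta> \<alpha>" using that ne[OF that] by simp
    then show ?thesis by force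
  qed (use that in simp)
  then have "(\<lambda>(i, j). (j, i)) ` ?S \<beta> \<alpha> \<union> ?S \<alpha> \<beta> = \<alpha> \<times> \<beta>"
    by auto
  then have "card \<alpha> * card \<beta> = card ((\<lambda>(i, j). (j, i)) ` ?S \<beta> \<alpha> \<union> ?S \<alpha> \<beta>)"
    by (simp add: card_cartesian_product)
  also have "\<dots> = card ((\<lambda>(i, j). (j, i)) ` ?S \<beta> \<alpha>) + card (?S \<alpha> \<beta>)"
  proof (rule card_Un_disjoint)
    show "finite (?S \<alpha> \<beta>)" by (rule finite_subset[of _ "\<alpha> \<times> \<beta>"]) (use assms in auto)
    have "finite (?S \<beta> \<alpha>)" by (rule finite_subset[of _ "\<beta> \<times> \<alpha>"]) (use assms in auto)
    then show "finite ((\<lambda>(i, j). (j, i)) ` ?S \<beta> \<alpha>)" by (rule finite_imageI)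
  qed auto
  also have "card ((\<lambda>(i, j). (j, i)) ` ?S \<beta> \<alpha>) = card (?S \<beta> \<alpha>)"
    by (rule card_image) (auto simp: inj_on_def)
  finally have "card (?S \<beta> \<alpha>) + card (?S \<alpha> \<beta>) = card \<alpha> * card \<beta>" by simp
  then have "gsign \<beta> \<alpha> * gsign \<alpha> \<beta> = ((- 1) ^ (card \<alpha> * card \<beta>) :: 'a)"
    by (simp add: gsign_def flip: power_add)
  then have "gsign \<beta> \<alpha> * gsign \<alpha> \<beta> * gsign \<alpha> \<beta> = ((- 1) ^ (card \<alpha> * card \<beta>) * gsign \<alpha> \<beta> :: 'a)"
    by simp
  then show ?thesis by (simp add: mult.assoc)
qed

lemma gsign_less:
  assumes "\<And>i j. i \<in> \<alpha> \<Longrightarrow> j \<in> \<beta> \<Longrightarrow> i < j"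
  shows "gsign \<alpha> \<beta> = 1"
proof -
  have "{(i, j). i \<in> \<alpha> \<and> j \<in> \<beta> \<and> j < i} = {}" using assms by force
  then show ?thesis unfolding gsign_def by (metis card.empty power_0)
qed

lemma gsign_greater:
  assumes "\<And>i j. i \<in> \<alpha> \<Longrightarrow> j \<in> \<beta> \<Longrightarrow> j < i"
  shows "gsign \<alpha> \<beta> = (- 1) ^ (card \<alpha> * card \<beta>)"
proof -
  have "{(i, j). i \<in> \<alpha> \<and> j \<in> \<beta> \<and> j < i} = \<alpha> \<times> \<beta>" using assms by auto
  then show ?thesis by (simp add: gsign_def card_cartesian_product)
qed

text \<open>
  One type for all \<open>n\<close>, so that type class algebra applies; \<open>\<Lambda>\<^sub>n\<close> is its subalgebra \<open>grn n\<close>, defined below.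
  (Series in infinitely many monomials are allowed, but never used.)
\<close>

typedef (overloaded) 'a gr = "{a :: nat set \<Rightarrow> 'a::comm_ring_1. \<forall>\<alpha>. infinite \<alpha> \<longrightarrow> a \<alpha> = 0}"
  morphisms cf Gr
  by (rule exI[of _ "\<lambda>_. 0"]) simp

lemma cf_infinite: "infinite \<alpha> \<Longrightarrow> cf a \<alpha> = 0"
  using cf[of a] by simp

lemma cf_Gr: "(\<And>\<alpha>. infinite \<alpha> \<Longrightarrow> a \<alpha> = 0) \<Longrightarrow> cf (Gr a) = a"
  by (rule Gr_inverse) simp

lemma gr_eqI: "(\<And>\<alpha>. finite \<alpha> \<Longrightarrow> cf a \<alpha> = cf b \<alpha>) \<Longrightarrow> a = b"
  by (metis cf_infinite cf_inject ext)

instantiation gr :: (comm_ring_1) ring_1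
begin

definition "0 = Gr (\<lambda>_. 0)"
definition "1 = Gr (gmonom {})"
definition "a + b = Gr (\<lambda>\<alpha>. cf a \<alpha> + cf b \<alpha>)"
definition "a - b = Gr (\<lambda>\<alpha>. cf a \<alpha> - cf b \<alpha>)"
definition "- a = Gr (\<lambda>\<alpha>. - cf a \<alpha>)"
definition "a * b = Gr (\<lambda>\<gamma>. \<Sum>\<alpha>\<in>Pow \<gamma>. gsign \<alpha> (\<gamma> - \<alpha>) * cf a \<alpha> * cf b (\<gamma> - \<alpha>))"

lemma cf_zero [simp]: "cf 0 = (\<lambda>_. 0)"
  unfolding zero_gr_def by (rule cf_Gr) simp

lemma cf_one: "cf 1 = gmonom {}"
  unfolding one_gr_def by (rule cf_Gr) (auto simp: gmonom_def)

lemma cf_plus [simp]: "cf (a + b) = (\<lambda>\<alpha>. cf a \<alpha> + cf b \<alpha>)"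
  unfolding plus_gr_def by (rule cf_Gr) (simp add: cf_infinite)

lemma cf_minus [simp]: "cf (a - b) = (\<lambda>\<alpha>. cf a \<alpha> - cf b \<alpha>)"
  unfolding minus_gr_def by (rule cf_Gr) (simp add: cf_infinite)

lemma cf_uminus [simp]: "cf (- a) = (\<lambda>\<alpha>. - cf a \<alpha>)"
  unfolding uminus_gr_def by (rule cf_Gr) (simp add: cf_infinite)

lemma cf_times: "cf (a * b) = (\<lambda>\<gamma>. \<Sum>\<alpha>\<in>Pow \<gamma>. gsign \<alpha> (\<gamma> - \<alpha>) * cf a \<alpha> * cf b (\<gamma> - \<alpha>))"
  unfolding times_gr_def by (rule cf_Gr) (simp add: finite_Pow_iff)

instance
proof
  fix a b c :: "'a gr"
  show "a + b + c = a + (b + c)" "a + b = b + a" "0 + a = a" "- a + a = 0" "a - b = a + - b"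
    by (rule gr_eqI; simp add: algebra_simps)+
  show "(a + b) * c = a * c + b * c" "a * (b + c) = a * b + a * c"
    by (rule gr_eqI; simp add: cf_times algebra_simps sum.distrib)+
  show "(0::'a gr) \<noteq> 1"
  proof
    assume "(0::'a gr) = 1"
    then have "cf (0::'a gr) {} = cf (1::'a gr) {}" by simp
    then show False by (simp add: cf_one gmonom_def)
  qed
  show "1 * a = a"
  proof (rule gr_eqI)
    fix \<gamma> :: "nat set" assume "finite \<gamma>"
    then have "cf (1 * a) \<gamma> = (\<Sum>\<alpha>\<in>{{}}. gsign \<alpha> (\<gamma> - \<alpha>) * cf 1 \<alpha> * cf a (\<gamma> - \<alpha>))"
      unfolding cf_times by (intro sum.mono_neutral_right) (auto simp: cf_one gmonom_def)
    then show "cf (1 * a) \<gamma> = cf a \<gamma>" by (simp add: cf_one gmonom_def)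
  qed
  show "a * 1 = a"
  proof (rule gr_eqI)
    fix \<gamma> :: "nat set" assume "finite \<gamma>"
    then have "cf (a * 1) \<gamma> = (\<Sum>\<alpha>\<in>{\<gamma>}. gsign \<alpha> (\<gamma> - \<alpha>) * cf a \<alpha> * cf 1 (\<gamma> - \<alpha>))"
      unfolding cf_times by (intro sum.mono_neutral_right) (auto simp: cf_one gmonom_def)
    then show "cf (a * 1) \<gamma> = cf a \<gamma>" by (simp add: cf_one gmonom_def)
  qed
  show "a * b * c = a * (b * c)"
  proof (rule gr_eqI)
    fix \<gamma> :: "nat set" assume \<gamma>: "finite \<gamma>"
    let ?s = "gsign :: nat set \<Rightarrow> nat set \<Rightarrow> 'a"
    have "cf (a * b * c) \<gamma> = (\<Sum>\<delta>\<in>Pow \<gamma>. \<Sum>\<alpha>\<in>Pow \<delta>.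
        ?s \<delta> (\<gamma> - \<delta>) * ?s \<alpha> (\<delta> - \<alpha>) * cf a \<alpha> * cf b (\<delta> - \<alpha>) * cf c (\<gamma> - \<delta>))"
      by (simp add: cf_times sum_distrib_left sum_distrib_right mult.assoc)
    also have "\<dots> = (\<Sum>(\<delta>, \<alpha>)\<in>Sigma (Pow \<gamma>) Pow.
        ?s \<delta> (\<gamma> - \<delta>) * ?s \<alpha> (\<delta> - \<alpha>) * cf a \<alpha> * cf b (\<delta> - \<alpha>) * cf c (\<gamma> - \<delta>))"
      by (rule sum.Sigma) (use \<gamma> in \<open>auto intro: finite_subset\<close>)
    also have "\<dots> = (\<Sum>(\<alpha>, \<beta>)\<in>Sigma (Pow \<gamma>) (\<lambda>\<alpha>. Pow (\<gamma> - \<alpha>)).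
        ?s \<alpha> (\<gamma> - \<alpha>) * ?s \<beta> (\<gamma> - \<alpha> - \<beta>) * cf a \<alpha> * cf b \<beta> * cf c (\<gamma> - \<alpha> - \<beta>))"
    \<comment> \<open>Both sums run over the ways to cut \<gamma> into three ordered disjoint parts;
      (\<delta>, \<alpha>) encodes the parts \<alpha>, \<delta> - \<alpha>, \<gamma> - \<delta>.
      Either bracketing has as its sign the product of the three pairwise signs.\<close>
    proof (rule sum.reindex_bij_witness[where i = "\<lambda>(\<alpha>, \<beta>). (\<alpha> \<union> \<beta>, \<alpha>)" and j = "\<lambda>(\<delta>, \<alpha>). (\<alpha>, \<delta> - \<alpha>)"])
      fix p assume "p \<in> Sigma (Pow \<gamma>) Pow"
      then obtain \<delta> \<alpha> where p: "p = (\<delta>, \<alpha>)" "\<delta> \<subseteq> \<gamma>" "\<alpha> \<subseteq> \<delta>" by auto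
      have fin: "finite \<alpha>" "finite \<delta>" using p \<gamma> by (auto intro: finite_subset)
      have "?s \<delta> (\<gamma> - \<delta>) = ?s \<alpha> (\<gamma> - \<delta>) * ?s (\<delta> - \<alpha>) (\<gamma> - \<delta>)"
        using gsign_Un_left[of \<alpha> "\<delta> - \<alpha>" "\<gamma> - \<delta>"] p fin \<gamma> by (auto simp: Un_absorb1)
      moreover have "?s \<alpha> (\<gamma> - \<alpha>) = ?s \<alpha> (\<delta> - \<alpha>) * ?s \<alpha> (\<gamma> - \<delta>)"
      proof -
        have "\<gamma> - \<alpha> = (\<delta> - \<alpha>) \<union> (\<gamma> - \<delta>)" using p by auto
        then show ?thesis using gsign_Un_right[of \<alpha> "\<delta> - \<alpha>" "\<gamma> - \<delta>"] fin \<gamma> by auto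
      qed
      moreover have "\<gamma> - \<alpha> - (\<delta> - \<alpha>) = \<gamma> - \<delta>" using p by auto
      ultimately show "(case case p of (\<delta>, \<alpha>) \<Rightarrow> (\<alpha>, \<delta> - \<alpha>) of (\<alpha>, \<beta>) \<Rightarrow>
          ?s \<alpha> (\<gamma> - \<alpha>) * ?s \<beta> (\<gamma> - \<alpha> - \<beta>) * cf a \<alpha> * cf b \<beta> * cf c (\<gamma> - \<alpha> - \<beta>)) =
        (case p of (\<delta>, \<alpha>) \<Rightarrow> ?s \<delta> (\<gamma> - \<delta>) * ?s \<alpha> (\<delta> - \<alpha>) * cf a \<alpha> * cf b (\<delta> - \<alpha>) * cf c (\<gamma> - \<delta>))"
        by (simp add: p mult_ac)
    qed auto
    also have "\<dots> = (\<Sum>\<alpha>\<in>Pow \<gamma>. \<Sum>\<beta>\<in>Pow (\<gamma> - \<alpha>).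
        ?s \<alpha> (\<gamma> - \<alpha>) * ?s \<beta> (\<gamma> - \<alpha> - \<beta>) * cf a \<alpha> * cf b \<beta> * cf c (\<gamma> - \<alpha> - \<beta>))"
      by (rule sum.Sigma[symmetric]) (use \<gamma> in auto)
    also have "\<dots> = cf (a * (b * c)) \<gamma>"
      by (simp add: cf_times sum_distrib_left mult_ac)
    finally show "cf (a * b * c) \<gamma> = cf (a * (b * c)) \<gamma>" .
  qed
qed

end

lemma cf_sum: "cf (sum f A) \<alpha> = (\<Sum>x\<in>A. cf (f x) \<alpha>)"
  by (induction A rule: infinite_finite_induct) auto

section \<open>Monomials and scalars\<close>

definition xpow :: "nat set \<Rightarrow> 'a::comm_ring_1 gr" where
  "xpow \<alpha> = Gr (gmonom \<alpha>)"

abbreviation xvar :: "nat \<Rightarrow> 'a::comm_ring_1 gr" where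
  "xvar i \<equiv> xpow {i}"

text \<open>Scalars are elements of the algebra, so scalar multiplication is an ordinary product and
  linearity of a map becomes a statement about products.\<close>

definition sc :: "'a \<Rightarrow> 'a::comm_ring_1 gr" where
  "sc c = Gr (\<lambda>\<alpha>. c * gmonom {} \<alpha>)"

lemma cf_xpow: "finite \<alpha> \<Longrightarrow> cf (xpow \<alpha>) \<beta> = (if \<beta> = \<alpha> then 1 else 0)"
  unfolding xpow_def by (subst cf_Gr) (auto simp: gmonom_def)

lemma cf_sc: "cf (sc c) \<beta> = (if \<beta> = {} then c else 0)"
  unfolding sc_def by (subst cf_Gr) (auto simp: gmonom_def)

lemma xpow_empty: "xpow {} = 1"
  by (rule gr_eqI) (simp add: cf_xpow cf_one gmonom_def)

lemma cf_sc_mult [simp]: "cf (sc c * a) \<beta> = c * cf a \<beta>"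
proof (cases "finite \<beta>")
  case True
  then have "cf (sc c * a) \<beta> = (\<Sum>\<alpha>\<in>{{}}. gsign \<alpha> (\<beta> - \<alpha>) * cf (sc c) \<alpha> * cf a (\<beta> - \<alpha>))"
    unfolding cf_times by (intro sum.mono_neutral_right) (auto simp: cf_sc)
  then show ?thesis by (simp add: cf_sc)
qed (simp add: cf_infinite)

lemma mult_sc: "a * sc c = sc c * a"
proof (rule gr_eqI)
  fix \<beta> :: "nat set" assume "finite \<beta>"
  then have "cf (a * sc c) \<beta> = (\<Sum>\<alpha>\<in>{\<beta>}. gsign \<alpha> (\<beta> - \<alpha>) * cf a \<alpha> * cf (sc c) (\<beta> - \<alpha>))"
    unfolding cf_times by (intro sum.mono_neutral_right) (auto simp: cf_sc)
  then show "cf (a * sc c) \<beta> = cf (sc c * a) \<beta>" by (simp add: cf_sc mult.commute)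
qed

lemma sc_mult: "a * (sc c * b) = sc c * (a * b)"
  by (metis mult.assoc mult_sc)

lemma sc_simps: "sc 0 = 0" "sc 1 = 1" "sc (c + d) = sc c + sc d" "sc (c * d) = sc c * sc d" "sc (- c) = - sc c"
    "sc (c - d) = sc c - sc d"
  by (rule gr_eqI; simp add: cf_sc cf_one gmonom_def)+

lemma sc_mult_sc: "(sc c * a) * (sc d * b) = sc (c * d) * (a * b)"
proof -
  have "(sc c * a) * (sc d * b) = sc c * (a * (sc d * b))" by (rule mult.assoc)
  also have "\<dots> = sc c * (sc d * (a * b))" by (simp only: sc_mult[of a d b])
  finally show ?thesis by (simp add: sc_simps mult.assoc)
qed

lemma xpow_mult:
  assumes "finite \<alpha>" "finite \<beta>"
  shows "xpow \<alpha> * xpow \<beta> = (if \<alpha> \<inter> \<beta> = {} then sc (gsign \<alpha> \<beta>) * xpow (\<alpha> \<union> \<beta>) else 0)"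
proof (rule gr_eqI)
  fix \<gamma> :: "nat set" assume \<gamma>: "finite \<gamma>"
  have *: "gsign \<delta> (\<gamma> - \<delta>) * cf (xpow \<alpha>) \<delta> * cf (xpow \<beta>) (\<gamma> - \<delta>) =
      (if \<delta> = \<alpha> then gsign \<alpha> (\<gamma> - \<alpha>) * (if \<gamma> - \<alpha> = \<beta> then 1 else 0 :: 'a) else 0)" for \<delta>
    using assms by (simp add: cf_xpow)
  have "cf (xpow \<alpha> * xpow \<beta>) \<gamma> = (if \<alpha> \<subseteq> \<gamma> \<and> \<gamma> - \<alpha> = \<beta> then gsign \<alpha> \<beta> else 0 :: 'a)"
    unfolding cf_times * using \<gamma> by (auto simp: sum.delta)
  moreover have "\<alpha> \<subseteq> \<gamma> \<and> \<gamma> - \<alpha> = \<beta> \<longleftrightarrow> \<alpha> \<inter> \<beta> = {} \<and> \<gamma> = \<alpha> \<union> \<beta>" by auto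
  ultimately show "cf (xpow \<alpha> * xpow \<beta>) \<gamma> = 
      cf (if \<alpha> \<inter> \<beta> = {} then sc (gsign \<alpha> \<beta>) * xpow (\<alpha> \<union> \<beta>) else 0 :: 'a gr) \<gamma>"
    using assms by (auto simp: cf_xpow)
qed

section \<open>Even and odd elements\<close>

definition evn :: "'a::comm_ring_1 gr \<Rightarrow> bool" where
  "evn a \<longleftrightarrow> (\<forall>\<alpha>. odd (card \<alpha>) \<longrightarrow> cf a \<alpha> = 0)"

definition odn :: "'a::comm_ring_1 gr \<Rightarrow> bool" where
  "odn a \<longleftrightarrow> (\<forall>\<alpha>. even (card \<alpha>) \<longrightarrow> cf a \<alpha> = 0)"

text \<open>Passing to complements lists the coefficient of \<open>b * a\<close> over the same
  decompositions as that of \<open>a * b\<close>, at the price of the sign from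
  \<open>gsign_swap\<close>. Both orders can then be compared term by term.\<close>

lemma cf_times_swap:
  assumes "finite \<gamma>"
  shows "cf (b * a) \<gamma> = (\<Sum>\<alpha>\<in>Pow \<gamma>. (- 1) ^ (card \<alpha> * card (\<gamma> - \<alpha>)) * (gsign \<alpha> (\<gamma> - \<alpha>) * cf a \<alpha> * cf b (\<gamma> - \<alpha>)))"
  unfolding cf_times
proof (rule sum.reindex_bij_witness[where i = "\<lambda>\<alpha>. \<gamma> - \<alpha>" and j = "\<lambda>\<alpha>. \<gamma> - \<alpha>"])
  fix \<alpha> assume "\<alpha> \<in> Pow \<gamma>"
  then have *: "\<gamma> - (\<gamma> - \<alpha>) = \<alpha>" "finite \<alpha>" using assms by (auto intro: finite_subset)
  have sw: "gsign \<alpha> (\<gamma> - \<alpha>) = (- 1) ^ (card (\<gamma> - \<alpha>) * card \<alpha>) * (gsign (\<gamma> - \<alpha>) \<alpha> :: 'a)"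
    by (rule gsign_swap) (use assms *(2) in auto)
  show "(- 1) ^ (card (\<gamma> - \<alpha>) * card (\<gamma> - (\<gamma> - \<alpha>))) *
      (gsign (\<gamma> - \<alpha>) (\<gamma> - (\<gamma> - \<alpha>)) * cf a (\<gamma> - \<alpha>) * cf b (\<gamma> - (\<gamma> - \<alpha>))) =
      gsign \<alpha> (\<gamma> - \<alpha>) * cf b \<alpha> * cf a (\<gamma> - \<alpha>)"
    unfolding * using sw by (simp add: mult_ac)
qed auto

lemma evn_commute: assumes "evn a" shows "a * b = b * a"
proof (rule gr_eqI)
  fix \<gamma> :: "nat set" assume "finite \<gamma>"
  then show "cf (a * b) \<gamma> = cf (b * a) \<gamma>"
    unfolding cf_times_swap[OF \<open>finite \<gamma>\<close>, of b a] cf_times[of a b]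
    by (intro sum.cong refl) (use assms in \<open>auto simp: evn_def minus_one_power_iff\<close>)
qed

lemma odn_anticommute: assumes "odn a" "odn b" shows "a * b = - (b * a)"
proof (rule gr_eqI)
  fix \<gamma> :: "nat set" assume "finite \<gamma>"
  then show "cf (a * b) \<gamma> = cf (- (b * a)) \<gamma>"
    unfolding cf_uminus cf_times_swap[OF \<open>finite \<gamma>\<close>, of b a] cf_times[of a b] sum_negf[symmetric]
    by (intro sum.cong refl) (use assms in \<open>auto simp: odn_def minus_one_power_iff\<close>)
qed

text \<open>Anticommutation only gives 2 a^2 = 0, which is too weak over a general ring. Instead the
  terms at \<alpha> and at \<gamma> - \<alpha> cancel in pairs.\<close>

lemma odn_square: assumes "odn a" shows "a * a = 0"
proof (rule gr_eqI)
  fix \<gamma> :: "nat set" assume \<gamma>: "finite \<gamma>"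
  let ?f = "\<lambda>\<alpha>. gsign \<alpha> (\<gamma> - \<alpha>) * cf a \<alpha> * cf a (\<gamma> - \<alpha>)"
  have neg: "?f (\<gamma> - \<alpha>) = - ?f \<alpha>" if "\<alpha> \<subseteq> \<gamma>" for \<alpha>
  proof -
    have *: "\<gamma> - (\<gamma> - \<alpha>) = \<alpha>" "finite \<alpha>" using that \<gamma> by (auto intro: finite_subset)
    show ?thesis
    proof (cases "odd (card \<alpha>) \<and> odd (card (\<gamma> - \<alpha>))")
      case True
      have "gsign (\<gamma> - \<alpha>) \<alpha> = (- 1) ^ (card \<alpha> * card (\<gamma> - \<alpha>)) * (gsign \<alpha> (\<gamma> - \<alpha>) :: 'a)"
        by (rule gsign_swap) (use \<gamma> *(2) in auto)
      with True show ?thesis unfolding * by (simp add: mult_ac minus_one_power_iff)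
    next
      case False
      then have "cf a \<alpha> = 0 \<or> cf a (\<gamma> - \<alpha>) = 0" using assms by (auto simp: odn_def)
      then show ?thesis unfolding * by auto
    qed
  qed
  show "cf (a * a) \<gamma> = cf 0 \<gamma>"
  proof (cases "\<gamma> = {}")
    case True
    then show ?thesis using assms by (simp add: cf_times odn_def)
  next
    case False
    \<comment> \<open>Exactly one of \<alpha> and \<gamma> - \<alpha> contains \<open>m\<close>, so
      membership of \<open>m\<close> selects one term from each pair.\<close>
    then obtain m where m: "m \<in> \<gamma>" by auto
    let ?P = "{\<alpha>. \<alpha> \<subseteq> \<gamma> \<and> m \<in> \<alpha>}" and ?N = "{\<alpha>. \<alpha> \<subseteq> \<gamma> \<and> m \<notin> \<alpha>}"
    have "sum ?f ?N = (\<Sum>\<alpha>\<in>?P. ?f (\<gamma> - \<alpha>))"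
      by (rule sum.reindex_bij_witness[where i = "\<lambda>\<alpha>. \<gamma> - \<alpha>" and j = "\<lambda>\<alpha>. \<gamma> - \<alpha>"])
         (use m in \<open>auto simp: double_diff\<close>)
    also have "\<dots> = (\<Sum>\<alpha>\<in>?P. - ?f \<alpha>)" by (intro sum.cong refl neg) simp
    also have "\<dots> = - sum ?f ?P" by (rule sum_negf)
    finally have "sum ?f ?P + sum ?f ?N = 0" by simp
    moreover have "Pow \<gamma> = ?P \<union> ?N" by auto
    moreover have "sum ?f (?P \<union> ?N) = sum ?f ?P + sum ?f ?N"
      by (rule sum.union_disjoint) (use \<gamma> in auto)
    ultimately show ?thesis by (simp add: cf_times)
  qed
qed

text \<open>One nonzero summand is enough to read off parity, support and lowest degree of a
  product; all closure properties under multiplication are derived from it.\<close>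

lemma cf_times_parity:
  assumes "cf (a * b) \<gamma> \<noteq> 0"
  obtains \<alpha> \<beta> where "cf a \<alpha> \<noteq> 0" "cf b \<beta> \<noteq> 0" "\<alpha> \<inter> \<beta> = {}" "\<alpha> \<union> \<beta> = \<gamma>" "card \<gamma> = card \<alpha> + card \<beta>" "finite \<gamma>"
proof -
  have fin: "finite \<gamma>" using assms cf_infinite by blast
  obtain \<alpha> where \<alpha>: "\<alpha> \<subseteq> \<gamma>" "gsign \<alpha> (\<gamma> - \<alpha>) * cf a \<alpha> * cf b (\<gamma> - \<alpha>) \<noteq> 0"
    using assms unfolding cf_times by (meson PowD sum.not_neutral_contains_not_neutral)
  moreover have "card \<gamma> = card \<alpha> + card (\<gamma> - \<alpha>)"
    using card_Un_disjoint[of \<alpha> "\<gamma> - \<alpha>"] fin \<alpha>(1) finite_subset by (auto simp: Un_absorb1)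
  ultimately show ?thesis
    using fin by (intro that[of \<alpha> "\<gamma> - \<alpha>"]) auto
qed

lemma evn_mult: assumes "evn a" "evn b" shows "evn (a * b)"
  unfolding evn_def
proof (intro allI impI, rule ccontr)
  fix \<gamma> assume "odd (card \<gamma>)" "cf (a * b) \<gamma> \<noteq> 0"
  then show False by (elim cf_times_parity) (use assms in \<open>auto simp: evn_def\<close>)
qed

lemma evn_odn_mult: assumes "evn a" "odn b" shows "odn (a * b)"
  unfolding odn_def
proof (intro allI impI, rule ccontr)
  fix \<gamma> assume "even (card \<gamma>)" "cf (a * b) \<gamma> \<noteq> 0"
  then show False by (elim cf_times_parity) (use assms in \<open>auto simp: evn_def odn_def\<close>)
qed

lemma odn_odn_mult: assumes "odn a" "odn b" shows "evn (a * b)"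
  unfolding evn_def
proof (intro allI impI, rule ccontr)
  fix \<gamma> assume "odd (card \<gamma>)" "cf (a * b) \<gamma> \<noteq> 0"
  then show False by (elim cf_times_parity) (use assms in \<open>auto simp: odn_def\<close>)
qed

lemma odn_evn_mult: "odn a \<Longrightarrow> evn b \<Longrightarrow> odn (a * b)"
  by (metis evn_commute evn_odn_mult)

lemma evn_simps [simp]: "evn 0" "evn 1" "evn a \<Longrightarrow> evn b \<Longrightarrow> evn (a + b)" "evn a \<Longrightarrow> evn b \<Longrightarrow> evn (a - b)"
    "evn a \<Longrightarrow> evn (- a)" "evn (sc c)"
  by (auto simp: evn_def cf_one gmonom_def cf_sc)

lemma odn_simps [simp]: "odn 0" "odn a \<Longrightarrow> odn b \<Longrightarrow> odn (a + b)" "odn a \<Longrightarrow> odn b \<Longrightarrow> odn (a - b)"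
    "odn a \<Longrightarrow> odn (- a)" "odn a \<Longrightarrow> odn (sc c * a)"
  by (auto simp: odn_def)

lemma odn_xpow: assumes "odd (card \<alpha>)" shows "odn (xpow \<alpha>)"
proof -
  have "finite \<alpha>" using assms by (rule_tac ccontr) simp
  then show ?thesis using assms by (auto simp: odn_def cf_xpow)
qed

lemma xpow_insert_min:
  assumes "finite \<alpha>" "\<forall>j\<in>\<alpha>. i < j"
  shows "xpow (insert i \<alpha>) = (xvar i * xpow \<alpha> :: 'a::comm_ring_1 gr)"
proof -
  have "gsign {i} \<alpha> = (1::'a)" by (rule gsign_less) (use assms in auto)
  moreover have "i \<notin> \<alpha>" using assms by auto
  ultimately show ?thesis using xpow_mult[of "{i}" \<alpha>, where ?'a = 'a] assms(1) by (simp add: sc_simps)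
qed

lemma odn_sum: "(\<And>i. i \<in> A \<Longrightarrow> odn (f i)) \<Longrightarrow> odn (sum f A)"
  by (induction A rule: infinite_finite_induct) auto

lemma evn_sum: "(\<And>i. i \<in> A \<Longrightarrow> evn (f i)) \<Longrightarrow> evn (sum f A)"
  by (induction A rule: infinite_finite_induct) auto

text \<open>The even part is commutative, so that the library theory of determinants applies to it.\<close>

typedef (overloaded) 'a gev = "{a :: 'a::comm_ring_1 gr. evn a}"
  morphisms of_ev Ev
  by (rule exI[of _ 0]) simp

lemma evn_of_ev [simp]: "evn (of_ev a)"
  using of_ev[of a] by simp

lemma of_ev_Ev [simp]: "evn a \<Longrightarrow> of_ev (Ev a) = a"
  by (rule Ev_inverse) simp

instantiation gev :: (comm_ring_1) comm_ring_1
begin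

definition "0 = Ev 0"
definition "1 = Ev 1"
definition "a + b = Ev (of_ev a + of_ev b)"
definition "a - b = Ev (of_ev a - of_ev b)"
definition "- a = Ev (- of_ev a)"
definition "a * b = Ev (of_ev a * of_ev b)"

lemma of_ev_simps [simp]:
  "of_ev 0 = 0" "of_ev 1 = 1" "of_ev (a + b) = of_ev a + of_ev b" "of_ev (a - b) = of_ev a - of_ev b"
  "of_ev (- a) = - of_ev a" "of_ev (a * b) = of_ev a * of_ev b"
  by (simp_all add: zero_gev_def one_gev_def plus_gev_def minus_gev_def uminus_gev_def times_gev_def evn_mult)

instance
proof
  fix a b c :: "'a gev"
  show "a + b + c = a + (b + c)" "a + b = b + a" "0 + a = a" "- a + a = 0" "a - b = a + - b"
    "(a + b) * c = a * c + b * c" "1 * a = a" "a * b * c = a * (b * c)"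
    by (simp_all add: of_ev_inject[symmetric] algebra_simps)
  show "a * b = b * a" by (simp add: of_ev_inject[symmetric] evn_commute)
  show "(0::'a gev) \<noteq> 1" by (simp add: of_ev_inject[symmetric])
qed

end

lemma of_ev_sum: "of_ev (sum f A) = (\<Sum>x\<in>A. of_ev (f x))"
  by (induction A rule: infinite_finite_induct) auto

lemma of_ev_of_int [simp]: "of_ev (of_int k) = of_int k"
proof -
  have "of_ev (of_nat k) = of_nat k" for k by (induction k) auto
  then show ?thesis by (cases k rule: int_cases2) simp_all
qed

section \<open>Endomorphisms and skew derivations\<close>

definition grn :: "nat \<Rightarrow> 'a::comm_ring_1 gr \<Rightarrow> bool" where
  "grn n a \<longleftrightarrow> (\<forall>\<alpha>. \<not> \<alpha> \<subseteq> {1..n} \<longrightarrow> cf a \<alpha> = 0)"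

text \<open>This is the power m^d of the maximal ideal. Infinite sets have cardinality 0, but their
  coefficients vanish in any case.\<close>

definition fil :: "nat \<Rightarrow> 'a::comm_ring_1 gr \<Rightarrow> bool" where
  "fil d a \<longleftrightarrow> (\<forall>\<alpha>. card \<alpha> < d \<longrightarrow> cf a \<alpha> = 0)"

lemma grn_simps [simp]: "grn n 0" "grn n 1" "grn n a \<Longrightarrow> grn n b \<Longrightarrow> grn n (a + b)"
    "grn n a \<Longrightarrow> grn n b \<Longrightarrow> grn n (a - b)" "grn n a \<Longrightarrow> grn n (- a)" "grn n (sc c)"
  by (auto simp: grn_def cf_one gmonom_def cf_sc)

lemma grn_mult [simp]: assumes "grn n a" "grn n b" shows "grn n (a * b)"
  unfolding grn_def
proof (intro allI impI, rule ccontr)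
  fix \<gamma> assume "\<not> \<gamma> \<subseteq> {1..n}" "cf (a * b) \<gamma> \<noteq> 0"
  then show False by (elim cf_times_parity) (use assms in \<open>auto simp: grn_def\<close>)
qed

lemma grn_sum: "(\<And>i. i \<in> A \<Longrightarrow> grn n (f i)) \<Longrightarrow> grn n (sum f A)"
  by (induction A rule: infinite_finite_induct) auto

lemma grn_xpow: "\<alpha> \<subseteq> {1..n} \<Longrightarrow> grn n (xpow \<alpha>)"
  by (auto simp: grn_def cf_xpow finite_subset)

lemma grn_expand:
  assumes "grn n a"
  shows "a = (\<Sum>\<alpha>\<in>Pow {1..n}. sc (cf a \<alpha>) * xpow \<alpha>)"
proof (rule gr_eqI)
  fix \<beta> :: "nat set" assume \<beta>: "finite \<beta>"
  have "(\<Sum>\<alpha>\<in>Pow {1..n}. cf a \<alpha> * cf (xpow \<alpha>) \<beta>) = (\<Sum>\<alpha>\<in>Pow {1..n}. if \<beta> = \<alpha> then cf a \<alpha> else 0)"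
    by (intro sum.cong refl) (auto simp: cf_xpow finite_subset)
  also have "\<dots> = cf a \<beta>" using assms by (auto simp: sum.delta grn_def)
  finally show "cf a \<beta> = cf (\<Sum>\<alpha>\<in>Pow {1..n}. sc (cf a \<alpha>) * xpow \<alpha>) \<beta>" by (simp add: cf_sum)
qed

lemma fil_simps [simp]: "fil d 0" "fil 0 a" "fil d a \<Longrightarrow> fil d b \<Longrightarrow> fil d (a + b)"
    "fil d a \<Longrightarrow> fil d b \<Longrightarrow> fil d (a - b)" "fil d a \<Longrightarrow> fil d (- a)" "fil d a \<Longrightarrow> fil d (sc c * a)"
  by (auto simp: fil_def)

lemma fil_antimono: "fil d a \<Longrightarrow> e \<le> d \<Longrightarrow> fil e a"
  by (auto simp: fil_def)

lemma fil_mult: assumes "fil d a" "fil e b" shows "fil (d + e) (a * b)"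
  unfolding fil_def
proof (intro allI impI, rule ccontr)
  fix \<gamma> assume *: "card \<gamma> < d + e" "cf (a * b) \<gamma> \<noteq> 0"
  from *(2) show False
  proof (rule cf_times_parity)
    fix \<alpha> \<beta> assume "cf a \<alpha> \<noteq> 0" "cf b \<beta> \<noteq> 0" "card \<gamma> = card \<alpha> + card \<beta>"
    then have "d \<le> card \<alpha>" "e \<le> card \<beta>" using assms by (auto simp: fil_def not_less[symmetric])
    then show False using * \<open>card \<gamma> = _\<close> by simp
  qed
qed

lemma fil_mult_left: "fil d b \<Longrightarrow> fil d (a * b)"
  using fil_mult[of 0 a d b] by simp

lemma fil_mult_right: "fil d a \<Longrightarrow> fil d (a * b)"
  using fil_mult[of d a 0 b] by simp

lemma fil_sum: "(\<And>i. i \<in> A \<Longrightarrow> fil d (f i)) \<Longrightarrow> fil d (sum f A)"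
  by (induction A rule: infinite_finite_induct) auto

lemma fil_xpow: "finite \<alpha> \<Longrightarrow> d \<le> card \<alpha> \<Longrightarrow> fil d (xpow \<alpha>)"
  by (auto simp: fil_def cf_xpow)

lemma odn_fil_1: "odn a \<Longrightarrow> fil 1 a"
  by (auto simp: odn_def fil_def)

section \<open>Substitution of odd elements for the variables\<close>

text \<open>The image of \<open>xpow \<alpha>\<close> when each variable is replaced by
  \<open>y i\<close>. The factors do not commute, so the product is taken along the sorted
  list.\<close>

definition ypow :: "(nat \<Rightarrow> 'a::comm_ring_1 gr) \<Rightarrow> nat set \<Rightarrow> 'a gr" where
  "ypow y \<alpha> = prod_list (map y (sorted_list_of_set \<alpha>))"

lemma ypow_empty [simp]: "ypow y {} = 1"
  by (simp add: ypow_def)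

lemma ypow_insert_min:
  assumes "finite \<alpha>" "\<forall>j\<in>\<alpha>. i < j"
  shows "ypow y (insert i \<alpha>) = y i * ypow y \<alpha>"
proof -
  have "Min (insert i \<alpha>) = i" using assms by (intro Min_eqI) (auto intro: less_imp_le)
  moreover have "insert i \<alpha> - {i} = \<alpha>" using assms by auto
  ultimately have "sorted_list_of_set (insert i \<alpha>) = i # sorted_list_of_set \<alpha>"
    using sorted_list_of_set_nonempty[of "insert i \<alpha>"] assms by simp
  then show ?thesis by (simp add: ypow_def)
qed

lemma gsign_insert_right:
  assumes "finite \<alpha>" "finite \<beta>" "i \<notin> \<beta>"
  shows "gsign \<alpha> (insert i \<beta>) = gsign \<alpha> {i} * gsign \<alpha> \<beta>"
  using gsign_Un_right[of \<alpha> "{i}" \<beta>] assms by auto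

lemma gsign_insert_left:
  assumes "finite \<alpha>" "finite \<beta>" "i \<notin> \<alpha>"
  shows "gsign (insert i \<alpha>) \<beta> = gsign {i} \<beta> * gsign \<alpha> \<beta>"
  using gsign_Un_left[of "{i}" \<alpha> \<beta>] assms by auto

text \<open>The factor \<open>y i\<close> is moved to its place by exchanges with the smaller
  factors, each giving a sign; if it meets a copy of itself the square is zero. Splitting off the
  smallest element of \<beta> leaves at most one exchange per step.\<close>

lemma ypow_left:
  assumes y: "\<And>i. odn (y i)" and "finite \<beta>"
  shows "y i * ypow y \<beta> = (if i \<in> \<beta> then 0 else sc (gsign {i} \<beta>) * ypow y (insert i \<beta>))"
  using assms(2)
proof (induction \<beta> rule: finite_linorder_min_induct)
  case empty
  then show ?case using ypow_insert_min[of "{}" i y] by (simp add: sc_simps)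
next
  case (insert m \<beta>)
  then have m: "m \<notin> \<beta>" by auto
  consider "i < m" | "i = m" | "m < i" by linarith
  then show ?case
  proof cases
    case 1
    then have "i \<notin> insert m \<beta>" "\<forall>j\<in>insert m \<beta>. i < j" using insert by force+
    moreover have "gsign {i} (insert m \<beta>) = (1::'a)" by (rule gsign_less) (use calculation in auto)
    ultimately show ?thesis
      using ypow_insert_min[of "insert m \<beta>" i y] insert by (simp add: sc_simps)
  next
    case 2
    have "y i * ypow y (insert m \<beta>) = y i * y i * ypow y \<beta>"
      using ypow_insert_min[of \<beta> m y] insert.hyps 2 by (simp add: mult.assoc)
    then show ?thesis using odn_square[OF y, of i] 2 by simp
  next
    case 3
    have "y i * ypow y (insert m \<beta>) = - (y m * (y i * ypow y \<beta>))"
      using insert.hyps odn_anticommute[OF y y, of i m] by (simp add: ypow_insert_min mult.assoc[symmetric])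
    also have "\<dots> = (if i \<in> insert m \<beta> then 0 else sc (gsign {i} (insert m \<beta>)) * ypow y (insert i (insert m \<beta>)))"
    proof (cases "i \<in> \<beta>")
      case True
      then show ?thesis using insert.IH by simp
    next
      case False
      have "gsign {i} {m} = - (1::'a)" using gsign_greater[of "{i}" "{m}", where ?'a = 'a] 3 by simp
      then have "gsign {i} (insert m \<beta>) = - (gsign {i} \<beta> :: 'a)"
        using gsign_insert_right[of "{i}" \<beta> m, where ?'a = 'a] insert m by simp
      moreover have "ypow y (insert m (insert i \<beta>)) = y m * ypow y (insert i \<beta>)"
        using insert 3 by (intro ypow_insert_min) auto
      ultimately show ?thesis
        using insert.IH False 3 by (simp add: insert_commute sc_mult sc_simps)
    qed
    finally show ?thesis .
  qed
qed

text \<open>Odd elements obey the defining relations of the variables, so their ordered products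
  multiply with the same signs as monomials.\<close>

lemma ypow_mult:
  assumes y: "\<And>i. odn (y i)" and "finite \<alpha>" "finite \<beta>"
  shows "ypow y \<alpha> * ypow y \<beta> = (if \<alpha> \<inter> \<beta> = {} then sc (gsign \<alpha> \<beta>) * ypow y (\<alpha> \<union> \<beta>) else 0)"
  using assms(2)
proof (induction \<alpha> rule: finite_linorder_min_induct)
  case empty
  then show ?case by (simp add: sc_simps)
next
  case (insert m \<alpha>)
  then have m: "m \<notin> \<alpha>" by auto
  have eq: "ypow y (insert m \<alpha>) * ypow y \<beta> = y m * (ypow y \<alpha> * ypow y \<beta>)"
    using insert by (simp add: ypow_insert_min mult.assoc)
  show ?case
  proof (cases "\<alpha> \<inter> \<beta> = {}")
    case False
    then show ?thesis using eq insert.IH by auto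
  next
    case True
    then have "ypow y (insert m \<alpha>) * ypow y \<beta> = sc (gsign \<alpha> \<beta>) * (y m * ypow y (\<alpha> \<union> \<beta>))"
      using eq insert.IH by (simp add: sc_mult)
    also have "\<dots> = (if m \<in> \<beta> then 0 else
        sc (gsign \<alpha> \<beta> * gsign {m} (\<alpha> \<union> \<beta>)) * ypow y (insert m (\<alpha> \<union> \<beta>)))"
      using ypow_left[of y "\<alpha> \<union> \<beta>" m, OF y] insert assms(3) m by (simp add: sc_simps mult.assoc)
    also have "gsign {m} (\<alpha> \<union> \<beta>) = (gsign {m} \<beta> :: 'a)"
      using gsign_Un_right[of "{m}" \<alpha> \<beta>, where ?'a = 'a] True insert assms(3) gsign_less[of "{m}" \<alpha>, where ?'a = 'a] by simp
    also have "gsign \<alpha> \<beta> * gsign {m} \<beta> = (gsign (insert m \<alpha>) \<beta> :: 'a)"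
      using gsign_insert_left[of \<alpha> \<beta> m, where ?'a = 'a] insert m assms(3) by (simp add: mult.commute)
    finally show ?thesis using True by (simp add: insert_Diff_if)
  qed
qed

lemma ypow_xvar: "finite \<alpha> \<Longrightarrow> ypow xvar \<alpha> = (xpow \<alpha> :: 'a::comm_ring_1 gr)"
proof (induction \<alpha> rule: finite_linorder_min_induct)
  case empty
  then show ?case by (simp add: xpow_empty)
next
  case (insert m \<alpha>)
  then show ?case by (simp only: ypow_insert_min xpow_insert_min)
qed

lemma ypow_cong: "(\<And>i. i \<in> \<alpha> \<Longrightarrow> y i = z i) \<Longrightarrow> ypow y \<alpha> = ypow z \<alpha>"
  unfolding ypow_def by (cases "finite \<alpha>") (auto intro!: arg_cong[of _ _ prod_list])

definition ghom :: "('a::comm_ring_1 gr \<Rightarrow> 'a gr) \<Rightarrow> bool" where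
  "ghom \<tau> \<longleftrightarrow> (\<forall>a b. \<tau> (a + b) = \<tau> a + \<tau> b) \<and> (\<forall>a b. \<tau> (a * b) = \<tau> a * \<tau> b) \<and> \<tau> 1 = 1 \<and>
     (\<forall>c. \<tau> (sc c) = sc c)"

lemma ghomD:
  assumes "ghom \<tau>"
  shows "\<tau> (a + b) = \<tau> a + \<tau> b" "\<tau> (a * b) = \<tau> a * \<tau> b" "\<tau> 1 = 1" "\<tau> (sc c) = sc c"
    "\<tau> 0 = 0" "\<tau> (- a) = - \<tau> a" "\<tau> (a - b) = \<tau> a - \<tau> b"
proof -
  show *: "\<tau> (a + b) = \<tau> a + \<tau> b" "\<tau> (a * b) = \<tau> a * \<tau> b" "\<tau> 1 = 1" "\<tau> (sc c) = sc c" for a b c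
    using assms by (auto simp: ghom_def)
  show 0: "\<tau> 0 = 0" using *(4)[of 0] by (simp add: sc_simps)
  show neg: "\<tau> (- a) = - \<tau> a" for a
    using *(1)[of a "- a"] 0 by (simp add: eq_neg_iff_add_eq_0 add.commute)
  show "\<tau> (a - b) = \<tau> a - \<tau> b" using *(1)[of a "- b"] neg by simp
qed

lemma ghom_sum: "ghom \<tau> \<Longrightarrow> \<tau> (sum f A) = (\<Sum>x\<in>A. \<tau> (f x))"
  by (induction A rule: infinite_finite_induct) (auto simp: ghomD)

lemma ghom_ypow: "ghom \<tau> \<Longrightarrow> \<tau> (ypow y \<alpha>) = ypow (\<lambda>i. \<tau> (y i)) \<alpha>"
proof -
  assume "ghom \<tau>"
  then have "\<tau> (prod_list (map y xs)) = prod_list (map (\<lambda>i. \<tau> (y i)) xs)" for xs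
    by (induction xs) (auto simp: ghomD)
  then show ?thesis by (simp add: ypow_def)
qed

text \<open>The homomorphism given by the universal property. Coefficients outside
  \<open>{1..n}\<close> are dropped, so it is multiplicative on the whole type, and
  \<open>endo n xvar\<close> is the projection onto \<open>grn n\<close>.\<close>

definition endo :: "nat \<Rightarrow> (nat \<Rightarrow> 'a::comm_ring_1 gr) \<Rightarrow> 'a gr \<Rightarrow> 'a gr" where
  "endo n y a = (\<Sum>\<alpha>\<in>Pow {1..n}. sc (cf a \<alpha>) * ypow y \<alpha>)"

lemma endo_cong: "(\<And>i. i \<in> {1..n} \<Longrightarrow> y i = z i) \<Longrightarrow> endo n y a = endo n z a"
  unfolding endo_def by (intro sum.cong refl arg_cong2[of _ _ _ _ "(*)"] ypow_cong) auto

lemma endo_xpow: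
  assumes "\<alpha> \<subseteq> {1..n}"
  shows "endo n y (xpow \<alpha>) = ypow y \<alpha>"
proof -
  have "finite \<alpha>" using assms finite_subset by auto
  then have "endo n y (xpow \<alpha>) = (\<Sum>\<beta>\<in>Pow {1..n}. if \<beta> = \<alpha> then ypow y \<beta> else 0)"
    unfolding endo_def by (intro sum.cong refl) (simp add: cf_xpow sc_simps)
  then show ?thesis using assms by (simp add: sum.delta)
qed

lemma endo_xvar: "i \<in> {1..n} \<Longrightarrow> endo n y (xvar i) = y i"
  using endo_xpow[of "{i}" n y] ypow_insert_min[of "{}" i y] by simp

lemma endo_id: "grn n a \<Longrightarrow> endo n xvar a = a"
  unfolding endo_def by (subst (2) grn_expand) (auto intro!: sum.cong simp: ypow_xvar finite_subset)

text \<open>For products, the decompositions of \<gamma> are listed as pairs of disjoint sets; the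
  overlapping pairs may then be added because their products vanish by \<open>ypow_mult\<close>, and
  the sum over all pairs factors.\<close>

lemma ghom_endo:
  assumes y: "\<And>i. odn (y i)"
  shows "ghom (endo n y)"
  unfolding ghom_def
proof (intro conjI allI)
  fix a b :: "'a gr" and c :: 'a
  show "endo n y (a + b) = endo n y a + endo n y b"
    by (simp add: endo_def sc_simps distrib_right sum.distrib)
  show sc: "endo n y (sc c) = sc c" for c
  proof -
    have "endo n y (sc c) = (\<Sum>\<beta>\<in>Pow {1..n}. if \<beta> = {} then sc c * ypow y \<beta> else 0)"
      unfolding endo_def by (intro sum.cong refl) (simp add: cf_sc sc_simps)
    then show ?thesis by (simp add: sum.delta)
  qed
  from sc[of 1] show "endo n y 1 = 1" by (simp add: sc_simps)
  let ?P = "Pow {1..n}"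
  have fin: "finite \<alpha>" if "\<alpha> \<in> ?P" for \<alpha> using that by (auto intro: finite_subset)
  have "endo n y (a * b) = (\<Sum>\<gamma>\<in>?P. \<Sum>\<alpha>\<in>Pow \<gamma>. sc (gsign \<alpha> (\<gamma> - \<alpha>) * cf a \<alpha> * cf b (\<gamma> - \<alpha>)) * ypow y \<gamma>)"
  proof -
    have "sc (sum f A) = (\<Sum>x\<in>A. sc (f x))" for f :: "nat set \<Rightarrow> 'a" and A
      by (induction A rule: infinite_finite_induct) (auto simp: sc_simps)
    then show ?thesis by (simp add: endo_def cf_times sum_distrib_right)
  qed
  also have "\<dots> = (\<Sum>(\<gamma>, \<alpha>)\<in>Sigma ?P Pow. sc (gsign \<alpha> (\<gamma> - \<alpha>) * cf a \<alpha> * cf b (\<gamma> - \<alpha>)) * ypow y \<gamma>)"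
    by (rule sum.Sigma) (use fin in auto)
  also have "\<dots> = (\<Sum>(\<alpha>, \<beta>)\<in>{(\<alpha>, \<beta>). \<alpha> \<in> ?P \<and> \<beta> \<in> ?P \<and> \<alpha> \<inter> \<beta> = {}}.
      sc (gsign \<alpha> \<beta> * cf a \<alpha> * cf b \<beta>) * ypow y (\<alpha> \<union> \<beta>))"
    by (rule sum.reindex_bij_witness[where i = "\<lambda>(\<alpha>, \<beta>). (\<alpha> \<union> \<beta>, \<alpha>)" and j = "\<lambda>(\<gamma>, \<alpha>). (\<alpha>, \<gamma> - \<alpha>)"])
       (auto simp: Un_absorb1 Un_Diff Diff_triv Int_commute)
  also have "\<dots> = (\<Sum>(\<alpha>, \<beta>)\<in>{(\<alpha>, \<beta>). \<alpha> \<in> ?P \<and> \<beta> \<in> ?P \<and> \<alpha> \<inter> \<beta> = {}}.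
      (sc (cf a \<alpha>) * ypow y \<alpha>) * (sc (cf b \<beta>) * ypow y \<beta>))"
  proof (rule sum.cong[OF refl])
    fix p assume "p \<in> {(\<alpha>, \<beta>). \<alpha> \<in> ?P \<and> \<beta> \<in> ?P \<and> \<alpha> \<inter> \<beta> = {}}"
    then obtain \<alpha> \<beta> where p: "p = (\<alpha>, \<beta>)" "\<alpha> \<in> ?P" "\<beta> \<in> ?P" "\<alpha> \<inter> \<beta> = {}" by auto
    have "(sc (cf a \<alpha>) * ypow y \<alpha>) * (sc (cf b \<beta>) * ypow y \<beta>) = sc (cf a \<alpha> * cf b \<beta>) * (ypow y \<alpha> * ypow y \<beta>)"
      by (rule sc_mult_sc)
    also have "\<dots> = sc (gsign \<alpha> \<beta> * cf a \<alpha> * cf b \<beta>) * ypow y (\<alpha> \<union> \<beta>)"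
      using ypow_mult[of y \<alpha> \<beta>, OF y] p fin
      by (simp add: mult.assoc[symmetric] sc_simps(4)[symmetric] mult.commute[of "gsign \<alpha> \<beta>"])
         (simp add: mult.assoc mult.commute[of "gsign \<alpha> \<beta>"])
    finally show "(case p of (\<alpha>, \<beta>) \<Rightarrow> sc (gsign \<alpha> \<beta> * cf a \<alpha> * cf b \<beta>) * ypow y (\<alpha> \<union> \<beta>)) =
      (case p of (\<alpha>, \<beta>) \<Rightarrow> (sc (cf a \<alpha>) * ypow y \<alpha>) * (sc (cf b \<beta>) * ypow y \<beta>))"
      using p by simp
  qed
  also have "\<dots> = (\<Sum>(\<alpha>, \<beta>)\<in>?P \<times> ?P. (sc (cf a \<alpha>) * ypow y \<alpha>) * (sc (cf b \<beta>) * ypow y \<beta>))"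
  proof (rule sum.mono_neutral_left)
    show "\<forall>p\<in>?P \<times> ?P - {(\<alpha>, \<beta>). \<alpha> \<in> ?P \<and> \<beta> \<in> ?P \<and> \<alpha> \<inter> \<beta> = {}}.
        (case p of (\<alpha>, \<beta>) \<Rightarrow> (sc (cf a \<alpha>) * ypow y \<alpha>) * (sc (cf b \<beta>) * ypow y \<beta>)) = 0"
    proof
      fix p assume "p \<in> ?P \<times> ?P - {(\<alpha>, \<beta>). \<alpha> \<in> ?P \<and> \<beta> \<in> ?P \<and> \<alpha> \<inter> \<beta> = {}}"
      then obtain \<alpha> \<beta> where p: "p = (\<alpha>, \<beta>)" "\<alpha> \<in> ?P" "\<beta> \<in> ?P" "\<alpha> \<inter> \<beta> \<noteq> {}" by auto
      have "(sc (cf a \<alpha>) * ypow y \<alpha>) * (sc (cf b \<beta>) * ypow y \<beta>) = sc (cf a \<alpha> * cf b \<beta>) * (ypow y \<alpha> * ypow y \<beta>)"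
        by (rule sc_mult_sc)
      then show "(case p of (\<alpha>, \<beta>) \<Rightarrow> (sc (cf a \<alpha>) * ypow y \<alpha>) * (sc (cf b \<beta>) * ypow y \<beta>)) = 0"
        using ypow_mult[of y \<alpha> \<beta>, OF y] p fin by simp
    qed
  qed auto
  also have "\<dots> = endo n y a * endo n y b"
    by (simp add: endo_def sum_product sum.cartesian_product)
  finally show "endo n y (a * b) = endo n y a * endo n y b" .
qed

lemma ghom_endo_comp: "ghom \<tau> \<Longrightarrow> \<tau> (endo n y a) = endo n (\<lambda>i. \<tau> (y i)) a"
  by (simp add: endo_def ghom_sum ghomD ghom_ypow)

text \<open>Images of the variables determine a homomorphism. This is how the elementary
  automorphisms, and later arbitrary elements of \<Gamma>, are recognised as substitutions.\<close>

lemma ghom_eq_endo: "ghom \<tau> \<Longrightarrow> grn n a \<Longrightarrow> \<tau> a = endo n (\<lambda>i. \<tau> (xvar i)) a"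
  using ghom_endo_comp[of \<tau> n xvar a] by (simp add: endo_id)

lemma odn_ypow_parity:
  assumes y: "\<And>i. odn (y i)" and "finite \<alpha>"
  shows "(even (card \<alpha>) \<longrightarrow> evn (ypow y \<alpha>)) \<and> (odd (card \<alpha>) \<longrightarrow> odn (ypow y \<alpha>))"
  using assms(2)
proof (induction \<alpha> rule: finite_linorder_min_induct)
  case (insert m \<alpha>)
  then have "card (insert m \<alpha>) = Suc (card \<alpha>)" by (subst card_insert_disjoint) auto
  then show ?case using insert y by (auto simp: ypow_insert_min odn_odn_mult odn_evn_mult)
qed simp

lemma evn_sc_mult: "evn a \<Longrightarrow> evn (sc c * a)"
  by (simp add: evn_mult)

lemma evn_endo:
  assumes "\<And>i. odn (y i)" "evn a"
  shows "evn (endo n y a)"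
  unfolding endo_def
proof (rule evn_sum)
  fix \<alpha> assume "\<alpha> \<in> Pow {1..n}"
  then have "finite \<alpha>" by (auto intro: finite_subset)
  then show "evn (sc (cf a \<alpha>) * ypow y \<alpha>)"
    using odn_ypow_parity[of y \<alpha>, OF assms(1)] assms(2)
    by (cases "even (card \<alpha>)") (auto simp: evn_def evn_sc_mult)
qed

lemma odn_endo:
  assumes "\<And>i. odn (y i)" "odn a"
  shows "odn (endo n y a)"
  unfolding endo_def
proof (rule odn_sum)
  fix \<alpha> assume "\<alpha> \<in> Pow {1..n}"
  then have "finite \<alpha>" by (auto intro: finite_subset)
  then show "odn (sc (cf a \<alpha>) * ypow y \<alpha>)"
    using odn_ypow_parity[of y \<alpha>, OF assms(1)] assms(2)
    by (cases "even (card \<alpha>)") (auto simp: odn_def)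
qed

lemma grn_ypow:
  assumes "\<And>i. i \<in> \<alpha> \<Longrightarrow> grn n (y i)"
  shows "grn n (ypow y \<alpha>)"
proof (cases "finite \<alpha>")
  case True
  have "\<forall>i\<in>set xs. grn n (y i) \<Longrightarrow> grn n (prod_list (map y xs))" for xs
    by (induction xs) auto
  then show ?thesis using True assms by (simp add: ypow_def)
qed (simp add: ypow_def)

lemma grn_endo: "(\<And>i. i \<in> {1..n} \<Longrightarrow> grn m (y i)) \<Longrightarrow> grn m (endo n y a)"
  unfolding endo_def by (intro grn_sum grn_mult grn_ypow) auto

lemma fil_ypow:
  assumes y: "\<And>i. odn (y i)" and "finite \<alpha>"
  shows "fil (card \<alpha>) (ypow y \<alpha>)"
  using assms(2)
proof (induction \<alpha> rule: finite_linorder_min_induct)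
  case (insert m \<alpha>)
  then have "card (insert m \<alpha>) = 1 + card \<alpha>" by (subst card_insert_disjoint) auto
  then show ?case using insert fil_mult[OF odn_fil_1[OF y]] by (simp add: ypow_insert_min)
qed simp

lemma fil_endo:
  assumes y: "\<And>i. odn (y i)" and "fil d a"
  shows "fil d (endo n y a)"
  unfolding endo_def
proof (rule fil_sum)
  fix \<alpha> assume "\<alpha> \<in> Pow {1..n}"
  then have "finite \<alpha>" by (auto intro: finite_subset)
  then show "fil d (sc (cf a \<alpha>) * ypow y \<alpha>)"
    using fil_ypow[of y \<alpha>, OF y] assms(2) fil_antimono[of "card \<alpha>" "ypow y \<alpha>" d]
    by (cases "card \<alpha> < d") (auto simp: fil_def)
qed

section \<open>Skew derivatives\<close>

text \<open>The variable x_j is moved to the front of the monomial, which costs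
  \<open>gsign {j} \<beta>\<close>, and is then deleted.\<close>

definition dd :: "nat \<Rightarrow> 'a::comm_ring_1 gr \<Rightarrow> 'a gr" where
  "dd j a = Gr (\<lambda>\<beta>. if j \<in> \<beta> then 0 else gsign {j} \<beta> * cf a (insert j \<beta>))"

text \<open>The grading automorphism. It absorbs the degree-dependent sign of the Leibniz rule,
  which then holds for inhomogeneous elements too.\<close>

definition pari :: "'a::comm_ring_1 gr \<Rightarrow> 'a gr" where
  "pari a = Gr (\<lambda>\<alpha>. (- 1) ^ card \<alpha> * cf a \<alpha>)"

lemma cf_dd: "cf (dd j a) \<beta> = (if j \<in> \<beta> then 0 else gsign {j} \<beta> * cf a (insert j \<beta>))"
  unfolding dd_def by (subst cf_Gr) (auto simp: cf_infinite)

lemma cf_pari: "cf (pari a) \<beta> = (- 1) ^ card \<beta> * cf a \<beta>"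
  unfolding pari_def by (subst cf_Gr) (auto simp: cf_infinite)

lemma pari_odn: "odn a \<Longrightarrow> pari a = - a"
  by (rule gr_eqI) (auto simp: cf_pari odn_def minus_one_power_iff)

lemma dd_simps: "dd j 0 = 0" "dd j 1 = 0" "dd j (a + b) = dd j a + dd j b" "dd j (- a) = - dd j a"
    "dd j (a - b) = dd j a - dd j b" "dd j (sc c * a) = sc c * dd j a"
  by (rule gr_eqI; simp add: cf_dd cf_one gmonom_def algebra_simps)+

lemma dd_sum: "dd j (sum f A) = (\<Sum>x\<in>A. dd j (f x))"
  by (induction A rule: infinite_finite_induct) (auto simp: dd_simps)

lemma dd_xvar: "dd j (xvar k) = (if k = j then 1 else 0)"
proof (rule gr_eqI)
  fix \<beta> :: "nat set"
  have "j \<notin> \<beta> \<and> insert j \<beta> = {k} \<longleftrightarrow> k = j \<and> \<beta> = {}" by auto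
  then show "cf (dd j (xvar k)) \<beta> = cf (if k = j then 1 else 0) \<beta>"
    by (auto simp: cf_dd cf_xpow cf_one gmonom_def)
qed

lemma dd_dd: "dd j (dd j a) = 0"
  by (rule gr_eqI) (simp add: cf_dd)

text \<open>Compare coefficients at \<gamma>. If j is not in \<gamma>, the decompositions of
  \<open>insert j \<gamma>\<close> split by the factor that receives j, and this gives the two
  terms. If j is in \<gamma>, the left side has no such coefficient, and on the right the first
  product at \<alpha> cancels the second at \<open>insert j \<alpha>\<close>.\<close>

lemma dd_mult: "dd j (a * b) = dd j a * b + pari a * dd j b"
proof (rule gr_eqI)
  fix \<gamma> :: "nat set" assume \<gamma>: "finite \<gamma>"
  define s where "s = (gsign :: nat set \<Rightarrow> nat set \<Rightarrow> 'a)"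
  have ss: "s \<alpha> \<beta> * s \<alpha> \<beta> = 1" "s \<alpha> \<beta> * (s \<alpha> \<beta> * c) = c" for \<alpha> \<beta> c by (simp_all add: s_def)
  have split: "sum f (Pow (insert j \<delta>)) = (\<Sum>\<alpha>\<in>Pow \<delta>. f \<alpha> + f (insert j \<alpha>))"
    if "j \<notin> \<delta>" "finite \<delta>" for f :: "nat set \<Rightarrow> 'a" and \<delta>
  proof -
    have "inj_on (insert j) (Pow \<delta>)" using that by (auto simp: inj_on_def)
    moreover have "sum f (Pow (insert j \<delta>)) = sum f (Pow \<delta>) + sum f (insert j ` Pow \<delta>)"
      unfolding Pow_insert by (rule sum.union_disjoint) (use that in auto)
    ultimately show ?thesis by (simp add: sum.reindex sum.distrib)
  qed
  have signs: "s \<alpha> (insert j (\<delta> - \<alpha>)) = (- 1) ^ card \<alpha> * s {j} \<alpha> * s \<alpha> (\<delta> - \<alpha>)"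
      "s (insert j \<alpha>) (\<delta> - \<alpha>) = s {j} (\<delta> - \<alpha>) * s \<alpha> (\<delta> - \<alpha>)" 
      "s {j} \<delta> = s {j} \<alpha> * s {j} (\<delta> - \<alpha>)" "card (insert j \<alpha>) = Suc (card \<alpha>)"
      "insert j \<delta> - \<alpha> = insert j (\<delta> - \<alpha>)" "insert j \<delta> - insert j \<alpha> = \<delta> - \<alpha>" "\<delta> - insert j \<alpha> = \<delta> - \<alpha>" "j \<notin> \<alpha>"
    if "j \<notin> \<delta>" "finite \<delta>" "\<alpha> \<in> Pow \<delta>" for \<alpha> \<delta>
  proof -
    have fin: "finite \<alpha>" "finite (\<delta> - \<alpha>)" "j \<notin> \<alpha>" "j \<notin> \<delta> - \<alpha>" using that by (auto intro: finite_subset)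
    show "s \<alpha> (insert j (\<delta> - \<alpha>)) = (- 1) ^ card \<alpha> * s {j} \<alpha> * s \<alpha> (\<delta> - \<alpha>)"
      using gsign_insert_right[of \<alpha> "\<delta> - \<alpha>" j, where ?'a = 'a] gsign_swap[of "{j}" \<alpha>, where ?'a = 'a] fin by (simp add: s_def)
    show "s (insert j \<alpha>) (\<delta> - \<alpha>) = s {j} (\<delta> - \<alpha>) * s \<alpha> (\<delta> - \<alpha>)"
      using gsign_insert_left[of \<alpha> "\<delta> - \<alpha>" j, where ?'a = 'a] fin by (simp add: s_def)
    show "s {j} \<delta> = s {j} \<alpha> * s {j} (\<delta> - \<alpha>)"
      using gsign_Un_right[of "{j}" \<alpha> "\<delta> - \<alpha>", where ?'a = 'a] fin that by (simp add: s_def Un_absorb1)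
    show "card (insert j \<alpha>) = Suc (card \<alpha>)" using fin by simp
  qed (use that in auto)
  show "cf (dd j (a * b)) \<gamma> = cf (dd j a * b + pari a * dd j b) \<gamma>"
  proof (cases "j \<in> \<gamma>")
    case False
    have "cf (dd j (a * b)) \<gamma> = (\<Sum>\<alpha>\<in>Pow \<gamma>. s {j} \<gamma> *
       (s \<alpha> (insert j \<gamma> - \<alpha>) * cf a \<alpha> * cf b (insert j \<gamma> - \<alpha>) +
        s (insert j \<alpha>) (insert j \<gamma> - insert j \<alpha>) * cf a (insert j \<alpha>) * cf b (insert j \<gamma> - insert j \<alpha>)))"
      using False \<gamma> by (simp add: cf_dd cf_times split sum_distrib_left s_def)
    also have "\<dots> = (\<Sum>\<alpha>\<in>Pow \<gamma>. s \<alpha> (\<gamma> - \<alpha>) * cf (dd j a) \<alpha> * cf b (\<gamma> - \<alpha>) +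
        s \<alpha> (\<gamma> - \<alpha>) * cf (pari a) \<alpha> * cf (dd j b) (\<gamma> - \<alpha>))"
    proof (rule sum.cong[OF refl])
      fix \<alpha> assume \<alpha>: "\<alpha> \<in> Pow \<gamma>"
      note sg = signs[OF False \<gamma> \<alpha>]
      have "j \<notin> \<gamma> - \<alpha>" using False by auto
      then show "s {j} \<gamma> * (s \<alpha> (insert j \<gamma> - \<alpha>) * cf a \<alpha> * cf b (insert j \<gamma> - \<alpha>) +
        s (insert j \<alpha>) (insert j \<gamma> - insert j \<alpha>) * cf a (insert j \<alpha>) * cf b (insert j \<gamma> - insert j \<alpha>)) =
        s \<alpha> (\<gamma> - \<alpha>) * cf (dd j a) \<alpha> * cf b (\<gamma> - \<alpha>) + s \<alpha> (\<gamma> - \<alpha>) * cf (pari a) \<alpha> * cf (dd j b) (\<gamma> - \<alpha>)"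
        unfolding sg(5,6) sg(1-3) using sg(8) by (simp add: cf_dd cf_pari distrib_left s_def[symmetric] ss mult_ac)
    qed
    also have "\<dots> = cf (dd j a * b + pari a * dd j b) \<gamma>"
      by (simp add: cf_times sum.distrib s_def)
    finally show ?thesis .
  next
    case True
    define \<delta> where "\<delta> = \<gamma> - {j}"
    have \<delta>: "\<gamma> = insert j \<delta>" "j \<notin> \<delta>" "finite \<delta>" using True \<gamma> by (auto simp: \<delta>_def)
    have "cf (dd j a * b + pari a * dd j b) \<gamma> = (\<Sum>\<alpha>\<in>Pow \<delta>.
      (s \<alpha> (\<gamma> - \<alpha>) * cf (dd j a) \<alpha> * cf b (\<gamma> - \<alpha>) +
       s (insert j \<alpha>) (\<gamma> - insert j \<alpha>) * cf (dd j a) (insert j \<alpha>) * cf b (\<gamma> - insert j \<alpha>)) +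
      (s \<alpha> (\<gamma> - \<alpha>) * cf (pari a) \<alpha> * cf (dd j b) (\<gamma> - \<alpha>) +
       s (insert j \<alpha>) (\<gamma> - insert j \<alpha>) * cf (pari a) (insert j \<alpha>) * cf (dd j b) (\<gamma> - insert j \<alpha>)))"
      unfolding cf_plus cf_times unfolding \<delta>(1) split[OF \<delta>(2,3)] by (simp add: sum.distrib s_def)
    also have "\<dots> = 0"
    proof (rule sum.neutral, rule ballI)
      fix \<alpha> assume \<alpha>: "\<alpha> \<in> Pow \<delta>"
      note sg = signs[OF \<delta>(2,3) \<alpha>]
      have "j \<notin> \<delta> - \<alpha>" using \<delta> by auto
      then show "(s \<alpha> (\<gamma> - \<alpha>) * cf (dd j a) \<alpha> * cf b (\<gamma> - \<alpha>) +
       s (insert j \<alpha>) (\<gamma> - insert j \<alpha>) * cf (dd j a) (insert j \<alpha>) * cf b (\<gamma> - insert j \<alpha>)) +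
      (s \<alpha> (\<gamma> - \<alpha>) * cf (pari a) \<alpha> * cf (dd j b) (\<gamma> - \<alpha>) +
       s (insert j \<alpha>) (\<gamma> - insert j \<alpha>) * cf (pari a) (insert j \<alpha>) * cf (dd j b) (\<gamma> - insert j \<alpha>)) = 0"
        unfolding \<delta>(1) sg(5,6) sg(1,2) using sg(8) by (simp add: cf_dd cf_pari sg(4) s_def[symmetric] ss mult_ac)
    qed
    finally show ?thesis using True by (simp add: cf_dd)
  qed
qed

lemma dd_mult_odn: "odn a \<Longrightarrow> dd j (a * b) = dd j a * b - a * dd j b"
  by (simp add: dd_mult pari_odn)

lemma evn_dd: "odn a \<Longrightarrow> evn (dd j a)"
  unfolding evn_def
proof (intro allI impI)
  fix \<alpha> :: "nat set" assume a: "odn a" "odd (card \<alpha>)"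
  then have "finite \<alpha>" by (rule_tac ccontr) simp
  then show "cf (dd j a) \<alpha> = 0" using a by (auto simp: cf_dd odn_def)
qed

lemma grn_dd: "grn n a \<Longrightarrow> grn n (dd j a)"
  by (auto simp: grn_def cf_dd)

lemma fil_dd: "fil (Suc d) a \<Longrightarrow> fil d (dd j a)"
  unfolding fil_def
proof (intro allI impI)
  fix \<alpha> :: "nat set" assume a: "\<forall>\<alpha>. card \<alpha> < Suc d \<longrightarrow> cf a \<alpha> = 0" "card \<alpha> < d"
  then show "cf (dd j a) \<alpha> = 0"
    by (cases "finite \<alpha>") (auto simp: cf_dd cf_infinite)
qed

lemma dd_xpow_notin: "finite \<alpha> \<Longrightarrow> j \<notin> \<alpha> \<Longrightarrow> dd j (xpow \<alpha>) = 0"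
  by (rule gr_eqI) (auto simp: cf_dd cf_xpow)

section \<open>The Jacobian determinant\<close>

definition pdet :: "nat \<Rightarrow> (nat \<Rightarrow> nat \<Rightarrow> 'e::comm_ring_1) \<Rightarrow> 'e" where
  "pdet n A = (\<Sum>p | p permutes {1..n}. of_int (sign p) * (\<Prod>i\<in>{1..n}. A i (p i)))"

lemma pdet_cong: "(\<And>i j. i \<in> {1..n} \<Longrightarrow> j \<in> {1..n} \<Longrightarrow> A i j = B i j) \<Longrightarrow> pdet n A = pdet n B"
  unfolding pdet_def
proof (intro sum.cong refl arg_cong2[of _ _ _ _ "(*)"] prod.cong)
  fix p i assume AB: "\<And>i j. i \<in> {1..n} \<Longrightarrow> j \<in> {1..n} \<Longrightarrow> A i j = B i j"
    and "p \<in> {p. p permutes {1..n}}" and i: "i \<in> {1..n}"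
  then have "p i \<in> {1..n}" by (simp only: permutes_in_image mem_Collect_eq)
  with i show "A i (p i) = B i (p i)" by (rule AB)
qed

text \<open>A permutation other than the identity moves at least two indices, hence one different
  from i; in that row the matrix is the unit matrix, so the term vanishes.\<close>

lemma pdet_except_row:
  assumes "\<And>k j. k \<in> {1..n} - {i} \<Longrightarrow> j \<in> {1..n} \<Longrightarrow> A k j = (if k = j then 1 else 0)"
  shows "pdet n A = (if i \<in> {1..n} then A i i else 1)"
proof -
  have zero: "of_int (sign p) * (\<Prod>k\<in>{1..n}. A k (p k)) = 0" if p: "p permutes {1..n}" "p \<noteq> id" for p
  proof -
    obtain k where k: "p k \<noteq> k" using p(2) by force
    then have "p (p k) \<noteq> p k" using permutes_inj[OF p(1)] by (auto dest: injD)
    define k' where "k' = (if k = i then p k else k)"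
    have k': "k' \<noteq> i" "p k' \<noteq> k'" using k \<open>p (p k) \<noteq> p k\<close> by (auto simp: k'_def)
    have "k' \<in> {1..n}" by (rule ccontr) (use permutes_not_in[OF p(1)] k' in blast)
    moreover from this have "p k' \<in> {1..n}" by (simp only: permutes_in_image[OF p(1)])
    ultimately have "A k' (p k') = 0" using assms[of k' "p k'"] k' by simp
    then have "(\<Prod>k\<in>{1..n}. A k (p k)) = 0" using \<open>k' \<in> {1..n}\<close> by (intro prod_zero bexI[of _ k']) auto
    then show ?thesis by simp
  qed
  have "pdet n A = (\<Sum>p\<in>{id}. of_int (sign p) * (\<Prod>k\<in>{1..n}. A k (p k)))"
    unfolding pdet_def
    by (rule sum.mono_neutral_right) (use zero in \<open>auto simp: permutes_id intro: finite_permutations\<close>)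
  also have "\<dots> = (\<Prod>k\<in>{1..n}. A k k)" by simp
  also have "\<dots> = (\<Prod>k\<in>{1..n}. if k = i then A i i else 1)"
  proof (rule prod.cong[OF refl])
    fix k assume "k \<in> {1..n}"
    then show "A k k = (if k = i then A i i else 1)" using assms[of k k] by simp
  qed
  finally show ?thesis by (simp add: prod.delta)
qed

text \<open>Bordering with a unit row and column turns the index range into the one of the library.\<close>

definition bord :: "nat \<Rightarrow> (nat \<Rightarrow> nat \<Rightarrow> 'e::comm_ring_1) \<Rightarrow> 'e mat" where
  "bord n A = mat (Suc n) (Suc n) (\<lambda>(i, j). if i = 0 \<or> j = 0 then (if i = j then 1 else 0) else A i j)"

text \<open>A permutation of 0, ..., n that moves 0 picks a zero of the border row; the others are
  the permutations of \<open>{1..n}\<close>.\<close>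

lemma det_bord: "Determinant.det (bord n A) = pdet n A"
proof -
  let ?t = "\<lambda>p. of_int (sign p) * (\<Prod>i = 0..<Suc n. bord n A $$ (i, p i))"
  have range: "{0..<Suc n} = insert 0 {1..n}" by auto
  have sub: "p permutes {0..<Suc n}" if "p permutes {1..n}" for p
    using that by (rule permutes_subset) auto
  have val: "bord n A $$ (i, p i) = (if i = 0 \<or> p i = 0 then (if i = p i then 1 else 0) else A i (p i))"
    if "p permutes {0..<Suc n}" "i \<in> {0..<Suc n}" for p i
    using that permutes_in_image[OF that(1), of i] by (simp add: bord_def)
  have "Determinant.det (bord n A) = (\<Sum>p | p permutes {0..<Suc n}. ?t p)"
    by (rule det_def') (simp add: bord_def)
  also have "\<dots> = (\<Sum>p | p permutes {1..n}. ?t p)"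
  proof (rule sum.mono_neutral_right)
    show "\<forall>p\<in>{p. p permutes {0..<Suc n}} - {p. p permutes {1..n}}. ?t p = 0"
    proof
      fix p assume "p \<in> {p. p permutes {0..<Suc n}} - {p. p permutes {1..n}}"
      then have p: "p permutes {0..<Suc n}" "\<not> p permutes {1..n}" by auto
      have "p 0 \<noteq> 0"
      proof
        assume "p 0 = 0"
        then have "p permutes {0..<Suc n} - {0}"
          using p(1) by (intro permutes_superset[OF p(1)]) auto
        moreover have "{0..<Suc n} - {0} = {1..n}" by auto
        ultimately show False using p(2) by simp
      qed
      then have "bord n A $$ (0, p 0) = 0" using val[OF p(1), of 0] by simp
      then have "(\<Prod>i = 0..<Suc n. bord n A $$ (i, p i)) = 0" by (intro prod_zero) auto
      then show "?t p = 0" by simp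
    qed
  qed (use sub in \<open>auto intro: finite_permutations\<close>)
  also have "\<dots> = pdet n A"
    unfolding pdet_def
  proof (intro sum.cong refl arg_cong2[of _ _ _ _ "(*)"])
    fix p assume "p \<in> {p. p permutes {1..n}}"
    then have p: "p permutes {1..n}" by simp
    have "p 0 = 0" using p by (simp add: permutes_not_in)
    have ne: "p i \<noteq> 0" if "i \<in> {1..n}" for i using permutes_in_image[OF p, of i] that by auto
    have "(\<Prod>i = 0..<Suc n. bord n A $$ (i, p i)) = bord n A $$ (0, p 0) * (\<Prod>i\<in>{1..n}. bord n A $$ (i, p i))"
      unfolding range by (subst prod.insert) auto
    also have "bord n A $$ (0, p 0) = 1" using val[OF sub[OF p], of 0] \<open>p 0 = 0\<close> by simp
    also have "(\<Prod>i\<in>{1..n}. bord n A $$ (i, p i)) = (\<Prod>i\<in>{1..n}. A i (p i))"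
    proof (rule prod.cong[OF refl])
      fix i assume i: "i \<in> {1..n}"
      then show "bord n A $$ (i, p i) = A i (p i)" using val[OF sub[OF p], of i] ne[OF i] by simp
    qed
    finally show "(\<Prod>i = 0..<Suc n. bord n A $$ (i, p i)) = (\<Prod>i\<in>{1..n}. A i (p i))" by simp
  qed
  finally show ?thesis .
qed

lemma bord_mult: "bord n A * bord n B = bord n (\<lambda>i j. \<Sum>k\<in>{1..n}. A i k * B k j)"
proof (rule eq_matI)
  fix i j assume "i < dim_row (bord n (\<lambda>i j. \<Sum>k\<in>{1..n}. A i k * B k j))"
    "j < dim_col (bord n (\<lambda>i j. \<Sum>k\<in>{1..n}. A i k * B k j))"
  then have ij: "i < Suc n" "j < Suc n" by (auto simp: bord_def)
  have range: "{0..<Suc n} = insert 0 {1..n}" by auto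
  have "(bord n A * bord n B) $$ (i, j) = (\<Sum>k = 0..<Suc n. bord n A $$ (i, k) * bord n B $$ (k, j))"
    using ij by (simp add: bord_def scalar_prod_def)
  also have "\<dots> = bord n A $$ (i, 0) * bord n B $$ (0, j) + (\<Sum>k\<in>{1..n}. bord n A $$ (i, k) * bord n B $$ (k, j))"
    unfolding range by (subst sum.insert) auto
  also have "(\<Sum>k\<in>{1..n}. bord n A $$ (i, k) * bord n B $$ (k, j)) =
      (\<Sum>k\<in>{1..n}. if i = 0 \<or> j = 0 then 0 else A i k * B k j)"
    by (rule sum.cong) (use ij in \<open>auto simp: bord_def\<close>)
  also have "bord n A $$ (i, 0) * bord n B $$ (0, j) + \<dots> = bord n (\<lambda>i j. \<Sum>k\<in>{1..n}. A i k * B k j) $$ (i, j)"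
    using ij by (simp add: bord_def)
  finally show "(bord n A * bord n B) $$ (i, j) = bord n (\<lambda>i j. \<Sum>k\<in>{1..n}. A i k * B k j) $$ (i, j)" .
qed (simp_all add: bord_def)

lemma pdet_mult: "pdet n (\<lambda>i j. \<Sum>k\<in>{1..n}. A i k * B k j) = pdet n A * pdet n B"
  unfolding det_bord[symmetric] bord_mult[symmetric] by (rule det_mult[of _ "Suc n"]) (simp_all add: bord_def)

lemma ring_hom_pdet:
  fixes h :: "'e::comm_ring_1 \<Rightarrow> 'f::comm_ring_1"
  assumes h: "\<And>a b. h (a + b) = h a + h b" "\<And>a b. h (a * b) = h a * h b" "h 1 = 1"
  shows "h (pdet n A) = pdet n (\<lambda>i j. h (A i j))"
proof -
  have h0: "h 0 = 0" using h(1)[of 0 0] by simp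
  have hm: "h (- a) = - h a" for a using h(1)[of a "- a"] h0 by (simp add: eq_neg_iff_add_eq_0 add.commute)
  have hs: "h (sum f S) = (\<Sum>x\<in>S. h (f x))" for f :: "(nat \<Rightarrow> nat) \<Rightarrow> 'e" and S
    by (induction S rule: infinite_finite_induct) (auto simp: h h0)
  have hp: "h (prod f S) = (\<Prod>x\<in>S. h (f x))" for f :: "nat \<Rightarrow> 'e" and S
    by (induction S rule: infinite_finite_induct) (auto simp: h)
  show ?thesis unfolding pdet_def hs by (intro sum.cong refl) (auto simp: h hp hm sign_def)
qed

text \<open>The entries are even when the \<open>y i\<close> are odd, and it is for such families
  that \<open>Ev\<close> has its intended value.\<close>

definition jac :: "nat \<Rightarrow> (nat \<Rightarrow> 'a::comm_ring_1 gr) \<Rightarrow> 'a gr" where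
  "jac n y = of_ev (pdet n (\<lambda>i j. Ev (dd j (y i))))"

lemma evn_jac [simp]: "evn (jac n y)"
  by (simp add: jac_def)

lemma jac_cong: "(\<And>i. i \<in> {1..n} \<Longrightarrow> y i = z i) \<Longrightarrow> jac n y = jac n z"
  unfolding jac_def by (intro arg_cong[of _ _ of_ev] pdet_cong) simp

lemma ghom_pdet:
  assumes "ghom \<tau>" "\<And>a. evn a \<Longrightarrow> evn (\<tau> a)"
  shows "\<tau> (of_ev (pdet n A)) = of_ev (pdet n (\<lambda>i j. Ev (\<tau> (of_ev (A i j)))))"
proof -
  define h where "h a = Ev (\<tau> (of_ev a))" for a
  have of_h: "of_ev (h a) = \<tau> (of_ev a)" for a by (simp add: h_def assms)
  have "h (pdet n A) = pdet n (\<lambda>i j. h (A i j))"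
    by (rule ring_hom_pdet) (simp_all add: of_ev_inject[symmetric] of_h ghomD[OF assms(1)])
  then have "of_ev (h (pdet n A)) = of_ev (pdet n (\<lambda>i j. h (A i j)))" by simp
  then show ?thesis unfolding of_h by (simp add: h_def)
qed

lemma grn_jac:
  assumes "\<And>i. i \<in> {1..n} \<Longrightarrow> odn (y i)" "\<And>i. i \<in> {1..n} \<Longrightarrow> grn n (y i)"
  shows "grn n (jac n y)"
proof -
  have p: "grn n (of_ev (prod f S))" if "\<And>i. i \<in> S \<Longrightarrow> grn n (of_ev (f i))" for f :: "nat \<Rightarrow> 'a gev" and S
    using that by (induction S rule: infinite_finite_induct) auto
  have s: "grn n (of_int (sign p))" for p :: "nat \<Rightarrow> nat" by (simp add: sign_def)
  have "grn n (of_ev (Ev (dd j (y i))))" if "i \<in> {1..n}" for i j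
    using assms[OF that] by (simp add: evn_dd grn_dd)
  then show ?thesis
    unfolding jac_def pdet_def of_ev_sum of_ev_simps of_ev_of_int by (intro grn_sum grn_mult p s)
qed

section \<open>The chain rule and the Jacobian of a composite\<close>

text \<open>Induction splits off the smallest variable. The sign in the skew Leibniz rule is the
  same on both sides, because \<open>dd j (y k)\<close> is even and passes \<open>y m\<close>
  freely.\<close>

lemma chain_rule_ypow:
  assumes y: "\<And>i. odn (y i)" and "\<alpha> \<subseteq> {1..n}"
  shows "dd j (ypow y \<alpha>) = (\<Sum>k\<in>{1..n}. dd j (y k) * endo n y (dd k (xpow \<alpha>)))"
proof -
  have "finite \<alpha>" using assms(2) by (rule finite_subset) simp
  from this assms(2) show ?thesis
  proof (induction \<alpha> rule: finite_linorder_min_induct)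
    case empty
    then show ?case by (simp add: xpow_empty dd_simps ghomD[OF ghom_endo[OF y]])
  next
    case (insert m \<alpha>)
    then have m: "m \<in> {1..n}" "\<alpha> \<subseteq> {1..n}" "m \<notin> \<alpha>" by auto
    note H = ghomD[OF ghom_endo[OF y]]
    have xp: "xpow (insert m \<alpha>) = (xvar m * xpow \<alpha> :: 'a gr)"
      using insert by (intro xpow_insert_min)
    have e: "dd j (y k) * endo n y (dd k (xpow (insert m \<alpha>))) =
        (if k = m then dd j (y k) * ypow y \<alpha> else 0) - y m * (dd j (y k) * endo n y (dd k (xpow \<alpha>)))" for k
    proof -
      have "dd j (y k) * y m = y m * dd j (y k)" by (rule evn_commute) (simp add: evn_dd y)
      then have "dd j (y k) * (y m * z) = y m * (dd j (y k) * z)" for z by (metis mult.assoc)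
      then show ?thesis
        unfolding xp dd_mult_odn[OF odn_xpow[of "{m}", simplified]] dd_xvar
        by (simp add: H endo_xvar[OF m(1)] endo_xpow[OF m(2)] algebra_simps)
    qed
    have "dd j (ypow y (insert m \<alpha>)) = dd j (y m) * ypow y \<alpha> - y m * dd j (ypow y \<alpha>)"
      using insert by (simp add: ypow_insert_min dd_mult_odn y)
    also have "\<dots> = dd j (y m) * ypow y \<alpha> - y m * (\<Sum>k\<in>{1..n}. dd j (y k) * endo n y (dd k (xpow \<alpha>)))"
      using insert.IH m by simp
    also have "\<dots> = (\<Sum>k\<in>{1..n}. dd j (y k) * endo n y (dd k (xpow (insert m \<alpha>))))"
      unfolding e using m by (simp add: sum_subtractf sum.delta sum_distrib_left)
    finally show ?case .
  qed
qed

lemma chain_rule: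
  assumes y: "\<And>i. odn (y i)" and a: "grn n a"
  shows "dd j (endo n y a) = (\<Sum>k\<in>{1..n}. dd j (y k) * endo n y (dd k a))"
proof -
  note H = ghomD[OF ghom_endo[OF y]]
  have "endo n y (dd k a) = (\<Sum>\<alpha>\<in>Pow {1..n}. sc (cf a \<alpha>) * endo n y (dd k (xpow \<alpha>)))" for k
    by (subst grn_expand[OF a]) (simp add: dd_sum ghom_sum[OF ghom_endo[OF y]] dd_simps H)
  then have "(\<Sum>k\<in>{1..n}. dd j (y k) * endo n y (dd k a)) =
      (\<Sum>k\<in>{1..n}. \<Sum>\<alpha>\<in>Pow {1..n}. sc (cf a \<alpha>) * (dd j (y k) * endo n y (dd k (xpow \<alpha>))))"
    by (simp add: sum_distrib_left sc_mult)
  also have "\<dots> = (\<Sum>\<alpha>\<in>Pow {1..n}. sc (cf a \<alpha>) * (\<Sum>k\<in>{1..n}. dd j (y k) * endo n y (dd k (xpow \<alpha>))))"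
    by (subst sum.swap) (simp add: sum_distrib_left)
  also have "\<dots> = (\<Sum>\<alpha>\<in>Pow {1..n}. sc (cf a \<alpha>) * dd j (ypow y \<alpha>))"
    by (intro sum.cong refl) (simp add: chain_rule_ypow[OF y])
  also have "\<dots> = dd j (endo n y a)"
    by (simp add: endo_def dd_sum dd_simps)
  finally show ?thesis by simp
qed

text \<open>By the chain rule the matrix of the composite is the matrix of \<open>z\<close>, with
  \<open>endo n y\<close> applied to its entries, times the matrix of \<open>y\<close>. All entries
  are even, so the determinant is multiplicative and commutes with \<open>endo n y\<close>.\<close>

lemma jac_endo:
  assumes y: "\<And>i. odn (y i)" and z: "\<And>i. i \<in> {1..n} \<Longrightarrow> odn (z i)" "\<And>i. i \<in> {1..n} \<Longrightarrow> grn n (z i)"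
  shows "jac n (\<lambda>i. endo n y (z i)) = jac n y * endo n y (jac n z)"
proof -
  have ev: "evn (endo n y (dd k (z i)))" if "i \<in> {1..n}" for i k
    by (rule evn_endo[OF y evn_dd[OF z(1)[OF that]]])
  have "pdet n (\<lambda>i j. Ev (dd j (endo n y (z i)))) =
      pdet n (\<lambda>i j. \<Sum>k\<in>{1..n}. Ev (endo n y (dd k (z i))) * Ev (dd j (y k)))"
  proof (rule pdet_cong)
    fix i j assume i: "i \<in> {1..n}"
    have "endo n y (dd k (z i)) * dd j (y k) = dd j (y k) * endo n y (dd k (z i))" for k
      by (rule evn_commute) (rule ev[OF i])
    then have "of_ev (\<Sum>k\<in>{1..n}. Ev (endo n y (dd k (z i))) * Ev (dd j (y k))) = dd j (endo n y (z i))"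
      using chain_rule[OF y z(2)[OF i], of j] ev[OF i] by (simp add: of_ev_sum evn_dd y)
    moreover have "evn (dd j (endo n y (z i)))" by (rule evn_dd[OF odn_endo[OF y z(1)[OF i]]])
    ultimately show "Ev (dd j (endo n y (z i))) = (\<Sum>k\<in>{1..n}. Ev (endo n y (dd k (z i))) * Ev (dd j (y k)))"
      by (simp add: of_ev_inject[symmetric])
  qed
  also have "\<dots> = pdet n (\<lambda>i k. Ev (endo n y (dd k (z i)))) * pdet n (\<lambda>k j. Ev (dd j (y k)))"
    by (rule pdet_mult)
  finally have "jac n (\<lambda>i. endo n y (z i)) = of_ev (pdet n (\<lambda>i k. Ev (endo n y (dd k (z i))))) * jac n y"
    by (simp add: jac_def)
  also have "of_ev (pdet n (\<lambda>i k. Ev (endo n y (dd k (z i))))) = endo n y (jac n z)"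
    unfolding jac_def
  proof (subst ghom_pdet[of "endo n y"])
    show "ghom (endo n y)" "\<And>a. evn a \<Longrightarrow> evn (endo n y a)"
      using ghom_endo[of y] evn_endo[of y] y by auto
    show "of_ev (pdet n (\<lambda>i k. Ev (endo n y (dd k (z i))))) =
        of_ev (pdet n (\<lambda>i j. Ev (endo n y (of_ev (Ev (dd j (z i)))))))"
      by (intro arg_cong[of _ _ of_ev] pdet_cong) (use z in \<open>simp add: evn_dd\<close>)
  qed
  also have "\<dots> * jac n y = jac n y * \<dots>" by (rule evn_commute[symmetric]) simp
  finally show ?thesis .
qed

lemma jac_except_row:
  assumes "\<And>k. k \<in> {1..n} - {i} \<Longrightarrow> y k = xvar k" "odn (y i)" "i \<in> {1..n}"
  shows "jac n y = dd i (y i)"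
proof -
  have "pdet n (\<lambda>k j. Ev (dd j (y k))) = (if i \<in> {1..n} then Ev (dd i (y i)) else 1)"
    by (rule pdet_except_row) (simp add: assms dd_xvar of_ev_inject[symmetric])
  then show ?thesis using assms by (simp add: jac_def evn_dd)
qed

section \<open>Elementary automorphisms\<close>

definition el :: "nat \<Rightarrow> 'a::comm_ring_1 gr \<Rightarrow> 'a gr \<Rightarrow> 'a gr" where
  "el i b f = f + b * dd i f"

text \<open>For odd \<open>b\<close> the map f \<mapsto> b \<partial>f/\<partial>x_i is an ordinary
  derivation, since \<open>b * pari f = f * b\<close> absorbs the Leibniz sign. A product of two of
  its values contains \<open>b\<close> twice and vanishes, so identity plus derivation is
  multiplicative.\<close>

lemma ghom_el: assumes b: "odn b" shows "ghom (el i b)"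
  unfolding ghom_def
proof (intro conjI allI)
  fix f g :: "'a gr" and c :: 'a
  show "el i b (f + g) = el i b f + el i b g" by (simp add: el_def dd_simps algebra_simps)
  show "el i b 1 = 1" by (simp add: el_def dd_simps)
  show "el i b (sc c) = sc c" using dd_simps(6)[of i c 1] by (simp add: el_def dd_simps)
  have comm: "b * pari a = a * b" for a
  proof -
    have "cf (b * pari a) \<gamma> = cf (a * b) \<gamma>" if \<gamma>: "finite \<gamma>" for \<gamma>
      unfolding cf_times_swap[OF \<gamma>, of a b] cf_times[of b "pari a"]
    proof (intro sum.cong refl)
      fix \<alpha> show "gsign \<alpha> (\<gamma> - \<alpha>) * cf b \<alpha> * cf (pari a) (\<gamma> - \<alpha>) =
        (- 1) ^ (card \<alpha> * card (\<gamma> - \<alpha>)) * (gsign \<alpha> (\<gamma> - \<alpha>) * cf b \<alpha> * cf a (\<gamma> - \<alpha>))"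
        using b by (cases "even (card \<alpha>)") (auto simp: odn_def cf_pari minus_one_power_iff)
    qed
    then show ?thesis by (rule gr_eqI)
  qed
  have "b * (z * b) = 0" for z
    using comm[of "pari z"] odn_square[OF b]
  proof -
    have "pari (pari z) = z" by (rule gr_eqI) (simp add: cf_pari flip: mult.assoc power_add)
    then have "b * z = pari z * b" using comm[of "pari z"] by simp
    then have "b * (z * b) = pari z * (b * b)" by (metis mult.assoc)
    then show ?thesis using odn_square[OF b] by simp
  qed
  then have z: "b * dd i f * (b * dd i g) = 0" by (metis mult.assoc mult_zero_left)
  have "b * (pari f * dd i g) = f * (b * dd i g)" by (metis comm mult.assoc)
  then show "el i b (f * g) = el i b f * el i b g"
    using z by (simp add: el_def dd_mult distrib_left distrib_right mult.assoc)
qed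

text \<open>The condition on \<open>b\<close> makes the derivation f \<mapsto> b
  \<partial>f/\<partial>x_i square to zero, so 1 + D and 1 - D are inverse to each other.\<close>

lemma el_inverse:
  assumes b: "odn b" "b * dd i b = 0"
  shows "el i b (el i (- b) f) = f"
proof -
  have "dd i (el i (- b) f) = dd i f - dd i b * dd i f"
    by (simp add: el_def dd_simps dd_mult_odn b dd_dd)
  then have "b * dd i (el i (- b) f) = b * dd i f - b * dd i b * dd i f" by (simp add: right_diff_distrib mult.assoc)
  then show ?thesis using b by (simp add: el_def[of i b] el_def[of i "- b"])
qed

lemma dd_xpow_in: "finite \<alpha> \<Longrightarrow> j \<in> \<alpha> \<Longrightarrow> dd j (xpow \<alpha>) = sc (gsign {j} (\<alpha> - {j})) * xpow (\<alpha> - {j})"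
  by (rule gr_eqI) (auto simp: cf_dd cf_xpow insert_absorb)

text \<open>Degree at least 3 leaves \<open>\<beta> - {i}\<close> nonempty, so x^\<beta> and its
  derivative share a variable.\<close>

lemma el_monomial:
  assumes "odd (card \<beta>)" "3 \<le> card \<beta>"
  shows "sc c * xpow \<beta> * dd i (sc c * xpow \<beta>) = 0"
proof (cases "i \<in> \<beta>")
  case True
  have fin: "finite \<beta>" using assms by (rule_tac ccontr) simp
  have "sc c * xpow \<beta> * dd i (sc c * xpow \<beta>) = sc (c * (c * gsign {i} (\<beta> - {i}))) * (xpow \<beta> * xpow (\<beta> - {i}))"
    using fin True sc_mult_sc[of c "xpow \<beta>" "c * gsign {i} (\<beta> - {i})" "xpow (\<beta> - {i})"]
    by (simp add: dd_simps dd_xpow_in sc_simps mult.assoc)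
  moreover have "card (\<beta> - {i}) > 0" using assms True fin by simp
  then have "\<beta> \<inter> (\<beta> - {i}) \<noteq> {}" by (metis Diff_subset Int_absorb1 card_gt_0_iff)
  ultimately show ?thesis using fin by (simp add: xpow_mult)
next
  case False
  have "finite \<beta>" using assms by (rule_tac ccontr) simp
  then show ?thesis using False by (simp add: dd_simps dd_xpow_notin)
qed

section \<open>Elementary automorphisms and the Berezin integral\<close>

text \<open>Fixing \<open>y i = xvar i\<close> outside \<open>{1..n}\<close> makes equality of
  points equality of functions, and makes every \<open>y i\<close> odd, as the lemmas on
  \<open>endo\<close> require.\<close>

definition Pts :: "nat \<Rightarrow> (nat \<Rightarrow> 'a::comm_ring_1 gr) \<Rightarrow> bool" where
  "Pts n y \<longleftrightarrow> (\<forall>i\<in>{1..n}. odn (y i) \<and> grn n (y i) \<and> fil 3 (y i - xvar i)) \<and> (\<forall>i. i \<notin> {1..n} \<longrightarrow> y i = xvar i)"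

lemma odn_xvar [simp]: "odn (xvar i)"
  by (rule odn_xpow) simp

lemma PtsD:
  assumes "Pts n y"
  shows "odn (y i)" "i \<in> {1..n} \<Longrightarrow> grn n (y i)" "fil 3 (y i - xvar i)" "i \<notin> {1..n} \<Longrightarrow> y i = xvar i"
proof -
  show o: "i \<notin> {1..n} \<Longrightarrow> y i = xvar i" "i \<in> {1..n} \<Longrightarrow> grn n (y i)" using assms unfolding Pts_def by blast+
  show "odn (y i)" "fil 3 (y i - xvar i)"
    using assms o(1) unfolding Pts_def by (cases "i \<in> {1..n}"; force)+
qed

lemma Pts_xvar [simp]: "Pts n xvar"
  by (auto simp: Pts_def grn_xpow)

lemma Pts_el:
  assumes y: "Pts n y" and b: "odn b" "grn n b" "fil 3 b" and i: "i \<in> {1..n}"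
  shows "Pts n (\<lambda>k. el i b (y k))"
  unfolding Pts_def
proof (intro conjI ballI allI impI)
  fix k
  show "odn (el i b (y k))" by (simp add: el_def PtsD[OF y] b odn_evn_mult evn_dd)
  show "grn n (el i b (y k))" if "k \<in> {1..n}" using PtsD[OF y] that b by (simp add: el_def grn_dd)
  have e: "el i b (y k) - xvar k = (y k - xvar k) + b * dd i (y k)" by (simp add: el_def)
  show "fil 3 (el i b (y k) - xvar k)" unfolding e using PtsD(3)[OF y] b by (simp add: fil_mult_right)
  show "el i b (y k) = xvar k" if "k \<notin> {1..n}" using PtsD(4)[OF y that] that i by (auto simp: el_def dd_xvar)
qed

text \<open>Let y - x start in degree d and let c be its coefficient at (i, \<beta>) with |\<beta>|
  = d. Applying \<open>el i (- b)\<close> with b = c x^\<beta> subtracts b from \<open>y i\<close>;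
  every other change has degree at least d + (d - 1) > d. So one coordinate of degree d disappears
  and no other one of degree d changes. The inner induction counts the nonzero coordinates of degree
  d, the outer one raises d.\<close>

lemma Pts_induct [consumes 1, case_names id el]:
  assumes y: "Pts n y"
    and id: "Q xvar"
    and el: "\<And>z i \<beta> c. Pts n z \<Longrightarrow> Q z \<Longrightarrow> i \<in> {1..n} \<Longrightarrow> \<beta> \<subseteq> {1..n} \<Longrightarrow> odd (card \<beta>) \<Longrightarrow> 3 \<le> card \<beta> \<Longrightarrow>
      Q (\<lambda>k. el i (sc c * xpow \<beta>) (z k))"
  shows "Q y"
proof -
  have main: "Q y" if "Pts n y" "3 \<le> d" "\<And>i. fil d (y i - xvar i)" for d y
    using that
  proof (induction "n + 1 - d" arbitrary: d y rule: less_induct)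
    case less
    define S where "S y = {(i, \<beta>). i \<in> {1..n} \<and> \<beta> \<subseteq> {1..n} \<and> card \<beta> = d \<and> cf (y i - xvar i) \<beta> \<noteq> 0}"
      for y :: "nat \<Rightarrow> 'a gr"
    have finS: "finite (S y)" for y
      by (rule finite_subset[of _ "{1..n} \<times> Pow {1..n}"]) (auto simp: S_def)
    have "Q y" if "Pts n y" "\<And>i. fil d (y i - xvar i)" "card (S y) = m" for y m
      using that
    proof (induction m arbitrary: y)
      case 0
      then have S: "S y = {}" using finS by simp
      have fil: "fil (Suc d) (y i - xvar i)" for i
        unfolding fil_def
      proof (intro allI impI)
        fix \<beta> :: "nat set" assume \<beta>: "card \<beta> < Suc d"
        show "cf (y i - xvar i) \<beta> = 0"
        proof (cases "i \<in> {1..n}")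
          case True
          then have "grn n (y i - xvar i)" using PtsD[OF 0(1)] by (simp add: grn_xpow)
          then show ?thesis using S True 0(2)[of i] \<beta>
            by (cases "card \<beta> < d"; cases "\<beta> \<subseteq> {1..n}") (auto simp: S_def fil_def grn_def less_Suc_eq)
        next
          case False
          then show ?thesis using PtsD(4)[OF 0(1)] by simp
        qed
      qed
      show ?case
      \<comment> \<open>Above degree n there are no monomials left, so the point is the identity;
        this is also where the outer measure \<open>n + 1 - d\<close> stops decreasing.\<close>
      proof (cases "d \<le> n")
        case True
        then show ?thesis
          using less.hyps[of "Suc d" y] less.prems(2) 0(1) fil by simp
      next
        case False
        have "y i = xvar i" for i
        proof (cases "i \<in> {1..n}")
          case True
          have "y i - xvar i = 0"
          proof (rule gr_eqI)
            fix \<beta> :: "nat set"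
            have "card \<beta> < Suc d" if "\<beta> \<subseteq> {1..n}" using card_mono[OF _ that] False by simp
            moreover have "grn n (y i - xvar i)" using PtsD[OF 0(1)] True by (simp add: grn_xpow)
            ultimately show "cf (y i - xvar i) \<beta> = cf 0 \<beta>" using fil[of i]
              by (cases "\<beta> \<subseteq> {1..n}") (auto simp: fil_def grn_def)
          qed
          then show ?thesis by simp
        qed (rule PtsD(4)[OF 0(1)])
        then have "y = xvar" by auto
        then show ?thesis using id by simp
      qed
    next
      case (Suc m)
      then obtain i \<beta> where "(i, \<beta>) \<in> S y" by (metis card.empty ex_in_conv nat.distinct(1) surj_pair)
      then have i\<beta>: "i \<in> {1..n}" "\<beta> \<subseteq> {1..n}" "card \<beta> = d" "cf (y i - xvar i) \<beta> \<noteq> 0" by (auto simp: S_def)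
      define c where "c = cf (y i - xvar i) \<beta>"
      define b where "b = sc c * xpow \<beta>"
      have odd: "odd (card \<beta>)"
      proof
        assume "even (card \<beta>)"
        moreover have "odn (y i - xvar i)" using PtsD(1)[OF Suc.prems(1), of i] by simp
        ultimately have "cf (y i - xvar i) \<beta> = 0" by (simp only: odn_def)
        with i\<beta>(4) show False by contradiction
      qed
      have d3: "3 \<le> card \<beta>" using i\<beta> less.prems(2) by simp
      have fin\<beta>: "finite \<beta>" using i\<beta>(2) by (rule finite_subset) simp
      have b: "odn b" "grn n b" "fil d b" "b * dd i b = 0"
        using odd d3 i\<beta> fin\<beta> el_monomial[OF odd d3, of c i]
        by (simp_all add: b_def odn_xpow grn_xpow fil_xpow)
      define z where "z k = el i (- b) (y k)" for k
      have zP: "Pts n z"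
        unfolding z_def by (rule Pts_el) (use Suc.prems b i\<beta> fil_antimono[OF b(3) less.prems(2)] in auto)
      have yz: "y = (\<lambda>k. el i b (z k))" using b by (simp add: z_def el_inverse)
      have coord: "cf (z k - xvar k) \<gamma> = cf (y k - xvar k) \<gamma> - (if k = i \<and> \<gamma> = \<beta> then c else 0)"
        if "card \<gamma> \<le> d" for k \<gamma>
      proof -
        have "z k - xvar k = (y k - xvar k) - b * dd i (y k - xvar k) - b * dd i (xvar k)"
          by (simp add: z_def el_def dd_simps algebra_simps)
        moreover have "fil (Suc d) (b * dd i (y k - xvar k))"
        proof -
          have "fil (d - 1) (dd i (y k - xvar k))"
            by (rule fil_dd) (use Suc.prems(2)[of k] less.prems(2) in simp)
          then have "fil (d + (d - 1)) (b * dd i (y k - xvar k))" by (rule fil_mult[OF b(3)])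
          then show ?thesis by (rule fil_antimono) (use less.prems(2) in simp)
        qed
        then have "cf (b * dd i (y k - xvar k)) \<gamma> = 0" using that by (simp add: fil_def)
        ultimately show ?thesis by (simp add: dd_xvar b_def cf_xpow fin\<beta>)
      qed
      have zf: "fil d (z k - xvar k)" for k
        unfolding fil_def
      proof (intro allI impI)
        fix \<gamma> :: "nat set" assume \<gamma>: "card \<gamma> < d"
        then have "\<gamma> \<noteq> \<beta>" using i\<beta>(3) by auto
        then show "cf (z k - xvar k) \<gamma> = 0"
          using \<gamma> Suc.prems(2)[of k] coord[of \<gamma> k] by (simp only: fil_def) simp
      qed
      have "S z = S y - {(i, \<beta>)}"
      proof -
        have "cf (z k - xvar k) \<gamma> \<noteq> 0 \<longleftrightarrow> cf (y k - xvar k) \<gamma> \<noteq> 0 \<and> (k, \<gamma>) \<noteq> (i, \<beta>)" if "card \<gamma> = d" for k \<gamma>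
          using coord[of \<gamma> k] that c_def by auto
        then show ?thesis unfolding S_def by blast
      qed
      then have "card (S z) = m" using Suc.prems(3) \<open>(i, \<beta>) \<in> S y\<close> finS by simp
      then have "Q z" by (intro Suc.IH zP zf)
      then have "Q (\<lambda>k. el i (sc c * xpow \<beta>) (z k))" by (intro el zP i\<beta> odd d3)
      then show ?case using yz by (simp add: b_def)
    qed
    then show ?case using less.prems by simp
  qed
  show ?thesis using main[OF y, of 3] PtsD(3)[OF y] by simp
qed

section \<open>Composition and inversion of points\<close>

text \<open>The point of the composite automorphism, \<open>endo n z\<close> followed by
  \<open>endo n y\<close>; outside \<open>{1..n}\<close> it keeps the normalisation of
  \<open>Pts\<close>.\<close>

definition gcomp :: "nat \<Rightarrow> (nat \<Rightarrow> 'a::comm_ring_1 gr) \<Rightarrow> (nat \<Rightarrow> 'a gr) \<Rightarrow> nat \<Rightarrow> 'a gr" where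
  "gcomp n y z i = (if i \<in> {1..n} then endo n y (z i) else xvar i)"

lemma ghom_endo_Pts: "Pts n y \<Longrightarrow> ghom (endo n y)"
  by (rule ghom_endo) (simp add: PtsD)

text \<open>Exchanging the factors of a monomial one after the other, each step replaces one x_m by
  y_m - x_m, which trades degree 1 for degree at least 3. This makes the action on monomials
  unitriangular.\<close>

lemma fil_endo_minus:
  assumes y: "Pts n y" and a: "grn n a" "fil d a"
  shows "fil (d + 2) (endo n y a - a)"
proof -
  have *: "fil (card \<alpha> + 2) (ypow y \<alpha> - xpow \<alpha>)" if "finite \<alpha>" for \<alpha>
    using that
  proof (induction \<alpha> rule: finite_linorder_min_induct)
    case empty
    then show ?case by (simp add: xpow_empty)
  next
    case (insert m \<alpha>)
    have m: "m \<notin> \<alpha>" using insert by auto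
    have xp: "xpow (insert m \<alpha>) = (xvar m * xpow \<alpha> :: 'a gr)" using insert by (intro xpow_insert_min)
    have "ypow y (insert m \<alpha>) - xpow (insert m \<alpha>) = (y m - xvar m) * ypow y \<alpha> + xvar m * (ypow y \<alpha> - xpow \<alpha>)"
      unfolding xp using insert by (simp add: ypow_insert_min algebra_simps)
    moreover have "fil (3 + card \<alpha>) ((y m - xvar m) * ypow y \<alpha>)"
      by (intro fil_mult fil_ypow PtsD[OF y] insert)
    moreover have "fil (1 + (card \<alpha> + 2)) (xvar m * (ypow y \<alpha> - xpow \<alpha>))"
      by (intro fil_mult insert odn_fil_1) simp
    ultimately show ?case using insert m by (simp add: eval_nat_numeral)
  qed
  have "endo n y a - a = (\<Sum>\<alpha>\<in>Pow {1..n}. sc (cf a \<alpha>) * (ypow y \<alpha> - xpow \<alpha>))"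
    unfolding right_diff_distrib sum_subtractf grn_expand[OF a(1), symmetric] endo_def[symmetric] ..
  also have "fil (d + 2) \<dots>"
  proof (rule fil_sum)
    fix \<alpha> assume "\<alpha> \<in> Pow {1..n}"
    then have fin: "finite \<alpha>" by (auto intro: finite_subset)
    show "fil (d + 2) (sc (cf a \<alpha>) * (ypow y \<alpha> - xpow \<alpha>))"
    proof (cases "card \<alpha> < d")
      case True
      then show ?thesis using a(2) by (simp add: fil_def)
    next
      case False
      then have "fil (d + 2) (ypow y \<alpha> - xpow \<alpha>)" using *[OF fin] by (rule_tac fil_antimono) auto
      then show ?thesis by simp
    qed
  qed
  finally show ?thesis .
qed

lemma Pts_gcomp:
  assumes y: "Pts n y" and z: "Pts n z"
  shows "Pts n (gcomp n y z)"
  unfolding Pts_def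
proof (intro conjI ballI allI impI)
  fix i assume i: "i \<in> {1..n}"
  show "odn (gcomp n y z i)" using i by (simp add: gcomp_def odn_endo PtsD[OF y] PtsD[OF z])
  show "grn n (gcomp n y z i)" using i grn_endo[OF PtsD(2)[OF y]] by (simp add: gcomp_def)
  have e: "gcomp n y z i - xvar i = (endo n y (z i - xvar i)) + (y i - xvar i)"
    using i by (simp add: gcomp_def ghomD[OF ghom_endo_Pts[OF y]] endo_xvar)
  have "fil 3 (endo n y (z i - xvar i))"
    by (rule fil_endo) (use PtsD[OF y] PtsD[OF z] in auto)
  then show "fil 3 (gcomp n y z i - xvar i)" unfolding e using PtsD(3)[OF y] by simp
qed (simp only: gcomp_def if_False)

lemma endo_gcomp: "Pts n y \<Longrightarrow> endo n (gcomp n y z) a = endo n y (endo n z a)"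
  unfolding ghom_endo_comp[OF ghom_endo_Pts] by (rule endo_cong) (simp add: gcomp_def)

lemma gcomp_assoc: "Pts n y \<Longrightarrow> gcomp n (gcomp n y z) w = gcomp n y (gcomp n z w)"
  by (rule ext) (simp add: gcomp_def endo_gcomp)

lemma gcomp_xvar: "Pts n y \<Longrightarrow> gcomp n xvar y = y" "Pts n y \<Longrightarrow> gcomp n y xvar = y"
  by (rule ext; simp add: gcomp_def endo_id PtsD endo_xvar)+

text \<open>If \<open>w\<close> is a left inverse of \<open>z\<close> and \<open>u\<close> is the
  point of \<open>el i (- b)\<close>, then composing \<open>w\<close> with \<open>u\<close> undoes
  first the elementary factor and then \<open>z\<close>.\<close>

lemma Pts_left_inverse: "Pts n y \<Longrightarrow> \<exists>z. Pts n z \<and> gcomp n z y = xvar"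
proof (induction rule: Pts_induct)
  case id
  then show ?case using gcomp_xvar(1)[OF Pts_xvar] Pts_xvar by blast
next
  case (el z i \<beta> c)
  define b where "b = sc c * xpow \<beta>"
  have fin\<beta>: "finite \<beta>" using el.hyps(3) by (rule finite_subset) simp
  have b: "odn b" "grn n b" "fil 3 b" "b * dd i b = 0" "b * dd i (- b) = 0"
    using el el_monomial[of \<beta> c i] fin\<beta> by (simp_all add: b_def odn_xpow grn_xpow fil_xpow dd_simps)
  from el obtain w where w: "Pts n w" "gcomp n w z = xvar" by blast
  define u where "u k = el i (- b) (xvar k)" for k
  have u: "Pts n u" unfolding u_def by (rule Pts_el) (use b el in auto)
  have elu: "endo n u a = el i (- b) a" if "grn n a" for a
    unfolding u_def by (rule ghom_eq_endo[symmetric]) (use b that in \<open>auto intro: ghom_el\<close>)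
  have "gcomp n (gcomp n w u) (\<lambda>k. el i b (z k)) = gcomp n w (gcomp n u (\<lambda>k. el i b (z k)))"
    by (rule gcomp_assoc[OF w(1)])
  also have "gcomp n u (\<lambda>k. el i b (z k)) = z"
  proof
    fix k show "gcomp n u (\<lambda>k. el i b (z k)) k = z k"
    proof (cases "k \<in> {1..n}")
      case True
      then have "grn n (el i b (z k))" using b PtsD(2)[OF el.hyps(1)] by (simp add: el_def grn_dd)
      then show ?thesis using True el_inverse[of "- b" i "z k"] b by (simp add: gcomp_def elu)
    next
      case False
      then show ?thesis using PtsD(4)[OF el.hyps(1) False] by (simp only: gcomp_def if_False)
    qed
  qed
  finally have "gcomp n (gcomp n w u) (\<lambda>k. el i b (z k)) = xvar" using w by simp
  then show ?case using Pts_gcomp[OF w(1) u] unfolding b_def by blast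
qed

text \<open>The left inverse of a left inverse of \<open>y\<close> is \<open>y\<close> itself, so
  left inverses are two-sided.\<close>

lemma Pts_inverse:
  assumes "Pts n y"
  obtains z where "Pts n z" "gcomp n z y = xvar" "gcomp n y z = xvar"
proof -
  obtain z where z: "Pts n z" "gcomp n z y = xvar" using Pts_left_inverse[OF assms] by blast
  obtain w where w: "Pts n w" "gcomp n w z = xvar" using Pts_left_inverse[OF z(1)] by blast
  have "w = gcomp n w (gcomp n z y)" using z w by (simp add: gcomp_xvar)
  also have "\<dots> = y" using w assms by (simp add: gcomp_assoc[symmetric] gcomp_xvar)
  finally show ?thesis using that z w by simp
qed

lemma jac_gcomp:
  assumes y: "Pts n y" and z: "Pts n z"
  shows "jac n (gcomp n y z) = jac n y * endo n y (jac n z)"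
proof -
  have "jac n (gcomp n y z) = jac n (\<lambda>i. endo n y (z i))" by (rule jac_cong) (simp add: gcomp_def)
  also have "\<dots> = jac n y * endo n y (jac n z)" by (rule jac_endo) (use PtsD[OF y] PtsD[OF z] in auto)
  finally show ?thesis .
qed

lemma jac_xvar: "jac n xvar = 1"
proof (cases "n = 0")
  case True
  then show ?thesis by (simp add: jac_def pdet_def)
next
  case False
  then show ?thesis using jac_except_row[of n 1 xvar] by (simp add: dd_xvar)
qed

text \<open>The Berezin integral of \<open>a\<close> is its coefficient at \<open>x\<^sub>1 \<dots> x\<^sub>n\<close>.\<close>

lemma berezin:
  assumes "Pts n y"
  shows "\<exists>u. u * jac n y = 1 \<and> grn n u \<and> (\<forall>f. grn n f \<longrightarrow> cf (u * endo n y f) {1..n} = cf f {1..n})"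
  using assms
proof (induction rule: Pts_induct)
  case id
  then show ?case by (intro exI[of _ 1]) (simp add: jac_xvar endo_id)
next
  case (el z i \<beta> c)
  define b where "b = sc c * xpow \<beta>"
  have fin\<beta>: "finite \<beta>" using el.hyps(3) by (rule finite_subset) simp
  have b: "odn b" "grn n b" "fil 3 b" "b * dd i b = 0"
    using el el_monomial[of \<beta> c i] fin\<beta> by (simp_all add: b_def odn_xpow grn_xpow fil_xpow)
  have db: "evn (dd i b)" "dd i b * b = 0" using b evn_commute[OF evn_dd[OF b(1)], of i b] by (simp_all add: evn_dd)
  \<comment> \<open>This is the derivative of the relation b \<partial>b = 0, because applying
    \<partial> twice gives zero.\<close>
  have db2: "dd i b * dd i b = 0"
    using dd_mult_odn[OF b(1), of i "dd i b"] b(4) by (simp add: dd_dd dd_simps)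
  from el obtain u where u: "u * jac n z = 1" "grn n u"
    "\<And>f. grn n f \<Longrightarrow> cf (u * endo n z f) {1..n} = cf f {1..n}" by blast
  define w where "w k = el i b (xvar k)" for k
  have w: "Pts n w" unfolding w_def by (rule Pts_el) (use b el in auto)
  note H = ghomD[OF ghom_el[OF b(1)]]
  have elw: "endo n w a = el i b a" if "grn n a" for a
    unfolding w_def by (rule ghom_eq_endo[symmetric]) (use b that in \<open>auto intro: ghom_el\<close>)
  have gj: "grn n (jac n z)" by (rule grn_jac) (use PtsD[OF el.hyps(1)] in auto)
  have "jac n (\<lambda>k. el i b (z k)) = jac n (gcomp n w z)"
    by (rule jac_cong) (simp add: gcomp_def elw PtsD[OF el.hyps(1)])
  also have "\<dots> = jac n w * el i b (jac n z)" using jac_gcomp[OF w el.hyps(1)] elw[OF gj] by simp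
  also have "jac n w = 1 + dd i b"
    using jac_except_row[of n i w] el.hyps(2) PtsD(1)[OF w, of i]
    by (simp add: w_def el_def dd_xvar dd_simps)
  finally have jac: "jac n (\<lambda>k. el i b (z k)) = (1 + dd i b) * el i b (jac n z)" .
  \<comment> \<open>The new Jacobian is 1 + \<partial>b times the image of the old one. As
    \<partial>b squares to zero, 1 - \<partial>b inverts the first factor, and the image of
    \<open>u\<close> inverts the second.\<close>
  have inv: "(1 - dd i b) * el i b u * jac n (\<lambda>k. el i b (z k)) = 1"
  proof -
    have "(1 - dd i b) * el i b u * jac n (\<lambda>k. el i b (z k)) =
        (1 - dd i b) * (el i b u * (1 + dd i b)) * el i b (jac n z)"
      by (simp only: jac mult.assoc)
    also have "el i b u * (1 + dd i b) = (1 + dd i b) * el i b u"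
      by (rule evn_commute[symmetric]) (simp add: db)
    also have "(1 - dd i b) * ((1 + dd i b) * el i b u) * el i b (jac n z) =
        ((1 - dd i b) * (1 + dd i b)) * el i b (u * jac n z)"
      by (simp only: H mult.assoc)
    also have "\<dots> = 1" using db2 by (simp add: u H algebra_simps)
    finally show ?thesis .
  qed
  \<comment> \<open>The product is g minus the total derivative \<partial>(b g)/\<partial>x_i, and a
    derivative with respect to x_i has no term containing x_i.\<close>
  have top: "cf ((1 - dd i b) * el i b g) {1..n} = cf g {1..n}" for g
  proof -
    have "(1 - dd i b) * el i b g = g - dd i (b * g)"
      using db(2) by (simp add: el_def dd_mult_odn b algebra_simps) (simp add: mult.assoc[symmetric])
    moreover have "cf (dd i (b * g)) {1..n} = 0" using el.hyps(2) by (simp only: cf_dd if_True)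
    ultimately show ?thesis by simp
  qed
  show ?case
    unfolding b_def[symmetric]
  proof (intro exI[of _ "(1 - dd i b) * el i b u"] conjI allI impI)
    show "grn n ((1 - dd i b) * el i b u)" using b u by (simp add: el_def grn_dd)
    fix f :: "'a gr" assume f: "grn n f"
    have "endo n (\<lambda>k. el i b (z k)) f = el i b (endo n z f)" by (rule ghom_endo_comp[symmetric, OF ghom_el[OF b(1)]])
    then have "(1 - dd i b) * el i b u * endo n (\<lambda>k. el i b (z k)) f = (1 - dd i b) * el i b (u * endo n z f)"
      by (simp only: H mult.assoc)
    then show "cf ((1 - dd i b) * el i b u * endo n (\<lambda>k. el i b (z k)) f) {1..n} = cf f {1..n}"
      using top u(3)[OF f] by simp
  qed (rule inv)
qed

section \<open>First-order expansion of the Jacobian\<close>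

definition evfil :: "nat \<Rightarrow> 'a::comm_ring_1 gev \<Rightarrow> bool" where
  "evfil d a \<longleftrightarrow> fil d (of_ev a)"

lemma evfil_simps [simp]: "evfil d 0" "evfil 0 a" "evfil d a \<Longrightarrow> evfil d b \<Longrightarrow> evfil d (a + b)"
    "evfil d a \<Longrightarrow> evfil d b \<Longrightarrow> evfil d (a - b)" "evfil d a \<Longrightarrow> evfil d (a * b)" "evfil d b \<Longrightarrow> evfil d (a * b)"
  by (simp_all add: evfil_def fil_mult_left fil_mult_right)

lemma evfil_mult: "evfil d a \<Longrightarrow> evfil e b \<Longrightarrow> evfil (d + e) (a * b)"
  by (simp add: evfil_def fil_mult)

lemma evfil_sum: "(\<And>i. i \<in> A \<Longrightarrow> evfil d (f i)) \<Longrightarrow> evfil d (sum f A)"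
  by (induction A rule: infinite_finite_induct) auto

lemma evfil_prod_diff:
  assumes "\<And>i. i \<in> S \<Longrightarrow> evfil d (f i - g i)"
  shows "evfil d (prod f S - prod g S)"
  using assms
proof (induction S rule: infinite_finite_induct)
  case (insert k S)
  have "prod f (insert k S) - prod g (insert k S) = (f k - g k) * prod f S + g k * (prod f S - prod g S)"
    using insert by (simp add: algebra_simps)
  then show ?case using insert by simp
qed simp_all

text \<open>When the factors are exchanged one at a time, each difference \<open>f k - g k\<close>
  is multiplied by something congruent to 1, which changes it only in degree at least d + 1.\<close>

lemma evfil_prod_unipotent:
  assumes "\<And>i. i \<in> S \<Longrightarrow> evfil d (f i - g i)" "\<And>i. i \<in> S \<Longrightarrow> evfil 1 (f i - 1)" "\<And>i. i \<in> S \<Longrightarrow> evfil 1 (g i - 1)"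
  shows "evfil (d + 1) (prod f S - prod g S - (\<Sum>i\<in>S. f i - g i))"
  using assms
proof (induction S rule: infinite_finite_induct)
  case (insert k S)
  have "evfil 1 (prod f S - prod (\<lambda>_. 1) S)" by (rule evfil_prod_diff) (use insert in auto)
  then have "evfil (d + 1) ((f k - g k) * (prod f S - 1))" using insert by (intro evfil_mult) auto
  moreover have "evfil (1 + d) ((g k - 1) * (prod f S - prod g S))"
    by (intro evfil_mult evfil_prod_diff) (use insert in auto)
  moreover have "evfil (d + 1) (prod f S - prod g S - (\<Sum>i\<in>S. f i - g i))" using insert by auto
  moreover have "prod f (insert k S) - prod g (insert k S) - (\<Sum>i\<in>insert k S. f i - g i) =
      (f k - g k) * (prod f S - 1) + (g k - 1) * (prod f S - prod g S) + (prod f S - prod g S - (\<Sum>i\<in>S. f i - g i))"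
    using insert by (simp add: algebra_simps)
  ultimately show ?case by (simp add: add.commute)
qed simp_all

text \<open>With factors of positive degree at two places, one of them is still present as a
  cofactor whichever factor is exchanged.\<close>

lemma evfil_prod_two:
  assumes "\<And>i. i \<in> S \<Longrightarrow> evfil d (f i - g i)" "finite S" "k \<in> S" "l \<in> S" "k \<noteq> l"
    "evfil 1 (f l)" "evfil 1 (g k)"
  shows "evfil (d + 1) (prod f S - prod g S)"
proof -
  have l: "l \<in> S - {k}" using assms by auto
  have e: "prod f S = f k * prod f (S - {k})" "prod g S = g k * prod g (S - {k})"
    using assms by (simp_all add: prod.remove)
  have "evfil 1 (prod f (S - {k}))" using prod.remove[OF _ l, of f] assms by simp
  then have "evfil (d + 1) ((f k - g k) * prod f (S - {k}))" using assms by (intro evfil_mult) auto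
  moreover have "evfil (1 + d) (g k * (prod f (S - {k}) - prod g (S - {k})))"
    by (intro evfil_mult evfil_prod_diff) (use assms in auto)
  moreover have "prod f S - prod g S = (f k - g k) * prod f (S - {k}) + g k * (prod f (S - {k}) - prod g (S - {k}))"
    unfolding e by (simp add: algebra_simps)
  ultimately show ?thesis by (simp add: add.commute)
qed

text \<open>A permutation other than the identity has two off-diagonal factors, both of positive
  degree, so by \<open>evfil_prod_two\<close> it contributes only in degree d + 1. The identity
  permutation contributes the trace of the difference.\<close>

lemma evfil_pdet_diff:
  fixes A B :: "nat \<Rightarrow> nat \<Rightarrow> 'a::comm_ring_1 gev"
  assumes AB: "\<And>i j. i \<in> {1..n} \<Longrightarrow> j \<in> {1..n} \<Longrightarrow> evfil d (A i j - B i j)"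
    and A: "\<And>i j. i \<in> {1..n} \<Longrightarrow> j \<in> {1..n} \<Longrightarrow> evfil 1 (A i j - (if i = j then 1 else 0))"
    and B: "\<And>i j. i \<in> {1..n} \<Longrightarrow> j \<in> {1..n} \<Longrightarrow> evfil 1 (B i j - (if i = j then 1 else 0))"
  shows "evfil (d + 1) (pdet n A - pdet n B - (\<Sum>i\<in>{1..n}. A i i - B i i))"
proof -
  let ?t = "\<lambda>p. (\<Prod>i\<in>{1..n}. A i (p i)) - (\<Prod>i\<in>{1..n}. B i (p i))"
  let ?P = "{p. p permutes {1..n}}"
  have fin: "finite ?P" by (rule finite_permutations) simp
  have "pdet n A - pdet n B = (\<Sum>p\<in>?P. of_int (sign p) * ?t p)"
    by (simp add: pdet_def sum_subtractf right_diff_distrib)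
  also have "\<dots> = of_int (sign id) * ?t id + (\<Sum>p\<in>?P - {id}. of_int (sign p) * ?t p)"
    by (subst sum.remove[OF fin, of id]) (simp_all add: permutes_id)
  finally have eq: "pdet n A - pdet n B - (\<Sum>i\<in>{1..n}. A i i - B i i) =
      (?t id - (\<Sum>i\<in>{1..n}. A i i - B i i)) + (\<Sum>p\<in>?P - {id}. of_int (sign p) * ?t p)"
    by (simp add: algebra_simps)
  have 1: "evfil (d + 1) (?t id - (\<Sum>i\<in>{1..n}. A i i - B i i))"
    unfolding id_apply
  proof (rule evfil_prod_unipotent)
    fix i assume i: "i \<in> {1..n}"
    show "evfil d (A i i - B i i)" using AB[OF i i] .
    show "evfil 1 (A i i - 1)" "evfil 1 (B i i - 1)" using A[OF i i] B[OF i i] by simp_all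
  qed
  have 2: "evfil (d + 1) (\<Sum>p\<in>?P - {id}. of_int (sign p) * ?t p)"
  proof (intro evfil_sum evfil_simps(6))
    fix p assume "p \<in> ?P - {id}"
    then have p: "p permutes {1..n}" "p \<noteq> id" by auto
    have im: "p i \<in> {1..n}" if "i \<in> {1..n}" for i using that by (simp only: permutes_in_image[OF p(1)])
    obtain k where k: "p k \<noteq> k" using p(2) by force
    then have k': "p (p k) \<noteq> p k" using permutes_inj[OF p(1)] by (auto dest: injD)
    have kn: "k \<in> {1..n}" by (rule ccontr) (use permutes_not_in[OF p(1)] k in blast)
    show "evfil (d + 1) (?t p)"
    proof (rule evfil_prod_two[of _ _ _ _ k "p k"])
      show "evfil 1 (A (p k) (p (p k)))" using A[OF im[OF kn] im[OF im[OF kn]]] k' by simp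
      show "evfil 1 (B k (p k))" using B[OF kn im[OF kn]] k by simp
    qed (use AB im kn k in auto)
  qed
  show ?thesis unfolding eq by (rule evfil_simps(3)[OF 1 2])
qed

text \<open>Two arbitrary points are compared here, because the elimination compares the universal
  point with the one in which the coordinates not yet solved for are set to zero.\<close>

lemma jac_diff:
  assumes y: "Pts n y" and z: "Pts n z" and d: "\<And>i. i \<in> {1..n} \<Longrightarrow> fil (Suc d) (y i - z i)"
  shows "fil (d + 1) (jac n y - jac n z - (\<Sum>i\<in>{1..n}. dd i (y i - z i)))"
proof -
  have unip: "evfil 1 (Ev (dd j (w i)) - (if i = j then 1 else 0))" if "Pts n w" for w :: "nat \<Rightarrow> 'a gr" and i j
  proof -
    have "fil (Suc 1) (w i - xvar i)" using PtsD(3)[OF that, of i] by (rule fil_antimono) simp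
    then have "fil 1 (dd j (w i - xvar i))" by (rule fil_dd)
    then show ?thesis using PtsD(1)[OF that] by (auto simp: evfil_def evn_dd dd_simps dd_xvar)
  qed
  have "evfil (d + 1) (pdet n (\<lambda>i j. Ev (dd j (y i))) - pdet n (\<lambda>i j. Ev (dd j (z i))) -
      (\<Sum>i\<in>{1..n}. Ev (dd i (y i)) - Ev (dd i (z i))))"
  proof (rule evfil_pdet_diff)
    fix i j assume i: "i \<in> {1..n}"
    show "evfil d (Ev (dd j (y i)) - Ev (dd j (z i)))"
      using fil_dd[OF d[OF i], of j] PtsD(1)[OF y] PtsD(1)[OF z] by (simp add: evfil_def evn_dd dd_simps)
  qed (use unip y z in auto)
  then show ?thesis
    using PtsD(1)[OF y] PtsD(1)[OF z] by (simp add: evfil_def jac_def of_ev_sum evn_dd dd_simps)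
qed

section \<open>Base change and coordinates\<close>

definition rhom :: "('a::comm_ring_1 \<Rightarrow> 'b::comm_ring_1) \<Rightarrow> bool" where
  "rhom \<phi> \<longleftrightarrow> (\<forall>a b. \<phi> (a + b) = \<phi> a + \<phi> b) \<and> (\<forall>a b. \<phi> (a * b) = \<phi> a * \<phi> b) \<and> \<phi> 1 = 1"

lemma rhomD:
  assumes "rhom \<phi>"
  shows "\<phi> (a + b) = \<phi> a + \<phi> b" "\<phi> (a * b) = \<phi> a * \<phi> b" "\<phi> 1 = 1"
    "\<phi> 0 = 0" "\<phi> (- a) = - \<phi> a" "\<phi> (a - b) = \<phi> a - \<phi> b"
proof -
  show *: "\<phi> (a + b) = \<phi> a + \<phi> b" "\<phi> (a * b) = \<phi> a * \<phi> b" "\<phi> 1 = 1" for a b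
    using assms by (auto simp: rhom_def)
  show 0: "\<phi> 0 = 0" using *(1)[of 0 0] by simp
  show neg: "\<phi> (- a) = - \<phi> a" for a
    using *(1)[of a "- a"] 0 by (simp add: eq_neg_iff_add_eq_0 add.commute)
  show "\<phi> (a - b) = \<phi> a - \<phi> b" using *(1)[of a "- b"] neg by simp
qed

lemma rhom_sum: "rhom \<phi> \<Longrightarrow> \<phi> (sum f A) = (\<Sum>x\<in>A. \<phi> (f x))"
  by (induction A rule: infinite_finite_induct) (auto simp: rhomD)

lemma rhom_power: "rhom \<phi> \<Longrightarrow> \<phi> (a ^ k) = \<phi> a ^ k"
  by (induction k) (auto simp: rhomD)

lemma rhom_gsign: "rhom \<phi> \<Longrightarrow> \<phi> (gsign \<alpha> \<beta>) = gsign \<alpha> \<beta>"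
  by (simp add: gsign_def rhom_power rhomD)

definition gmap :: "('a::comm_ring_1 \<Rightarrow> 'b::comm_ring_1) \<Rightarrow> 'a gr \<Rightarrow> 'b gr" where
  "gmap \<phi> a = Gr (\<lambda>\<alpha>. \<phi> (cf a \<alpha>))"

lemma cf_gmap: "rhom \<phi> \<Longrightarrow> cf (gmap \<phi> a) \<alpha> = \<phi> (cf a \<alpha>)"
  unfolding gmap_def by (subst cf_Gr) (simp_all add: cf_infinite rhomD)

context
  fixes \<phi> :: "'a::comm_ring_1 \<Rightarrow> 'b::comm_ring_1"
  assumes \<phi>: "rhom \<phi>"
begin

lemma gmap_simps: "gmap \<phi> 0 = 0" "gmap \<phi> 1 = 1" "gmap \<phi> (a + b) = gmap \<phi> a + gmap \<phi> b"
    "gmap \<phi> (a - b) = gmap \<phi> a - gmap \<phi> b" "gmap \<phi> (a * b) = gmap \<phi> a * gmap \<phi> b"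
    "gmap \<phi> (sc c) = sc (\<phi> c)" "gmap \<phi> (dd j a) = dd j (gmap \<phi> a)"
  by (rule gr_eqI; simp add: cf_gmap[OF \<phi>] rhomD[OF \<phi>] cf_one gmonom_def cf_times rhom_sum[OF \<phi>]
      rhom_gsign[OF \<phi>] cf_sc cf_dd)+

lemma gmap_xpow: "finite \<alpha> \<Longrightarrow> gmap \<phi> (xpow \<alpha>) = xpow \<alpha>"
  by (rule gr_eqI) (simp add: cf_gmap[OF \<phi>] rhomD[OF \<phi>] cf_xpow)

lemma gmap_sum: "gmap \<phi> (sum f A) = (\<Sum>x\<in>A. gmap \<phi> (f x))"
  by (induction A rule: infinite_finite_induct) (auto simp: gmap_simps)

lemma gmap_ypow: "gmap \<phi> (ypow y \<alpha>) = ypow (\<lambda>i. gmap \<phi> (y i)) \<alpha>"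
proof -
  have "gmap \<phi> (prod_list (map y xs)) = prod_list (map (\<lambda>i. gmap \<phi> (y i)) xs)" for xs
    by (induction xs) (auto simp: gmap_simps)
  then show ?thesis by (simp add: ypow_def)
qed

lemma gmap_endo: "gmap \<phi> (endo n y a) = endo n (\<lambda>i. gmap \<phi> (y i)) (gmap \<phi> a)"
  by (simp add: endo_def gmap_sum gmap_simps gmap_ypow cf_gmap[OF \<phi>])

lemma evn_gmap: "evn a \<Longrightarrow> evn (gmap \<phi> a)"
  by (simp add: evn_def cf_gmap[OF \<phi>] rhomD[OF \<phi>])

text \<open>Hence the equations of the universal point specialise to the Jacobian equations of every
  point over every ring.\<close>

lemma gmap_jac:
  assumes "\<And>i. i \<in> {1..n} \<Longrightarrow> odn (y i)"
  shows "gmap \<phi> (jac n y) = jac n (\<lambda>i. gmap \<phi> (y i))"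
proof -
  define h where "h a = Ev (gmap \<phi> (of_ev a))" for a
  have of_h: "of_ev (h a) = gmap \<phi> (of_ev a)" for a by (simp add: h_def evn_gmap)
  have "h (pdet n (\<lambda>i j. Ev (dd j (y i)))) = pdet n (\<lambda>i j. h (Ev (dd j (y i))))"
    by (rule ring_hom_pdet) (simp_all add: of_ev_inject[symmetric] of_h gmap_simps)
  also have "\<dots> = pdet n (\<lambda>i j. Ev (dd j (gmap \<phi> (y i))))"
    by (rule pdet_cong) (use assms in \<open>simp add: h_def evn_dd gmap_simps\<close>)
  finally show ?thesis unfolding jac_def of_h[symmetric] by simp
qed

end

section \<open>Points from coordinates\<close>

definition pt :: "nat \<Rightarrow> (nat \<times> nat set \<Rightarrow> 'a::comm_ring_1) \<Rightarrow> nat \<Rightarrow> 'a gr" where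
  "pt n c i = xvar i + Gr (\<lambda>\<alpha>. if (i, \<alpha>) \<in> Gamma_index n then c (i, \<alpha>) else 0)"

lemma Gamma_index_finite: "(i, \<alpha>) \<in> Gamma_index n \<Longrightarrow> finite \<alpha>"
  by (auto simp: Gamma_index_def finite_subset)

lemma finite_Gamma_index [simp]: "finite (Gamma_index n)"
  by (rule finite_subset[of _ "{1..n} \<times> Pow {1..n}"]) (auto simp: Gamma_index_def)

lemma cf_pt: "cf (pt n c i) \<alpha> = cf (xvar i) \<alpha> + (if (i, \<alpha>) \<in> Gamma_index n then c (i, \<alpha>) else 0)"
  unfolding pt_def cf_plus by (subst cf_Gr) (auto dest: Gamma_index_finite)

lemma Pts_pt: "Pts n (pt n c)"
proof -
  define a where "a i = Gr (\<lambda>\<alpha>. if (i, \<alpha>) \<in> Gamma_index n then c (i, \<alpha>) else 0)" for i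
  have cf: "cf (a i) \<alpha> = (if (i, \<alpha>) \<in> Gamma_index n then c (i, \<alpha>) else 0)" for i \<alpha>
    unfolding a_def by (subst cf_Gr) (auto dest: Gamma_index_finite)
  have a: "odn (a i)" "grn n (a i)" "fil 3 (a i)" "i \<notin> {1..n} \<Longrightarrow> a i = 0" for i
    unfolding odn_def grn_def fil_def by (auto simp: cf Gamma_index_def intro!: gr_eqI)
  have "pt n c i = xvar i + a i" for i by (simp add: pt_def a_def)
  then show ?thesis using a by (auto simp: Pts_def grn_xpow)
qed

lemma pt_coords: "Pts n y \<Longrightarrow> pt n (\<lambda>(i, \<alpha>). cf (y i - xvar i) \<alpha>) = y"
proof (rule ext, rule gr_eqI)
  fix i :: nat and \<alpha> :: "nat set" assume y: "Pts n y"
  have "cf (y i - xvar i) \<alpha> = 0" if "(i, \<alpha>) \<notin> Gamma_index n"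
  proof (cases "i \<in> {1..n}")
    case True
    have "odn (y i - xvar i)" "grn n (y i - xvar i)" "fil 3 (y i - xvar i)"
      using PtsD[OF y] True by (simp_all add: grn_xpow)
    moreover have "\<not> \<alpha> \<subseteq> {1..n} \<or> even (card \<alpha>) \<or> card \<alpha> < 3"
      using that True by (auto simp: Gamma_index_def)
    ultimately show ?thesis unfolding odn_def grn_def fil_def by blast
  next
    case False
    then show ?thesis using PtsD(4)[OF y False] by simp
  qed
  then show "cf (pt n (\<lambda>(i, \<alpha>). cf (y i - xvar i) \<alpha>) i) \<alpha> = cf (y i) \<alpha>" by (simp add: cf_pt)
qed

lemma pt_cong: "(\<And>v. v \<in> Gamma_index n \<Longrightarrow> c v = d v) \<Longrightarrow> pt n c = pt n d"
  by (rule ext, rule gr_eqI) (simp add: cf_pt)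

lemma gmap_pt: "rhom \<phi> \<Longrightarrow> gmap \<phi> (pt n c i) = pt n (\<lambda>v. \<phi> (c v)) i"
  by (rule gr_eqI) (auto simp: cf_gmap cf_pt rhomD cf_xpow)

lemma gmap_gcomp:
  assumes "rhom \<phi>"
  shows "gmap \<phi> (gcomp n y z i) = gcomp n (\<lambda>i. gmap \<phi> (y i)) (\<lambda>i. gmap \<phi> (z i)) i"
  using assms by (simp add: gcomp_def gmap_endo gmap_xpow)

section \<open>Translation to the Grassmann algebra as a record\<close>

lemma carrier_grassmann: "a \<in> carrier (grassmann n) \<longleftrightarrow> (\<exists>g. grn n g \<and> a = cf g)"
proof
  assume a: "a \<in> carrier (grassmann n)"
  have "a \<alpha> = 0" if "infinite \<alpha>" for \<alpha>
    using a that finite_subset[of \<alpha> "{1..n}"] by (auto simp: grassmann_def)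
  then have "cf (Gr a) = a" by (rule cf_Gr)
  moreover from this have "grn n (Gr a)" using a by (simp add: grn_def grassmann_def)
  ultimately show "\<exists>g. grn n g \<and> a = cf g" by metis
qed (auto simp: grassmann_def grn_def)

lemma carrier_grassmannE:
  assumes "a \<in> carrier (grassmann n)"
  obtains g where "grn n g" "a = cf g"
  using assms by (auto simp: carrier_grassmann)

lemma carrier_cf [simp]: "cf g \<in> carrier (grassmann n) \<longleftrightarrow> grn n g"
  by (auto simp: grassmann_def grn_def)

lemma Gr_cf [simp]: "Gr (cf g) = g"
  by (rule cf_inverse)

lemma grassmann_ops [simp]:
  "cf g \<otimes>\<^bsub>grassmann n\<^esub> cf h = cf (g * h)" "cf g \<oplus>\<^bsub>grassmann n\<^esub> cf h = cf (g + h)"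
  "\<one>\<^bsub>grassmann n\<^esub> = cf 1" "\<zero>\<^bsub>grassmann n\<^esub> = cf 0"
  by (simp_all add: grassmann_def cf_times cf_one)

lemma gscale_cf [simp]: "gscale c (cf g) = cf (sc c * g)"
  by (rule ext) (simp add: gscale_def)

lemma gvar_cf: "gvar i = cf (xvar i)"
  by (rule ext) (simp add: cf_xpow gmonom_def)

lemma ring_grassmann: "ring (grassmann n :: (nat set \<Rightarrow> 'a::comm_ring_1) ring)"
proof (rule ringI)
  show "abelian_group (grassmann n :: (nat set \<Rightarrow> 'a) ring)"
  proof (rule abelian_groupI)
    fix a :: "nat set \<Rightarrow> 'a" assume "a \<in> carrier (grassmann n)"
    then obtain g where g: "grn n g" "a = cf g" by (auto simp: carrier_grassmann)
    then show "\<exists>b\<in>carrier (grassmann n). b \<oplus>\<^bsub>grassmann n\<^esub> a = \<zero>\<^bsub>grassmann n\<^esub>"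
      by (intro bexI[of _ "cf (- g)"]) (simp_all del: cf_plus cf_uminus cf_zero)
  qed (auto elim!: carrier_grassmannE simp: add_ac simp del: cf_plus cf_zero)
  show "Group.monoid (grassmann n :: (nat set \<Rightarrow> 'a) ring)"
    by (rule monoidI) (auto elim!: carrier_grassmannE simp: mult.assoc)
qed (auto elim!: carrier_grassmannE simp: algebra_simps simp del: cf_plus)

lemma grassmann_minus:
  assumes "grn n g" "grn n h"
  shows "cf g \<ominus>\<^bsub>grassmann n\<^esub> cf h = cf (g - h)"
proof -
  interpret ring "grassmann n :: (nat set \<Rightarrow> 'a) ring" by (rule ring_grassmann)
  have "\<ominus>\<^bsub>grassmann n\<^esub> cf h = cf (- h)"
    by (rule minus_equality) (use assms in \<open>simp_all del: cf_plus cf_uminus cf_zero\<close>)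
  then show ?thesis by (simp add: a_minus_def del: cf_plus cf_uminus cf_minus)
qed

lemma godd_cf: "cf g \<in> godd n \<longleftrightarrow> grn n g \<and> odn g"
  by (auto simp: godd_def odn_def)

lemma gmax_cf: "cf g \<in> gmax n \<longleftrightarrow> grn n g \<and> fil 1 g"
proof -
  have "cf g {} = 0 \<longleftrightarrow> fil 1 g"
  proof
    assume *: "cf g {} = 0"
    show "fil 1 g" unfolding fil_def
    proof (intro allI impI)
      fix \<alpha> :: "nat set" assume "card \<alpha> < 1"
      then show "cf g \<alpha> = 0" using * by (cases "finite \<alpha>") (auto simp: cf_infinite)
    qed
  qed (auto simp: fil_def)
  then show ?thesis by (auto simp: gmax_def)
qed

lemma ideal_prod_fil:
  assumes "a \<in> ideal_prod (grassmann n) I J"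
    "\<And>g. g \<in> I \<Longrightarrow> \<exists>h. g = cf h \<and> grn n h \<and> fil d h" "\<And>g. g \<in> J \<Longrightarrow> \<exists>h. g = cf h \<and> grn n h \<and> fil e h"
  shows "\<exists>h. a = cf h \<and> grn n h \<and> fil (d + e) h"
  using assms(1)
proof (induction rule: ideal_prod.induct)
  case (prod i j)
  then obtain g h where "i = cf g" "grn n g" "fil d g" "j = cf h" "grn n h" "fil e h"
    using assms(2,3) by blast
  then show ?case by (intro exI[of _ "g * h"]) (simp add: fil_mult)
next
  case (sum s1 s2)
  then obtain g h where gh: "s1 = cf g" "grn n g" "fil (d + e) g" "s2 = cf h" "grn n h" "fil (d + e) h" by blast
  show ?case by (intro exI[of _ "g + h"]) (use gh in \<open>simp del: cf_plus\<close>)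
qed

lemma xpow_split:
  assumes "finite \<alpha>" "i \<in> \<alpha>"
  shows "xpow \<alpha> = sc (gsign {i} (\<alpha> - {i})) * xvar i * xpow (\<alpha> - {i})"
proof -
  have "xvar i * xpow (\<alpha> - {i}) = (sc (gsign {i} (\<alpha> - {i})) * xpow \<alpha> :: 'a::comm_ring_1 gr)"
    using assms xpow_mult[of "{i}" "\<alpha> - {i}", where ?'a = 'a] by (simp add: insert_absorb)
  then show ?thesis
    by (simp add: mult.assoc) (simp add: mult.assoc[symmetric] sc_simps(4)[symmetric] sc_simps(2))
qed

text \<open>Products of three elements without constant term have degree at least 3, and so do their
  sums. Conversely a monomial of degree at least 3 is, up to sign, x_i (x_j x^\<beta>) with \<beta>
  nonempty, and \<open>g\<close> is a finite sum of multiples of such monomials.\<close>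

lemma gmax_cubed_cf: "cf g \<in> gmax_cubed n \<longleftrightarrow> grn n g \<and> fil 3 g"
proof
  let ?I = "gmax n :: (nat set \<Rightarrow> 'a) set"
  let ?R = "grassmann n :: (nat set \<Rightarrow> 'a) ring"
  have I: "\<exists>h. a = cf h \<and> grn n h \<and> fil 1 h" if "a \<in> ?I" for a
  proof -
    have "a \<in> carrier ?R" using that by (simp add: gmax_def)
    then obtain h where "a = cf h" by (auto simp: carrier_grassmann)
    then show ?thesis using that by (auto simp: gmax_cf)
  qed
  assume "cf g \<in> gmax_cubed n"
  then have "cf g \<in> ideal_prod ?R ?I (ideal_prod ?R ?I ?I)" by (simp add: gmax_cubed_def)
  then have "\<exists>h. cf g = cf h \<and> grn n h \<and> fil (1 + (1 + 1)) h"
    by (rule ideal_prod_fil[OF _ I ideal_prod_fil[OF _ I I]])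
  then show "grn n g \<and> fil 3 g" by (auto simp: cf_inject numeral_3_eq_3)
next
  let ?R = "grassmann n :: (nat set \<Rightarrow> 'a) ring"
  assume g: "grn n g \<and> fil 3 g"
  \<comment> \<open>The ideal product is generated by products and binary sums, so zero is exhibited
    as a product before it can start a sum.\<close>
  have zero: "cf (0 :: 'a gr) \<in> gmax_cubed n"
  proof -
    have "cf (0 :: 'a gr) \<in> gmax n" by (simp add: gmax_cf del: cf_zero)
    then have "cf (0 :: 'a gr) \<otimes>\<^bsub>?R\<^esub> (cf 0 \<otimes>\<^bsub>?R\<^esub> cf 0) \<in> gmax_cubed n"
      unfolding gmax_cubed_def by (intro ideal_prod.prod)
    then show ?thesis by (simp del: cf_zero)
  qed
  have trm: "cf (sc (cf g \<alpha>) * xpow \<alpha>) \<in> gmax_cubed n" if \<alpha>: "\<alpha> \<subseteq> {1..n}" for \<alpha>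
  proof (cases "card \<alpha> < 3")
    case True
    then have "cf g \<alpha> = 0" using g by (simp add: fil_def)
    then show ?thesis using zero by (simp add: sc_simps)
  next
    case False
    have fin: "finite \<alpha>" using \<alpha> by (rule finite_subset) simp
    obtain i where i: "i \<in> \<alpha>" using False by fastforce
    have "card (\<alpha> - {i}) \<ge> 2" using False fin i by simp
    then have "\<alpha> - {i} \<noteq> {}" by (rule_tac notI) simp
    then obtain j where j: "j \<in> \<alpha> - {i}" by blast
    have c: "card (\<alpha> - {i} - {j}) \<ge> 1" using False fin i j by simp
    define s t :: 'a where "s = gsign {i} (\<alpha> - {i})" and "t = gsign {j} (\<alpha> - {i} - {j})"
    have x: "xpow \<alpha> = sc s * xvar i * (sc t * xvar j * xpow (\<alpha> - {i} - {j}))"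
      using xpow_split[OF fin i, where ?'a = 'a] xpow_split[of "\<alpha> - {i}" j, where ?'a = 'a] fin j
      by (simp add: s_def t_def)
    have gm: "cf (sc a * xpow \<beta>) \<in> gmax n" if "\<beta> \<subseteq> {1..n}" "card \<beta> \<ge> 1" for a \<beta>
      using that finite_subset[OF that(1)] by (simp add: gmax_cf grn_xpow fil_xpow)
    have "cf (sc (cf g \<alpha> * s) * xvar i) \<otimes>\<^bsub>?R\<^esub> (cf (sc t * xvar j) \<otimes>\<^bsub>?R\<^esub> cf (sc 1 * xpow (\<alpha> - {i} - {j}))) \<in> gmax_cubed n"
      unfolding gmax_cubed_def by (intro ideal_prod.prod gm) (use \<alpha> i j c in auto)
    then show ?thesis by (simp add: x sc_simps mult.assoc)
  qed
  have "cf (\<Sum>\<alpha>\<in>A. sc (cf g \<alpha>) * xpow \<alpha>) \<in> gmax_cubed n" if "finite A" "A \<subseteq> Pow {1..n}" for A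
    using that
  proof (induction A rule: finite_induct)
    case (insert \<alpha> A)
    then have "cf (sc (cf g \<alpha>) * xpow \<alpha>) \<oplus>\<^bsub>?R\<^esub> cf (\<Sum>\<alpha>\<in>A. sc (cf g \<alpha>) * xpow \<alpha>) \<in> gmax_cubed n"
      using trm[of \<alpha>] unfolding gmax_cubed_def by (intro ideal_prod.sum) auto
    then show ?case using insert by (simp del: cf_plus)
  qed (use zero in simp)
  from this[of "Pow {1..n}"] show "cf g \<in> gmax_cubed n"
    using grn_expand[of n g] g by simp
qed

section \<open>Elements of \<Gamma> as points\<close>

definition aut :: "nat \<Rightarrow> (nat \<Rightarrow> 'a::comm_ring_1 gr) \<Rightarrow> (nat set \<Rightarrow> 'a) \<Rightarrow> (nat set \<Rightarrow> 'a)" where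
  "aut n y = (\<lambda>a\<in>carrier (grassmann n). cf (endo n y (Gr a)))"

lemma aut_cf: "grn n g \<Longrightarrow> aut n y (cf g) = cf (endo n y g)"
  by (simp add: aut_def)

lemma grn_endo_Pts: "Pts n y \<Longrightarrow> grn n (endo n y a)"
  by (rule grn_endo) (rule PtsD(2))

lemma aut_compose:
  assumes "Pts n y" "Pts n z"
  shows "compose (carrier (grassmann n)) (aut n y) (aut n z) = aut n (gcomp n y z)"
proof
  fix a show "compose (carrier (grassmann n)) (aut n y) (aut n z) a = aut n (gcomp n y z) a"
  proof (cases "a \<in> carrier (grassmann n)")
    case True
    then obtain g where "grn n g" "a = cf g" by (auto simp: carrier_grassmann)
    then show ?thesis using grn_endo_Pts[OF assms(2)] True
      by (simp add: compose_def aut_cf endo_gcomp[OF assms(1)])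
  qed (simp add: compose_def aut_def)
qed

lemma aut_in_Gamma:
  assumes y: "Pts n y"
  shows "aut n y \<in> Gamma_group n"
proof -
  let ?R = "grassmann n :: (nat set \<Rightarrow> 'a) ring"
  note H = ghomD[OF ghom_endo_Pts[OF y]]
  note ge = grn_endo_Pts[OF y]
  obtain z where z: "Pts n z" "gcomp n z y = xvar" "gcomp n y z = xvar" using Pts_inverse[OF y] .
  have inv: "endo n z (endo n y g) = g" "endo n y (endo n z g) = g" if "grn n g" for g
    using that endo_gcomp[OF z(1), of y g] endo_gcomp[OF y, of z g] z by (simp_all add: endo_id)
  have "aut n y \<in> Ring.ring_hom ?R ?R"
    by (rule ring_hom_memI) (auto elim!: carrier_grassmannE simp: aut_cf ge H simp del: cf_plus)
  moreover have "bij_betw (aut n y) (carrier ?R) (carrier ?R)"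
    by (rule bij_betw_byWitness[where f' = "aut n z"])
       (auto elim!: carrier_grassmannE simp: aut_cf ge grn_endo_Pts[OF z(1)] inv)
  moreover have "aut n y (gscale c a) = gscale c (aut n y a)" if "a \<in> carrier ?R" for a c
    using that by (auto elim!: carrier_grassmannE simp: aut_cf H)
  moreover have "aut n y (gvar i) \<ominus>\<^bsub>?R\<^esub> gvar i \<in> godd n \<inter> gmax_cubed n" if "i \<in> {1..n}" for i
    using that PtsD[OF y] unfolding gvar_cf
    by (simp add: aut_cf grn_xpow grassmann_minus endo_xvar ge godd_cf gmax_cubed_cf del: cf_minus)
  ultimately show ?thesis by (simp add: Gamma_group_def grassmann_aut_def ring_iso_def aut_def)
qed

lemma Gamma_coords_aut:
  assumes y: "Pts n y"
  shows "Gamma_coords n (aut n y) = (\<lambda>(i, \<alpha>)\<in>Gamma_index n. cf (y i - xvar i) \<alpha>)"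
proof
  fix v show "Gamma_coords n (aut n y) v = (\<lambda>(i, \<alpha>)\<in>Gamma_index n. cf (y i - xvar i) \<alpha>) v"
  proof (cases v)
    case (Pair i \<alpha>)
    show ?thesis
    proof (cases "v \<in> Gamma_index n")
      case True
      then have i: "i \<in> {1..n}" by (simp add: Pair Gamma_index_def)
      then have "aut n y (gvar i) \<ominus>\<^bsub>grassmann n\<^esub> gvar i = cf (y i - xvar i)"
        unfolding gvar_cf using PtsD(2)[OF y i]
        by (simp add: aut_cf grn_xpow grassmann_minus endo_xvar del: cf_minus)
      then show ?thesis using True by (simp add: Gamma_coords_def Pair)
    qed (simp add: Gamma_coords_def)
  qed
qed

lemma Gamma_eq_aut:
  assumes \<sigma>: "\<sigma> \<in> Gamma_group n"
  obtains y where "Pts n y" "\<sigma> = aut n y"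
proof -
  let ?R = "grassmann n :: (nat set \<Rightarrow> 'a) ring"
  have \<sigma>R: "\<sigma> \<in> Ring.ring_hom ?R ?R" "\<sigma> \<in> extensional (carrier ?R)"
    and scale: "\<And>c a. a \<in> carrier ?R \<Longrightarrow> \<sigma> (gscale c a) = gscale c (\<sigma> a)"
    and cube: "\<And>i. i \<in> {1..n} \<Longrightarrow> \<sigma> (gvar i) \<ominus>\<^bsub>?R\<^esub> gvar i \<in> godd n \<inter> gmax_cubed n"
    using \<sigma> by (auto simp: Gamma_group_def grassmann_aut_def ring_iso_def)
  \<comment> \<open>Projecting with \<open>endo n xvar\<close> first extends \<sigma> to a
    homomorphism on the whole type, so that \<open>ghom_eq_endo\<close> applies.\<close>
  define \<tau> where "\<tau> g = Gr (\<sigma> (cf (endo n xvar g)))" for g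
  have proj: "grn n (endo n xvar g)" for g :: "'a gr" by (rule grn_endo) (simp add: grn_xpow)
  have cf\<tau>: "cf (\<tau> g) = \<sigma> (cf (endo n xvar g))" "grn n (\<tau> g)" for g
  proof -
    have "\<sigma> (cf (endo n xvar g)) \<in> carrier ?R" by (rule ring_hom_closed[OF \<sigma>R(1)]) (simp add: proj)
    then obtain h where "grn n h" "\<sigma> (cf (endo n xvar g)) = cf h" by (auto simp: carrier_grassmann)
    then show "cf (\<tau> g) = \<sigma> (cf (endo n xvar g))" "grn n (\<tau> g)" by (simp_all add: \<tau>_def)
  qed
  note H = ghomD[OF ghom_endo_Pts[OF Pts_xvar[of n]]]
  have "ghom \<tau>"
    unfolding ghom_def
  proof (intro conjI allI)
    fix a b :: "'a gr" and c :: 'a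
    have "cf (\<tau> (a + b)) = cf (\<tau> a + \<tau> b)" "cf (\<tau> (a * b)) = cf (\<tau> a * \<tau> b)"
      using ring_hom_add[OF \<sigma>R(1), of "cf (endo n xvar a)" "cf (endo n xvar b)"]
        ring_hom_mult[OF \<sigma>R(1), of "cf (endo n xvar a)" "cf (endo n xvar b)"]
      by (simp_all add: proj H cf\<tau>(1)[symmetric] del: cf_plus) (simp_all add: cf\<tau> H del: cf_plus)
    then show "\<tau> (a + b) = \<tau> a + \<tau> b" "\<tau> (a * b) = \<tau> a * \<tau> b" by (simp_all only: cf_inject)
    have one: "cf (\<tau> 1) = cf 1" using ring_hom_one[OF \<sigma>R(1)] by (simp add: cf\<tau> H)
    then show "\<tau> 1 = 1" by (simp only: cf_inject)
    have "cf (\<tau> (sc c)) = gscale c (\<sigma> (cf 1))"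
      using scale[of "cf 1" c] by (simp add: cf\<tau> H)
    also have "\<dots> = cf (sc c)" using one by (simp add: cf\<tau> H)
    finally show "\<tau> (sc c) = sc c" by (simp only: cf_inject)
  qed
  define y where "y i = (if i \<in> {1..n} then \<tau> (xvar i) else xvar i)" for i
  have \<tau>: "\<tau> g = endo n y g" if "grn n g" for g
    using ghom_eq_endo[OF \<open>ghom \<tau>\<close> that] endo_cong[of n "\<lambda>i. \<tau> (xvar i)" y g] by (simp add: y_def)
  have "Pts n y"
    unfolding Pts_def
  proof (intro conjI ballI allI impI)
    fix i assume i: "i \<in> {1..n}"
    have "\<sigma> (gvar i) = cf (y i)" using i by (simp add: gvar_cf y_def cf\<tau> endo_id grn_xpow)
    moreover show g: "grn n (y i)" using i by (simp add: y_def cf\<tau>)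
    ultimately have "odn (y i - xvar i)" "fil 3 (y i - xvar i)"
      using cube[OF i] i by (simp_all add: gvar_cf grassmann_minus grn_xpow godd_cf gmax_cubed_cf del: cf_minus)
    then show "odn (y i)" "fil 3 (y i - xvar i)" using odn_simps(2)[OF _ odn_xvar, of "y i - xvar i" i] by simp_all
  qed (simp only: y_def if_False)
  moreover have "\<sigma> = aut n y"
  proof
    fix a show "\<sigma> a = aut n y a"
    proof (cases "a \<in> carrier ?R")
      case True
      then obtain g where g: "grn n g" "a = cf g" by (auto simp: carrier_grassmann)
      then show ?thesis using \<tau>[OF g(1)] cf\<tau>(1)[of g] by (simp add: aut_cf endo_id)
    next
      case False
      then show ?thesis using \<sigma>R(2) by (simp add: aut_def extensional_def)
    qed
  qed
  ultimately show ?thesis using that by blast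
qed

text \<open>Every element of \<Gamma> is some \<open>aut n y\<close>, and \<open>pt_coords\<close>
  recovers \<open>y\<close> from its coordinates; so the coordinate map is injective on \<Gamma> and
  the inverse used in \<open>Gamma_point\<close> is meaningful.\<close>

lemma Gamma_point_eq: "Gamma_point n c = aut n (pt n c)"
  unfolding Gamma_point_def
proof (rule the_inv_into_f_eq)
  show "inj_on (Gamma_coords n) (Gamma_group n :: (_ \<Rightarrow> (nat set \<Rightarrow> 'a)) set)"
  proof (rule inj_onI)
    fix \<sigma> \<tau> :: "(nat set \<Rightarrow> 'a) \<Rightarrow> (nat set \<Rightarrow> 'a)"
    assume \<sigma>\<tau>: "\<sigma> \<in> Gamma_group n" "\<tau> \<in> Gamma_group n" "Gamma_coords n \<sigma> = Gamma_coords n \<tau>"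
    obtain y z where y: "Pts n y" "\<sigma> = aut n y" and z: "Pts n z" "\<tau> = aut n z"
      using Gamma_eq_aut[OF \<sigma>\<tau>(1)] Gamma_eq_aut[OF \<sigma>\<tau>(2)] by metis
    have "(\<lambda>(i, \<alpha>). cf (y i - xvar i) \<alpha>) v = (\<lambda>(i, \<alpha>). cf (z i - xvar i) \<alpha>) v" if "v \<in> Gamma_index n" for v
      using fun_cong[OF \<sigma>\<tau>(3), of v] that by (simp add: y z Gamma_coords_aut)
    then have "pt n (\<lambda>(i, \<alpha>). cf (y i - xvar i) \<alpha>) = pt n (\<lambda>(i, \<alpha>). cf (z i - xvar i) \<alpha>)" by (rule pt_cong)
    then show "\<sigma> = \<tau>" by (simp only: pt_coords y z)
  qed
  show "Gamma_coords n (aut n (pt n c)) = restrict c (Gamma_index n)"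
    by (rule ext) (auto simp: Gamma_coords_aut Pts_pt cf_pt)
qed (rule aut_in_Gamma[OF Pts_pt])

section \<open>Derivatives and Jacobian of the definitions\<close>

text \<open>Uniqueness: the Leibniz rule fixes a skew derivation on monomials, by splitting off the
  smallest variable, and linearity does the rest.\<close>

lemma skew_deriv_eq:
  assumes j: "j \<in> {1..n}"
  shows "(skew_deriv n j :: (nat set \<Rightarrow> 'a::comm_ring_1) \<Rightarrow> _) = (\<lambda>a\<in>carrier (grassmann n). cf (dd j (Gr a)))"
  unfolding skew_deriv_def
proof (rule the_equality)
  let ?R = "grassmann n :: (nat set \<Rightarrow> 'a) ring"
  let ?D = "\<lambda>a\<in>carrier ?R. cf (dd j (Gr a))"
  have homog: "\<exists>g. grn n g \<and> a = cf g \<and> pari g = sc ((- 1) ^ i) * g" if "a \<in> ghomogeneous n i" for a :: "nat set \<Rightarrow> 'a" and i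
  proof -
    have "a \<in> carrier ?R" using that by (simp add: ghomogeneous_def)
    then obtain g where g: "grn n g" "a = cf g" by (rule carrier_grassmannE)
    have "pari g = sc ((- 1) ^ i) * g"
    proof (rule gr_eqI)
      fix \<alpha> show "cf (pari g) \<alpha> = cf (sc ((- 1) ^ i) * g) \<alpha>"
        using that g(2) by (cases "cf g \<alpha> = 0") (auto simp: cf_pari ghomogeneous_def)
    qed
    with g show ?thesis by blast
  qed
  show "is_left_skew_derivation n j ?D"
    unfolding is_left_skew_derivation_def
  proof (intro conjI ballI allI)
    fix i and a b :: "nat set \<Rightarrow> 'a" assume ab: "a \<in> ghomogeneous n i" "b \<in> carrier ?R"
    obtain g where g: "grn n g" "a = cf g" "pari g = sc ((- 1) ^ i) * g" using homog[OF ab(1)] by blast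
    obtain h where h: "grn n h" "b = cf h" using ab(2) by (auto simp: carrier_grassmann)
    show "?D (a \<otimes>\<^bsub>?R\<^esub> b) = ?D a \<otimes>\<^bsub>?R\<^esub> b \<oplus>\<^bsub>?R\<^esub> gscale ((- 1) ^ i) (a \<otimes>\<^bsub>?R\<^esub> ?D b)"
      using g h by (simp add: dd_mult mult.assoc del: cf_plus)
  qed (auto elim!: carrier_grassmannE simp: grn_dd dd_simps gvar_cf grn_xpow dd_xvar cf_inject simp del: cf_plus cf_zero)
  fix D :: "(nat set \<Rightarrow> 'a) \<Rightarrow> (nat set \<Rightarrow> 'a)" assume D: "is_left_skew_derivation n j D"
  have Dc: "D \<in> carrier ?R \<rightarrow>\<^sub>E carrier ?R"
    and Dadd: "\<And>a b. a \<in> carrier ?R \<Longrightarrow> b \<in> carrier ?R \<Longrightarrow> D (a \<oplus>\<^bsub>?R\<^esub> b) = D a \<oplus>\<^bsub>?R\<^esub> D b"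
    and Dsc: "\<And>c a. a \<in> carrier ?R \<Longrightarrow> D (gscale c a) = gscale c (D a)"
    and Dvar: "\<And>k. k \<in> {1..n} \<Longrightarrow> D (gvar k) = (if k = j then \<one>\<^bsub>?R\<^esub> else \<zero>\<^bsub>?R\<^esub>)"
    and Dmult: "\<And>i a b. a \<in> ghomogeneous n i \<Longrightarrow> b \<in> carrier ?R \<Longrightarrow>
        D (a \<otimes>\<^bsub>?R\<^esub> b) = D a \<otimes>\<^bsub>?R\<^esub> b \<oplus>\<^bsub>?R\<^esub> gscale ((- 1) ^ i) (a \<otimes>\<^bsub>?R\<^esub> D b)"
    using D unfolding is_left_skew_derivation_def by blast+
  define \<delta> where "\<delta> g = Gr (D (cf g))" for g
  have cf\<delta>: "D (cf g) = cf (\<delta> g)" "grn n (\<delta> g)" if g: "grn n g" for g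
  proof -
    have "cf g \<in> carrier ?R" using g by simp
    then have "D (cf g) \<in> carrier ?R" by (rule PiE_mem[OF Dc])
    then obtain h where "grn n h" "D (cf g) = cf h" by (rule carrier_grassmannE)
    then show "D (cf g) = cf (\<delta> g)" "grn n (\<delta> g)" by (simp_all add: \<delta>_def)
  qed
  have add: "\<delta> (g + h) = \<delta> g + \<delta> h" if "grn n g" "grn n h" for g h
    using Dadd[of "cf g" "cf h"] that by (simp add: cf\<delta> cf_inject del: cf_plus)
  have scale: "\<delta> (sc c * g) = sc c * \<delta> g" if "grn n g" for g c
    using Dsc[of "cf g" c] that by (simp add: cf\<delta> cf_inject)
  have var: "\<delta> (xvar k) = (if k = j then 1 else 0)" if "k \<in> {1..n}" for k
    using Dvar[OF that] that by (auto simp: gvar_cf cf\<delta> cf_inject grn_xpow simp del: cf_zero split: if_splits)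
  have leib: "\<delta> (xpow \<alpha> * h) = \<delta> (xpow \<alpha>) * h + sc ((- 1) ^ card \<alpha>) * (xpow \<alpha> * \<delta> h)"
    if "\<alpha> \<subseteq> {1..n}" "grn n h" for \<alpha> h
  proof -
    have "cf (xpow \<alpha>) \<in> ghomogeneous n (card \<alpha>)"
      using that(1) finite_subset[OF that(1)] by (auto simp: ghomogeneous_def grn_xpow cf_xpow)
    from Dmult[OF this, of "cf h"] show ?thesis
      using that by (simp add: cf\<delta> cf_inject grn_xpow del: cf_plus)
  qed
  \<comment> \<open>The Leibniz rule for 1 = 1 \<cdot> 1 reads \<delta> 1 = \<delta> 1 + \<delta>
    1.\<close>
  have one: "\<delta> 1 = 0" using leib[of "{}" 1] by (simp add: xpow_empty sc_simps)
  have mono: "\<delta> (xpow \<alpha>) = dd j (xpow \<alpha>)" if "\<alpha> \<subseteq> {1..n}" for \<alpha>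
  proof -
    have "finite \<alpha>" using that by (rule finite_subset) simp
    from this that show ?thesis
    proof (induction \<alpha> rule: finite_linorder_min_induct)
      case empty
      then show ?case by (simp add: xpow_empty one dd_simps)
    next
      case (insert m \<alpha>)
      have m: "m \<notin> \<alpha>" "m \<in> {1..n}" "\<alpha> \<subseteq> {1..n}" using insert by auto
      have xp: "xpow (insert m \<alpha>) = (xvar m * xpow \<alpha> :: 'a gr)"
        using insert by (intro xpow_insert_min)
      show ?case
        unfolding xp dd_mult_odn[OF odn_xvar]
        using leib[of "{m}" "xpow \<alpha>"] m insert.IH by (simp add: grn_xpow var dd_xvar sc_simps)
    qed
  qed
  have sum: "\<delta> (\<Sum>\<alpha>\<in>A. sc (f \<alpha>) * xpow \<alpha>) = (\<Sum>\<alpha>\<in>A. sc (f \<alpha>) * dd j (xpow \<alpha>))"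
    if "finite A" "A \<subseteq> Pow {1..n}" for A f
    using that
  proof (induction A rule: finite_induct)
    case empty
    then show ?case using scale[of 1 0] by (simp add: sc_simps)
  next
    case (insert \<alpha> A)
    then have "grn n (\<Sum>\<alpha>\<in>A. sc (f \<alpha>) * xpow \<alpha>)" by (intro grn_sum) (auto simp: grn_xpow)
    then show ?case using insert by (simp add: add grn_xpow scale mono)
  qed
  have "\<delta> g = dd j g" if "grn n g" for g
  proof -
    have "\<delta> g = (\<Sum>\<alpha>\<in>Pow {1..n}. sc (cf g \<alpha>) * dd j (xpow \<alpha>))"
      using sum[of "Pow {1..n}" "cf g"] grn_expand[OF that] by simp
    also have "\<dots> = dd j (\<Sum>\<alpha>\<in>Pow {1..n}. sc (cf g \<alpha>) * xpow \<alpha>)" by (simp add: dd_sum dd_simps)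
    finally show ?thesis using grn_expand[OF that] by simp
  qed
  then show "D = ?D" using Dc by (intro extensionalityI[of _ "carrier ?R"])
      (auto simp: PiE_def carrier_grassmann cf\<delta>)
qed

lemma cf_of_int_mult: "cf (of_int k * g) \<alpha> = of_int k * cf g \<alpha>"
proof -
  have "cf (of_nat k * g) \<alpha> = of_nat k * cf g \<alpha>" for k by (induction k) (auto simp: algebra_simps)
  then show ?thesis by (cases k rule: int_cases2) simp_all
qed

text \<open>The entries are even, so the row-ordered products of \<open>gdet\<close> are products in
  the commutative ring \<open>gev\<close>.\<close>

lemma Jacobian_aut:
  assumes y: "Pts n y"
  shows "Jacobian n (aut n y) = cf (jac n y)"
proof
  fix \<alpha>
  let ?R = "grassmann n :: (nat set \<Rightarrow> 'a) ring"
  have entry: "skew_deriv n j (aut n y (gvar i)) = cf (dd j (y i))" if "i \<in> {1..n}" "j \<in> {1..n}" for i j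
    using that PtsD(2)[OF y that(1)] unfolding gvar_cf skew_deriv_eq[OF that(2)]
    by (simp add: aut_cf grn_xpow endo_xvar)
  have fold: "foldr (\<lambda>i b. skew_deriv n (p i) (aut n y (gvar i)) \<otimes>\<^bsub>?R\<^esub> b) xs \<one>\<^bsub>?R\<^esub> =
      cf (of_ev (\<Prod>i\<in>set xs. Ev (dd (p i) (y i))))"
    if "distinct xs" "set xs \<subseteq> {1..n}" "\<And>i. i \<in> {1..n} \<Longrightarrow> p i \<in> {1..n}" for p xs
    using that
  proof (induction xs)
    case (Cons i xs)
    then have "i \<in> {1..n}" by simp
    then have "skew_deriv n (p i) (aut n y (gvar i)) = cf (dd (p i) (y i))"
      using Cons.prems(3) by (intro entry)
    then show ?case using Cons by (simp add: evn_dd PtsD(1)[OF y])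
  qed simp
  have set: "set [1..<Suc n] = {1..n}" by auto
  have "Jacobian n (aut n y) \<alpha> = (\<Sum>p | p permutes {1..n}. of_int (sign p) * cf (of_ev (\<Prod>i\<in>{1..n}. Ev (dd (p i) (y i)))) \<alpha>)"
    unfolding Jacobian_def gdet_def
  proof (intro sum.cong refl arg_cong2[of _ _ _ _ "(*)"])
    fix p assume "p \<in> {p. p permutes {1..n}}"
    then have "p i \<in> {1..n}" if "i \<in> {1..n}" for i using that by (simp only: permutes_in_image mem_Collect_eq)
    then show "foldr (\<lambda>i b. skew_deriv n (p i) (aut n y (gvar i)) \<otimes>\<^bsub>?R\<^esub> b) [1..<Suc n] \<one>\<^bsub>?R\<^esub> \<alpha> =
        cf (of_ev (\<Prod>i\<in>{1..n}. Ev (dd (p i) (y i)))) \<alpha>"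
      using fold[of "[1..<Suc n]" p] unfolding set by auto
  qed
  also have "\<dots> = cf (jac n y) \<alpha>"
    by (simp add: jac_def pdet_def of_ev_sum cf_sum cf_of_int_mult)
  finally show "Jacobian n (aut n y) \<alpha> = cf (jac n y) \<alpha>" .
qed

section \<open>The universal point\<close>

abbreviation univ :: "nat \<Rightarrow> nat \<Rightarrow> (nat \<times> nat set, 'k::comm_ring_1) mpoly gr" where
  "univ n \<equiv> pt n mvar"

lemma eqs_Jacobian_group:
  "eqs (Jacobian_group n :: (_, 'k::comm_ring_1) mult_scheme) = {cf (jac n (univ n) - 1) \<alpha> | \<alpha>. \<alpha> \<subseteq> {1..n}}"
proof -
  have "grn n (jac n (univ n :: nat \<Rightarrow> (_, 'k) mpoly gr))" using PtsD[OF Pts_pt] by (intro grn_jac)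
  then show ?thesis
    by (simp add: Jacobian_group_def Gamma_point_eq Jacobian_aut Pts_pt grassmann_minus del: cf_minus)
qed

text \<open>The multiplication is given by coordinates on \<open>Gamma_index n\<close> only.
  Wrapping it in \<open>pt\<close> ignores its values elsewhere and turns it into a composite of
  points.\<close>

lemma pt_mul_Jacobian_group:
  "pt n (mul (Jacobian_group n :: (_, 'k::comm_ring_1) mult_scheme)) =
     gcomp n (pt n (\<lambda>v. mvar (Inl v))) (pt n (\<lambda>v. mvar (Inr v)))"
proof -
  let ?g = "gcomp n (pt n (\<lambda>v. mvar (Inl v))) (pt n (\<lambda>v. mvar (Inr v))) :: nat \<Rightarrow> (_, 'k) mpoly gr"
  have g: "Pts n ?g" by (intro Pts_gcomp Pts_pt)
  have "pt n (mul (Jacobian_group n)) = pt n (\<lambda>(i, \<alpha>). cf (?g i - xvar i) \<alpha>)"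
    by (rule pt_cong) (auto simp: Jacobian_group_def Gamma_point_eq aut_compose Pts_pt Gamma_coords_aut g simp del: cf_minus)
  then show ?thesis by (simp only: pt_coords[OF g])
qed

section \<open>Polynomial rings\<close>

definition mev :: "('v \<Rightarrow> 'r) \<Rightarrow> ('v \<Rightarrow>\<^sub>0 nat) \<Rightarrow> 'r::comm_ring_1" where
  "mev g m = (\<Prod>v\<in>Poly_Mapping.keys m. g v ^ Poly_Mapping.lookup m v)"

lemma mev_superset:
  assumes "finite S" "Poly_Mapping.keys m \<subseteq> S"
  shows "mev g m = (\<Prod>v\<in>S. g v ^ Poly_Mapping.lookup m v)"
  unfolding mev_def by (rule prod.mono_neutral_left) (use assms in \<open>auto simp: in_keys_iff\<close>)

lemma mev_zero [simp]: "mev g 0 = 1"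
  by (simp add: mev_def)

lemma mev_add: "mev g (m + m') = mev g m * mev g m'"
proof -
  let ?S = "Poly_Mapping.keys m \<union> Poly_Mapping.keys m'"
  have "Poly_Mapping.keys (m + m') \<subseteq> ?S" by (rule keys_add)
  then show ?thesis
    using mev_superset[of ?S "m + m'" g] mev_superset[of ?S m g] mev_superset[of ?S m' g]
    by (simp add: lookup_add power_add prod.distrib)
qed

lemma meval_superset:
  assumes "rhom f" "finite S" "Poly_Mapping.keys p \<subseteq> S"
  shows "meval f g p = (\<Sum>m\<in>S. f (Poly_Mapping.lookup p m) * mev g m)"
  unfolding meval_def mev_def[symmetric]
  by (rule sum.mono_neutral_left) (use assms in \<open>auto simp: in_keys_iff rhomD[OF assms(1)]\<close>)

lemma meval_add:
  assumes "rhom f"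
  shows "meval f g (p + q) = meval f g p + meval f g q"
proof -
  let ?S = "Poly_Mapping.keys p \<union> Poly_Mapping.keys q"
  have "Poly_Mapping.keys (p + q) \<subseteq> ?S" by (rule keys_add)
  then show ?thesis
    using meval_superset[OF assms, of ?S "p + q" g] meval_superset[OF assms, of ?S p g]
      meval_superset[OF assms, of ?S q g]
    by (simp add: lookup_add rhomD[OF assms] sum.distrib distrib_right)
qed

lemma meval_zero: "meval f g 0 = 0"
  by (simp add: meval_def)

lemma meval_sum: "rhom f \<Longrightarrow> meval f g (sum h A) = (\<Sum>x\<in>A. meval f g (h x))"
  by (induction A rule: infinite_finite_induct) (auto simp: meval_add meval_zero)

lemma meval_single:
  assumes "rhom f"
  shows "meval f g (Poly_Mapping.single m c) = f c * mev g m"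
  using meval_superset[OF assms, of "{m}" "Poly_Mapping.single m c" g]
  by (simp split: if_splits)

lemma poly_mapping_expand: "(\<Sum>m\<in>Poly_Mapping.keys p. Poly_Mapping.single m (Poly_Mapping.lookup p m)) = p"
proof (rule poly_mapping_eqI)
  fix k
  have "Poly_Mapping.lookup (\<Sum>m\<in>Poly_Mapping.keys p. Poly_Mapping.single m (Poly_Mapping.lookup p m)) k =
      (\<Sum>m\<in>Poly_Mapping.keys p. if m = k then Poly_Mapping.lookup p m else 0)"
    by (simp add: lookup_sum lookup_single when_def)
  also have "\<dots> = Poly_Mapping.lookup p k" by (simp add: sum.delta in_keys_iff)
  finally show "Poly_Mapping.lookup (\<Sum>m\<in>Poly_Mapping.keys p. Poly_Mapping.single m (Poly_Mapping.lookup p m)) k =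
      Poly_Mapping.lookup p k" .
qed

lemma meval_mult:
  assumes "rhom f"
  shows "meval f g (p * q) = meval f g p * meval f g q"
proof -
  let ?s = "\<lambda>p m. Poly_Mapping.single m (Poly_Mapping.lookup p m)"
  have "p * q = (\<Sum>m\<in>Poly_Mapping.keys p. ?s p m) * (\<Sum>m\<in>Poly_Mapping.keys q. ?s q m)"
    by (simp only: poly_mapping_expand)
  also have "\<dots> = (\<Sum>m\<in>Poly_Mapping.keys p. \<Sum>k\<in>Poly_Mapping.keys q. ?s p m * ?s q k)"
    by (rule sum_product)
  finally have "meval f g (p * q) =
      (\<Sum>m\<in>Poly_Mapping.keys p. \<Sum>k\<in>Poly_Mapping.keys q. meval f g (?s p m) * meval f g (?s q k))"
    by (simp add: meval_sum[OF assms] mult_single meval_single[OF assms] mev_add rhomD[OF assms] mult_ac)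
  also have "\<dots> = meval f g (\<Sum>m\<in>Poly_Mapping.keys p. ?s p m) * meval f g (\<Sum>m\<in>Poly_Mapping.keys q. ?s q m)"
    by (simp only: sum_product meval_sum[OF assms])
  finally show ?thesis by (simp only: poly_mapping_expand)
qed

lemma meval_mconst [simp]: "rhom f \<Longrightarrow> meval f g (mconst c) = f c"
  by (simp add: mconst_def meval_single)

lemma meval_mvar [simp]: assumes "rhom f" shows "meval f g (mvar v) = g v"
  using assms by (simp add: mvar_def meval_single mev_def rhomD[OF assms])

lemma rhom_meval: assumes "rhom f" shows "rhom (meval f g)"
proof -
  have "meval f g 1 = 1" using meval_mconst[OF assms, of g 1] by (simp add: mconst_def rhomD[OF assms])
  then show ?thesis by (simp add: rhom_def[of "meval f g"] meval_add[OF assms] meval_mult[OF assms])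
qed

lemma rhom_mconst: "rhom mconst"
  by (simp add: rhom_def mconst_def single_add mult_single)

lemma rhom_id: "rhom (\<lambda>c. c)"
  by (simp add: rhom_def)

lemma rhom_msubst: "rhom (msubst g)"
  unfolding msubst_def by (rule rhom_meval[OF rhom_mconst])

lemma msubst_mvar [simp]: "msubst g (mvar v) = g v"
  by (simp add: msubst_def rhom_mconst)

lemma msubst_mconst [simp]: "msubst g (mconst c) = mconst c"
  by (simp add: msubst_def rhom_mconst)

lemma rhom_mrename: "rhom (mrename r)"
  unfolding mrename_def by (rule rhom_msubst)

lemma mrename_mvar [simp]: "mrename r (mvar v) = mvar (r v)"
  by (simp add: mrename_def)

lemma mvar_power: "mvar v ^ k = Poly_Mapping.single (Poly_Mapping.single v k) 1"
proof (induction k)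
  case (Suc k)
  show ?case unfolding power_Suc Suc.IH by (simp add: mvar_def mult_single single_add[symmetric])
qed simp

lemma mev_mvar: "mev mvar m = Poly_Mapping.single m 1"
proof -
  have "(\<Prod>v\<in>S. Poly_Mapping.single (h v) 1) = Poly_Mapping.single (\<Sum>v\<in>S. h v) (1::'b)"
    for S and h :: "'a \<Rightarrow> 'a \<Rightarrow>\<^sub>0 nat"
    by (induction S rule: infinite_finite_induct) (auto simp: mult_single)
  then show ?thesis by (simp add: mev_def mvar_power poly_mapping_expand)
qed

section \<open>Polynomials in a given set of variables\<close>

definition mpc :: "'v set \<Rightarrow> ('v, 'k::comm_ring_1) mpoly set" where
  "mpc V = carrier (mpoly_ring V)"

lemma mpoly_ring_simps [simp]:
  "carrier (mpoly_ring V) = mpc V" "monoid.mult (mpoly_ring V) = (*)" "one (mpoly_ring V) = 1"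
  "zero (mpoly_ring V) = 0" "add (mpoly_ring V) = (+)"
  by (simp_all add: mpoly_ring_def mpc_def)

lemma mpc_iff: "p \<in> mpc V \<longleftrightarrow> (\<forall>m\<in>Poly_Mapping.keys p. Poly_Mapping.keys m \<subseteq> V)"
  by (simp add: mpc_def mpoly_ring_def)

lemma mpc_mconst [simp]: "mconst c \<in> mpc V"
  by (simp add: mpc_iff mconst_def)

lemma mpc_mvar [simp]: "v \<in> V \<Longrightarrow> mvar v \<in> mpc V"
  by (simp add: mpc_iff mvar_def)

lemma mpc_add [simp]: "p \<in> mpc V \<Longrightarrow> q \<in> mpc V \<Longrightarrow> p + q \<in> mpc V"
  unfolding mpc_iff using keys_add[of p q] by blast

lemma mpc_mult [simp]:
  assumes "p \<in> mpc V" "q \<in> mpc V"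
  shows "p * q \<in> mpc V"
  unfolding mpc_iff
proof
  fix m assume "m \<in> Poly_Mapping.keys (p * q)"
  then obtain a b where ab: "m = a + b" "a \<in> Poly_Mapping.keys p" "b \<in> Poly_Mapping.keys q"
    using keys_mult[of p q] by blast
  have "Poly_Mapping.keys m \<subseteq> Poly_Mapping.keys a \<union> Poly_Mapping.keys b"
    unfolding ab(1) by (rule keys_add)
  then show "Poly_Mapping.keys m \<subseteq> V" using ab assms by (fastforce simp: mpc_iff)
qed

lemma mpc_0 [simp]: "0 \<in> mpc V" and mpc_1 [simp]: "1 \<in> mpc V"
  by (simp_all add: mpc_iff)

lemma mpc_uminus [simp]: "p \<in> mpc V \<Longrightarrow> - p \<in> mpc V"
  by (simp add: mpc_iff in_keys_iff)

lemma mpc_diff [simp]: "p \<in> mpc V \<Longrightarrow> q \<in> mpc V \<Longrightarrow> p - q \<in> mpc V"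
  using mpc_add[of p V "- q"] by simp

lemma mpc_gsign [simp]: "gsign \<alpha> \<beta> \<in> mpc V"
  by (simp add: gsign_def minus_one_power_iff)

lemma mpc_mono: "U \<subseteq> V \<Longrightarrow> p \<in> mpc U \<Longrightarrow> p \<in> mpc V"
  by (auto simp: mpc_iff)

text \<open>A polynomial is the sum of its coefficients times the monomials
  \<open>mev mvar m\<close>, and these are products of powers of variables from
  \<open>V\<close>.\<close>

lemma mpc_induct [consumes 1, case_names const var add mult]:
  assumes p: "p \<in> mpc V"
    and const: "\<And>c. P (mconst c)" and var: "\<And>v. v \<in> V \<Longrightarrow> P (mvar v)"
    and add: "\<And>p q. p \<in> mpc V \<Longrightarrow> q \<in> mpc V \<Longrightarrow> P p \<Longrightarrow> P q \<Longrightarrow> P (p + q)"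
    and mult: "\<And>p q. p \<in> mpc V \<Longrightarrow> q \<in> mpc V \<Longrightarrow> P p \<Longrightarrow> P q \<Longrightarrow> P (p * q)"
  shows "P p"
proof -
  have P0: "P 0" and P1: "P 1" using const[of 0] const[of 1] by (simp_all add: mconst_def)
  have power: "P (q ^ k) \<and> q ^ k \<in> mpc V" if "P q" "q \<in> mpc V" for q k
    using that by (induction k) (auto simp: P1 mult)
  have prod: "P (prod f S) \<and> prod f S \<in> mpc V" if "\<And>x. x \<in> S \<Longrightarrow> P (f x) \<and> f x \<in> mpc V" for S :: "'a set" and f
    using that by (induction S rule: infinite_finite_induct) (auto simp: P1 mult)
  have sum: "P (sum f S) \<and> sum f S \<in> mpc V" if "\<And>x. x \<in> S \<Longrightarrow> P (f x) \<and> f x \<in> mpc V"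
    for S :: "('a \<Rightarrow>\<^sub>0 nat) set" and f
    using that by (induction S rule: infinite_finite_induct) (auto simp: P0 add)
  have single: "Poly_Mapping.single m c = mconst c * mev mvar m" for m and c :: 'b
    by (simp add: mev_mvar mconst_def mult_single)
  have "P (\<Sum>m\<in>Poly_Mapping.keys p. mconst (Poly_Mapping.lookup p m) * mev mvar m)"
  proof (rule conjunct1[OF sum])
    fix m assume m: "m \<in> Poly_Mapping.keys p"
    have "P (mev mvar m) \<and> (mev mvar m :: ('a, 'b) mpoly) \<in> mpc V"
      unfolding mev_def by (intro prod power var mpc_mvar) (use p m in \<open>auto simp: mpc_iff[of p]\<close>)
    then show "P (mconst (Poly_Mapping.lookup p m) * mev mvar m) \<and>
        mconst (Poly_Mapping.lookup p m) * mev mvar m \<in> mpc V"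
      using mult const by simp
  qed
  then show ?thesis by (simp only: single[symmetric] poly_mapping_expand)
qed

lemma mpc_UNIV [simp]: "p \<in> mpc UNIV"
  by (simp add: mpc_iff)

lemma rhom_eqI:
  assumes "rhom \<phi>" "rhom \<psi>" "p \<in> mpc V" "\<And>c. \<phi> (mconst c) = \<psi> (mconst c)"
    "\<And>v. v \<in> V \<Longrightarrow> \<phi> (mvar v) = \<psi> (mvar v)"
  shows "\<phi> p = \<psi> p"
  using assms(3) by (induction rule: mpc_induct) (simp_all add: assms rhomD[OF assms(1)] rhomD[OF assms(2)])

lemma msubst_cong: "p \<in> mpc V \<Longrightarrow> (\<And>v. v \<in> V \<Longrightarrow> g v = h v) \<Longrightarrow> msubst g p = msubst h p"
  by (rule rhom_eqI[OF rhom_msubst rhom_msubst]) auto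

lemma msubst_id: "p \<in> mpc V \<Longrightarrow> (\<And>v. v \<in> V \<Longrightarrow> g v = mvar v) \<Longrightarrow> msubst g p = p"
  by (rule rhom_eqI[OF rhom_msubst rhom_id]) auto

lemma rhom_comp: "rhom \<phi> \<Longrightarrow> rhom \<psi> \<Longrightarrow> rhom (\<lambda>a. \<phi> (\<psi> a))"
  by (simp add: rhom_def)

lemma msubst_msubst: "msubst g (msubst h p) = msubst (\<lambda>v. msubst g (h v)) p"
  by (rule rhom_eqI[OF rhom_comp[OF rhom_msubst rhom_msubst] rhom_msubst, of p UNIV]) auto

lemma msubst_mpc: "p \<in> mpc V \<Longrightarrow> (\<And>v. v \<in> V \<Longrightarrow> g v \<in> mpc W) \<Longrightarrow> msubst g p \<in> mpc W"
  by (induction rule: mpc_induct) (auto simp: rhomD[OF rhom_msubst])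

text \<open>Retraction that sets all variables outside \<open>V\<close> to zero. Lying in
  \<open>mpc V\<close> means being fixed by it; as it is a ring homomorphism, every construction
  compatible with base change preserves this property.\<close>

definition mkill :: "'v set \<Rightarrow> ('v, 'k::comm_ring_1) mpoly \<Rightarrow> ('v, 'k) mpoly" where
  "mkill V = msubst (\<lambda>v. if v \<in> V then mvar v else 0)"

lemma rhom_mkill: "rhom (mkill V)"
  unfolding mkill_def by (rule rhom_msubst)

lemma mkill_mvar [simp]: "mkill V (mvar v) = (if v \<in> V then mvar v else 0)"
  by (simp add: mkill_def)

lemma mpc_iff_mkill: "p \<in> mpc V \<longleftrightarrow> mkill V p = p"
proof
  show "mkill V p = p \<Longrightarrow> p \<in> mpc V"
    using msubst_mpc[of p UNIV "\<lambda>v. if v \<in> V then mvar v else 0" V] by (simp add: mkill_def)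
qed (auto simp: mkill_def intro: msubst_id)

lemma cring_mpoly_ring: "cring (mpoly_ring V)"
proof (rule cringI)
  show "abelian_group (mpoly_ring V)"
  proof (rule abelian_groupI)
    fix p assume "p \<in> carrier (mpoly_ring V)"
    then show "\<exists>q\<in>carrier (mpoly_ring V). q \<oplus>\<^bsub>mpoly_ring V\<^esub> p = \<zero>\<^bsub>mpoly_ring V\<^esub>"
      by (intro bexI[of _ "- p"]) simp_all
  qed (simp_all add: add_ac)
  show "comm_monoid (mpoly_ring V)" by (rule comm_monoidI) (simp_all add: mult_ac)
qed (simp_all add: distrib_right)

section \<open>Ideals and congruences\<close>

text \<open>Ideals of \<open>mpoly_ring V\<close> in terms of the type class operations; the
  multipliers range over \<open>mpc V\<close>, not over all polynomials of the type.\<close>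

definition is_ideal :: "'v set \<Rightarrow> ('v, 'k::comm_ring_1) mpoly set \<Rightarrow> bool" where
  "is_ideal V I \<longleftrightarrow> I \<subseteq> mpc V \<and> 0 \<in> I \<and> (\<forall>a\<in>I. \<forall>b\<in>I. a + b \<in> I) \<and> (\<forall>a\<in>I. \<forall>r\<in>mpc V. r * a \<in> I)"

lemma is_idealD:
  assumes "is_ideal V I"
  shows "a \<in> I \<Longrightarrow> a \<in> mpc V" "0 \<in> I" "a \<in> I \<Longrightarrow> b \<in> I \<Longrightarrow> a + b \<in> I"
    "a \<in> I \<Longrightarrow> r \<in> mpc V \<Longrightarrow> r * a \<in> I" "a \<in> I \<Longrightarrow> r \<in> mpc V \<Longrightarrow> a * r \<in> I" "a \<in> I \<Longrightarrow> - a \<in> I"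
    "a \<in> I \<Longrightarrow> b \<in> I \<Longrightarrow> a - b \<in> I"
proof -
  show *: "a \<in> I \<Longrightarrow> a \<in> mpc V" "0 \<in> I" "\<And>a b. a \<in> I \<Longrightarrow> b \<in> I \<Longrightarrow> a + b \<in> I"
    "\<And>a r. a \<in> I \<Longrightarrow> r \<in> mpc V \<Longrightarrow> r * a \<in> I" using assms by (auto simp: is_ideal_def)
  then show "a \<in> I \<Longrightarrow> r \<in> mpc V \<Longrightarrow> a * r \<in> I" by (simp add: mult.commute)
  show neg: "\<And>a. a \<in> I \<Longrightarrow> - a \<in> I" using *(4)[of _ "- 1"] by simp
  show "a \<in> I \<Longrightarrow> b \<in> I \<Longrightarrow> a - b \<in> I" using *(3)[of a "- b"] neg[of b] by simp
qed

lemma is_ideal_sum: "is_ideal V I \<Longrightarrow> (\<And>x. x \<in> A \<Longrightarrow> f x \<in> I) \<Longrightarrow> sum f A \<in> I"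
  by (induction A rule: infinite_finite_induct) (auto simp: is_idealD)

lemma ideal_genideal:
  assumes "S \<subseteq> mpc V"
  shows "ideal (Idl\<^bsub>mpoly_ring V\<^esub> S) (mpoly_ring V)"
proof -
  interpret cring "mpoly_ring V" by (rule cring_mpoly_ring)
  show ?thesis by (rule genideal_ideal) (use assms in simp)
qed

lemma is_ideal_genideal:
  assumes "S \<subseteq> mpc V"
  shows "is_ideal V (Idl\<^bsub>mpoly_ring V\<^esub> S)"
proof -
  let ?I = "Idl\<^bsub>mpoly_ring V\<^esub> S"
  have id: "ideal ?I (mpoly_ring V)" by (rule ideal_genideal[OF assms])
  then have add: "additive_subgroup ?I (mpoly_ring V)" by (rule ideal.axioms(1))
  show ?thesis
    unfolding is_ideal_def
  proof (intro conjI ballI)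
    show "?I \<subseteq> mpc V" using additive_subgroup.a_subset[OF add] by (simp only: mpoly_ring_simps)
    show "0 \<in> ?I" using additive_subgroup.zero_closed[OF add] by (simp only: mpoly_ring_simps)
    fix a assume a: "a \<in> ?I"
    show "a + b \<in> ?I" if "b \<in> ?I" for b
      using additive_subgroup.a_closed[OF add a that] by (simp only: mpoly_ring_simps)
    show "r * a \<in> ?I" if "r \<in> mpc V" for r
      using ideal.I_l_closed[OF id a, of r] that by (simp only: mpoly_ring_simps)
  qed
qed

lemma genideal_mem:
  assumes "S \<subseteq> mpc V" "a \<in> S"
  shows "a \<in> Idl\<^bsub>mpoly_ring V\<^esub> S"
proof -
  interpret cring "mpoly_ring V" by (rule cring_mpoly_ring)
  show ?thesis using genideal_self[of S] assms by auto
qed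

lemma genideal_kernel:
  assumes "rhom \<phi>" "S \<subseteq> mpc V" "\<And>a. a \<in> S \<Longrightarrow> \<phi> a = 0" "a \<in> Idl\<^bsub>mpoly_ring V\<^esub> S"
  shows "\<phi> a = 0"
proof -
  interpret cring "mpoly_ring V" by (rule cring_mpoly_ring)
  have inv: "\<ominus>\<^bsub>mpoly_ring V\<^esub> p = - p" if "p \<in> mpc V" for p :: "('a, 'b) mpoly"
    by (rule minus_equality) (use that in simp_all)
  have "ideal {p \<in> mpc V. \<phi> p = 0} (mpoly_ring V)"
  proof (rule idealI)
    show "subgroup {p \<in> mpc V. \<phi> p = 0} (add_monoid (mpoly_ring V))"
      by (rule subgroup.intro) (use inv in \<open>auto simp: rhomD[OF assms(1)] a_inv_def\<close>)
  qed (auto simp: rhomD[OF assms(1)] ring_axioms)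
  from genideal_minimal[OF this, of S] show ?thesis using assms(2-4) by auto
qed

text \<open>Congruent arguments give congruent values; for products use p q - p' q' = (p - p') q +
  p' (q - q').\<close>

lemma msubst_congruent:
  assumes I: "is_ideal V I" and "p \<in> mpc U" "U \<subseteq> V" "\<And>v. v \<in> U \<Longrightarrow> g v \<in> mpc V" "\<And>v. v \<in> U \<Longrightarrow> mvar v - g v \<in> I"
  shows "p - msubst g p \<in> I"
  using assms(2)
proof (induction rule: mpc_induct)
  case (add p q)
  then have "(p - msubst g p) + (q - msubst g q) \<in> I" by (intro is_idealD(3)[OF I])
  then show ?case by (simp add: rhomD[OF rhom_msubst] algebra_simps)
next
  case (mult p q)
  have "q \<in> mpc V" "msubst g p \<in> mpc V"
    using mult mpc_mono[OF assms(3)] msubst_mpc[of p U g V] assms(4) by auto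
  then have "(p - msubst g p) * q + msubst g p * (q - msubst g q) \<in> I"
    using mult by (intro is_idealD(3)[OF I] is_idealD(4)[OF I] is_idealD(5)[OF I])
  then show ?case by (simp add: rhomD[OF rhom_msubst] algebra_simps)
qed (use assms is_idealD(2)[OF I] in simp_all)

section \<open>Coefficients in an ideal or a subring\<close>

text \<open>With an ideal this says that the element becomes zero over the quotient ring, without
  forming the quotient; with \<open>mpc V\<close> it says that only variables from \<open>V\<close>
  occur.\<close>

definition gin :: "'r set \<Rightarrow> 'r::comm_ring_1 gr \<Rightarrow> bool" where
  "gin I a \<longleftrightarrow> (\<forall>\<alpha>. cf a \<alpha> \<in> I)"

lemma gin_mpc_iff: "gin (mpc V) a \<longleftrightarrow> gmap (mkill V) a = a"
  by (auto simp: gin_def mpc_iff_mkill cf_gmap[OF rhom_mkill] intro!: gr_eqI)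
     (metis cf_gmap rhom_mkill)

lemma gin_mpc_xpow: "finite \<alpha> \<Longrightarrow> gin (mpc V) (xpow \<alpha>)"
  by (simp add: gin_mpc_iff gmap_xpow[OF rhom_mkill])

lemma gin_mpc_endo: "(\<And>i. gin (mpc V) (y i)) \<Longrightarrow> gin (mpc V) a \<Longrightarrow> gin (mpc V) (endo n y a)"
  by (simp add: gin_mpc_iff gmap_endo[OF rhom_mkill])

lemma gin_mpc_ypow: "(\<And>i. gin (mpc V) (y i)) \<Longrightarrow> gin (mpc V) (ypow y \<alpha>)"
  by (simp add: gin_mpc_iff gmap_ypow[OF rhom_mkill])

lemma gin_mpc_gcomp: "(\<And>i. gin (mpc V) (y i)) \<Longrightarrow> (\<And>i. gin (mpc V) (z i)) \<Longrightarrow> gin (mpc V) (gcomp n y z i)"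
  by (simp add: gin_mpc_iff gmap_gcomp[OF rhom_mkill])

lemma gin_mpc_jac: "Pts n y \<Longrightarrow> (\<And>i. gin (mpc V) (y i)) \<Longrightarrow> gin (mpc V) (jac n y)"
  by (simp add: gin_mpc_iff gmap_jac[OF rhom_mkill] PtsD)

lemma gin_mpc_pt: "(\<And>v. v \<in> Gamma_index n \<Longrightarrow> c v \<in> mpc V) \<Longrightarrow> gin (mpc V) (pt n c i)"
  unfolding gin_mpc_iff gmap_pt[OF rhom_mkill] mpc_iff_mkill
  by (rule fun_cong[of _ _ i]) (rule pt_cong)

lemma gin_mult_left:
  assumes I: "is_ideal V I" and "gin I a" "gin (mpc V) r"
  shows "gin I (r * a)"
  unfolding gin_def cf_times
  by (intro allI is_ideal_sum[OF I] is_idealD(4)[OF I]) (use assms in \<open>auto simp: gin_def\<close>)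

lemma gin_mult_right:
  assumes I: "is_ideal V I" and "gin I a" "gin (mpc V) r"
  shows "gin I (a * r)"
  unfolding gin_def cf_times
  by (intro allI is_ideal_sum[OF I] is_idealD(5)[OF I] is_idealD(4)[OF I]) (use assms in \<open>auto simp: gin_def\<close>)

lemma gin_add: "is_ideal V I \<Longrightarrow> gin I a \<Longrightarrow> gin I b \<Longrightarrow> gin I (a + b)"
  by (simp add: gin_def is_idealD)

lemma gin_uminus: "is_ideal V I \<Longrightarrow> gin I a \<Longrightarrow> gin I (- a)"
  by (simp add: gin_def is_idealD)

lemma gin_endo:
  assumes I: "is_ideal V I" and "gin I a" "\<And>i. gin (mpc V) (y i)"
  shows "gin I (endo n y a)"
  unfolding gin_def endo_def cf_sum cf_sc_mult
  by (intro allI is_ideal_sum[OF I] is_idealD(5)[OF I]) (use assms gin_mpc_ypow[of V y] in \<open>auto simp: gin_def\<close>)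

section \<open>The group scheme\<close>

lemma vars_Jacobian_group [simp]: "vars (Jacobian_group n) = Gamma_index n"
  by (simp add: Jacobian_group_def)

lemma pt_zero: "pt n (\<lambda>_. 0) = xvar"
  by (rule ext, rule gr_eqI) (simp add: cf_pt)

lemma pt_coord: "(i, \<alpha>) \<in> Gamma_index n \<Longrightarrow> cf (pt n c i - xvar i) \<alpha> = c (i, \<alpha>)"
  by (simp add: cf_pt)

lemma rhom_jac_pt:
  assumes "rhom \<phi>"
  shows "\<phi> (cf (jac n (pt n c) - 1) \<alpha>) = cf (jac n (pt n (\<lambda>v. \<phi> (c v))) - 1) \<alpha>"
  unfolding cf_gmap[OF assms, symmetric] gmap_simps[OF assms] gmap_jac[OF assms PtsD(1)[OF Pts_pt]]
    gmap_pt[OF assms] ..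

text \<open>Substituting into the multiplication polynomials composes the substituted points. In
  this way every axiom about \<open>mul\<close> becomes an identity for
  \<open>gcomp\<close>.\<close>

lemma pt_rhom_mul:
  assumes "rhom \<phi>"
  shows "pt n (\<lambda>v. \<phi> (mul (Jacobian_group n) v)) =
    gcomp n (pt n (\<lambda>v. \<phi> (mvar (Inl v)))) (pt n (\<lambda>v. \<phi> (mvar (Inr v))))"
proof
  fix i
  have "pt n (\<lambda>v. \<phi> (mul (Jacobian_group n) v)) i = gmap \<phi> (pt n (mul (Jacobian_group n)) i)"
    by (rule gmap_pt[OF assms, symmetric])
  also have "\<dots> = gcomp n (pt n (\<lambda>v. \<phi> (mvar (Inl v)))) (pt n (\<lambda>v. \<phi> (mvar (Inr v)))) i"
    unfolding pt_mul_Jacobian_group gmap_gcomp[OF assms] gmap_pt[OF assms] ..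
  finally show "pt n (\<lambda>v. \<phi> (mul (Jacobian_group n) v)) i =
    gcomp n (pt n (\<lambda>v. \<phi> (mvar (Inl v)))) (pt n (\<lambda>v. \<phi> (mvar (Inr v)))) i" .
qed

lemma rhom_mul:
  assumes "rhom \<phi>" "(i, \<alpha>) \<in> Gamma_index n"
  shows "\<phi> (mul (Jacobian_group n) (i, \<alpha>)) =
    cf (gcomp n (pt n (\<lambda>v. \<phi> (mvar (Inl v)))) (pt n (\<lambda>v. \<phi> (mvar (Inr v)))) i - xvar i) \<alpha>"
  unfolding pt_rhom_mul[OF assms(1), symmetric] pt_coord[OF assms(2)] ..

lemma grn_jac_Pts: "Pts n y \<Longrightarrow> grn n (jac n y)"
  by (rule grn_jac) (rule PtsD, assumption)+

lemma gin_minus_one: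
  assumes I: "is_ideal V I" and "gin I (a - 1)" "gin I (b - 1)" "gin (mpc V) b"
  shows "gin I (a * b - 1)"
proof -
  have "gin I ((a - 1) * b + (b - 1))" by (intro gin_add[OF I] gin_mult_right[OF I] assms)
  then show ?thesis by (simp add: algebra_simps)
qed

context
  fixes n :: nat
begin

abbreviation (input) JG :: "(nat \<times> nat set, 'k::comm_ring_1) mult_scheme" where
  "JG \<equiv> Jacobian_group n"

lemma eqs_mpc: "eqs (JG :: (_, 'k::comm_ring_1) mult_scheme) \<subseteq> mpc (Gamma_index n)"
proof -
  have "gin (mpc (Gamma_index n)) (jac n (univ n :: nat \<Rightarrow> (_, 'k) mpoly gr))"
    by (intro gin_mpc_jac gin_mpc_pt Pts_pt) simp
  moreover have "gin (mpc (Gamma_index n)) (1 :: (nat \<times> nat set, 'k) mpoly gr)"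
    unfolding gin_mpc_iff gmap_simps[OF rhom_mkill] ..
  ultimately show ?thesis by (auto simp: eqs_Jacobian_group gin_def)
qed

lemma gin_jac_minus_one:
  assumes y: "Pts n y" and zero: "0 \<in> I" and I: "\<And>\<alpha>. \<alpha> \<subseteq> {1..n} \<Longrightarrow> cf (jac n y - 1) \<alpha> \<in> I"
  shows "gin I (jac n y - 1)"
  unfolding gin_def
proof
  fix \<alpha> show "cf (jac n y - 1) \<alpha> \<in> I"
  proof (cases "\<alpha> \<subseteq> {1..n}")
    case False
    have "grn n (jac n y - 1)" using grn_jac_Pts[OF y] by simp
    then show ?thesis using False zero by (simp only: grn_def) simp
  qed (rule I)
qed

lemma is_ideal_vanishing1: "is_ideal (Gamma_index n) (vanishing1 (JG :: (_, 'k::comm_ring_1) mult_scheme))"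
  unfolding vanishing1_def using is_ideal_genideal[OF eqs_mpc] by simp

lemma gin_vanishing1: "gin (vanishing1 JG) (jac n (univ n :: nat \<Rightarrow> (_, 'k::comm_ring_1) mpoly gr) - 1)"
proof (rule gin_jac_minus_one[OF Pts_pt is_idealD(2)[OF is_ideal_vanishing1]])
  fix \<alpha> :: "nat set" assume "\<alpha> \<subseteq> {1..n}"
  then have "cf (jac n (univ n :: nat \<Rightarrow> (_, 'k) mpoly gr) - 1) \<alpha> \<in> eqs JG" by (auto simp: eqs_Jacobian_group)
  then show "cf (jac n (univ n :: nat \<Rightarrow> (_, 'k) mpoly gr) - 1) \<alpha> \<in> vanishing1 JG"
    unfolding vanishing1_def vars_Jacobian_group by (rule genideal_mem[OF eqs_mpc])
qed

text \<open>Renaming variables is a base change, so the equations for the two factors are the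
  Jacobian equations of the two independent universal points.\<close>

lemma vanishing2_JG:
  fixes V :: "((nat \<times> nat set) + (nat \<times> nat set)) set"
  defines "V \<equiv> Gamma_index n <+> Gamma_index n"
  shows "is_ideal V (vanishing2 (JG :: (_, 'k::comm_ring_1) mult_scheme))"
    "gin (vanishing2 JG) (jac n (pt n (\<lambda>v. mvar (Inl v)) :: nat \<Rightarrow> (_, 'k) mpoly gr) - 1)"
    "gin (vanishing2 JG) (jac n (pt n (\<lambda>v. mvar (Inr v)) :: nat \<Rightarrow> (_, 'k) mpoly gr) - 1)"
proof -
  let ?S = "mrename Inl ` eqs JG \<union> mrename Inr ` eqs JG :: (_, 'k) mpoly set"
  have S: "?S \<subseteq> mpc V"
  proof
    fix p :: "(_, 'k) mpoly" assume "p \<in> ?S"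
    then obtain q where "q \<in> mpc (Gamma_index n)" "p = mrename Inl q \<or> p = mrename Inr q"
      using eqs_mpc by auto
    then show "p \<in> mpc V"
      by (auto simp: mrename_def V_def intro!: msubst_mpc[of q "Gamma_index n"] mpc_mvar)
  qed
  have v2: "vanishing2 (JG :: (_, 'k) mult_scheme) = Idl\<^bsub>mpoly_ring V\<^esub> ?S"
    by (simp add: vanishing2_def V_def)
  show I: "is_ideal V (vanishing2 (JG :: (_, 'k) mult_scheme))" unfolding v2 by (rule is_ideal_genideal[OF S])
  have *: "gin (vanishing2 JG) (jac n (pt n (\<lambda>v. mvar (r v)) :: nat \<Rightarrow> (_, 'k) mpoly gr) - 1)"
    if r: "mrename r ` eqs (JG :: (_, 'k) mult_scheme) \<subseteq> ?S" for r
  proof (rule gin_jac_minus_one[OF Pts_pt is_idealD(2)[OF I]])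
    fix \<alpha> :: "nat set" assume "\<alpha> \<subseteq> {1..n}"
    then have "mrename r (cf (jac n (univ n :: nat \<Rightarrow> (_, 'k) mpoly gr) - 1) \<alpha>) \<in> mrename r ` eqs JG"
      by (auto simp: eqs_Jacobian_group)
    then have "mrename r (cf (jac n (univ n :: nat \<Rightarrow> (_, 'k) mpoly gr) - 1) \<alpha>) \<in> vanishing2 JG"
      unfolding v2 using r by (intro genideal_mem[OF S]) blast
    then show "cf (jac n (pt n (\<lambda>v. mvar (r v)) :: nat \<Rightarrow> (_, 'k) mpoly gr) - 1) \<alpha> \<in> vanishing2 JG"
      unfolding rhom_jac_pt[OF rhom_mrename] mrename_mvar .
  qed
  show "gin (vanishing2 JG) (jac n (pt n (\<lambda>v. mvar (Inl v)) :: nat \<Rightarrow> (_, 'k) mpoly gr) - 1)"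
    "gin (vanishing2 JG) (jac n (pt n (\<lambda>v. mvar (Inr v)) :: nat \<Rightarrow> (_, 'k) mpoly gr) - 1)"
    by (rule *; blast)+
qed

lemma is_ideal_vanishing3:
  "is_ideal ((Gamma_index n <+> Gamma_index n) <+> Gamma_index n) (vanishing3 (JG :: (_, 'k::comm_ring_1) mult_scheme))"
proof -
  let ?V = "(Gamma_index n <+> Gamma_index n) <+> Gamma_index n"
  let ?S = "mrename (Inl \<circ> Inl) ` eqs JG \<union> mrename (Inl \<circ> Inr) ` eqs JG \<union> mrename Inr ` eqs JG :: (_, 'k) mpoly set"
  have *: "mrename r q \<in> mpc ?V" if "q \<in> eqs JG" "\<And>v. v \<in> Gamma_index n \<Longrightarrow> r v \<in> ?V" for r and q :: "(_, 'k) mpoly"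
    using that eqs_mpc unfolding mrename_def by (intro msubst_mpc[of q "Gamma_index n"]) auto
  have "?S \<subseteq> mpc ?V" by (intro Un_least image_subsetI *) auto
  from is_ideal_genideal[OF this] show ?thesis by (simp add: vanishing3_def)
qed

lemma mul_mpc:
  assumes "v \<in> Gamma_index n"
  shows "mul (JG :: (_, 'k::comm_ring_1) mult_scheme) v \<in> mpc (Gamma_index n <+> Gamma_index n)"
proof -
  let ?V = "Gamma_index n <+> Gamma_index n"
  obtain i \<alpha> where v: "v = (i, \<alpha>)" by (cases v)
  let ?g = "gcomp n (pt n (\<lambda>v. mvar (Inl v))) (pt n (\<lambda>v. mvar (Inr v))) i :: (_, 'k) mpoly gr"
  have "gin (mpc ?V) ?g" by (intro gin_mpc_gcomp gin_mpc_pt mpc_mvar) auto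
  moreover have "gin (mpc ?V) (xvar i :: (_, 'k) mpoly gr)" by (rule gin_mpc_xpow) simp
  ultimately have "cf (?g - xvar i) \<alpha> \<in> mpc ?V" by (simp add: gin_def)
  moreover have "mul JG v = cf (?g - xvar i) \<alpha>"
    unfolding v by (rule rhom_mul[OF rhom_id assms[unfolded v]])
  ultimately show ?thesis by simp
qed

text \<open>In the cocycle rule both factors are congruent to 1 modulo the ideal, the second because
  \<open>endo\<close> keeps coefficients in the ideal.\<close>

lemma msubst_mul_vanishing2:
  assumes "f \<in> eqs JG"
  shows "msubst (mul JG) f \<in> vanishing2 (JG :: (_, 'k::comm_ring_1) mult_scheme)"
proof -
  let ?l = "pt n (\<lambda>v. mvar (Inl v)) :: nat \<Rightarrow> (_, 'k) mpoly gr"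
    and ?r = "pt n (\<lambda>v. mvar (Inr v)) :: nat \<Rightarrow> (_, 'k) mpoly gr"
  let ?V = "Gamma_index n <+> Gamma_index n"
  obtain \<alpha> where \<alpha>: "f = cf (jac n (univ n) - 1) \<alpha>" using assms by (auto simp: eqs_Jacobian_group)
  note I = vanishing2_JG[where ?'k = 'k]
  have r: "gin (mpc ?V) (?r i)" and l: "gin (mpc ?V) (?l i)" for i by (intro gin_mpc_pt mpc_mvar; auto)+
  have "gin (vanishing2 JG) (endo n ?l (jac n ?r - 1))" by (rule gin_endo[OF I(1) I(3) l])
  then have *: "gin (vanishing2 JG) (endo n ?l (jac n ?r) - 1)"
    by (simp only: ghomD[OF ghom_endo_Pts[OF Pts_pt]])
  have "gin (mpc ?V) (endo n ?l (jac n ?r))" by (intro gin_mpc_endo l gin_mpc_jac Pts_pt r)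
  then have "gin (vanishing2 JG) (jac n ?l * endo n ?l (jac n ?r) - 1)"
    by (rule gin_minus_one[OF I(1) I(2) *])
  moreover have "msubst (mul JG) f = cf (jac n ?l * endo n ?l (jac n ?r) - 1) \<alpha>"
    unfolding \<alpha> rhom_jac_pt[OF rhom_msubst] msubst_mvar pt_mul_Jacobian_group jac_gcomp[OF Pts_pt Pts_pt] ..
  ultimately show ?thesis by (simp only: gin_def)
qed

lemma algebraic_group_JG: "algebraic_group (JG :: (_, 'k::comm_ring_1) mult_scheme)"
proof -
  let ?V = "Gamma_index n"
  let ?m = "mul (JG :: (_, 'k) mult_scheme)"
  note I1 = is_ideal_vanishing1[where ?'k = 'k] and I3 = is_ideal_vanishing3[where ?'k = 'k]
  \<comment> \<open>Both sides are coefficients of the same triple composite; they agree as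
    polynomials, not merely modulo the ideal.\<close>
  have assoc: "msubst (case_sum (\<lambda>w. mrename Inl (?m w)) (\<lambda>w. mvar (Inr w))) (?m v) -
        msubst (case_sum (\<lambda>w. mvar (Inl (Inl w))) (\<lambda>w. mrename (case_sum (Inl \<circ> Inr) Inr) (?m w))) (?m v)
        \<in> vanishing3 JG" if v: "v \<in> ?V" for v
  proof -
    obtain i \<alpha> where i: "v = (i, \<alpha>)" by (cases v)
    note v' = v[unfolded i]
    have "msubst (case_sum (\<lambda>w. mrename Inl (?m w)) (\<lambda>w. mvar (Inr w))) (?m v) =
        msubst (case_sum (\<lambda>w. mvar (Inl (Inl w))) (\<lambda>w. mrename (case_sum (Inl \<circ> Inr) Inr) (?m w))) (?m v)"
      unfolding i rhom_mul[OF rhom_msubst v'] msubst_mvar sum.case pt_rhom_mul[OF rhom_mrename] mrename_mvar o_apply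
        gcomp_assoc[OF Pts_pt] ..
    then show ?thesis using is_idealD(2)[OF I3] by simp
  qed
  obtain z where z: "Pts n z" "gcomp n z (univ n :: nat \<Rightarrow> (_, 'k) mpoly gr) = xvar" "gcomp n (univ n) z = xvar"
    using Pts_inverse[OF Pts_pt] .
  define s where "s = (\<lambda>(i, \<alpha>). cf (z i - xvar i) \<alpha>)"
  have pts: "pt n s = z" unfolding s_def by (rule pt_coords[OF z(1)])
  \<comment> \<open>The inverse of the universal point might involve variables outside
    \<open>Gamma_index n\<close>. Killing these fixes the universal point and turns \<open>z\<close>
    into another left inverse of it, which equals \<open>z\<close> by uniqueness.\<close>
  have ginz: "gin (mpc ?V) (z i)" for i
  proof -
    define w where "w i = gmap (mkill ?V) (z i)" for i
    have u: "gmap (mkill ?V) (univ n i) = (univ n i :: (_, 'k) mpoly gr)" for i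
      unfolding gmap_pt[OF rhom_mkill] by (rule fun_cong[of _ _ i]) (rule pt_cong, simp)
    have "w = pt n (\<lambda>v. mkill ?V (s v))"
      by (rule ext) (simp only: w_def pts[symmetric] gmap_pt[OF rhom_mkill])
    then have w: "Pts n w" by (simp only: Pts_pt)
    have "gcomp n w (univ n) = xvar"
    proof
      fix i
      have "gmap (mkill ?V) (gcomp n z (univ n) i) = gcomp n w (univ n) i"
        unfolding gmap_gcomp[OF rhom_mkill] u w_def ..
      then show "gcomp n w (univ n) i = xvar i" by (simp add: z gmap_xpow[OF rhom_mkill])
    qed
    then have "gcomp n w (gcomp n (univ n) z) = z" by (simp only: gcomp_assoc[OF w, symmetric] gcomp_xvar[OF z(1)])
    then have "w = z" by (simp only: z gcomp_xvar[OF w])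
    then show ?thesis unfolding gin_mpc_iff by (metis w_def)
  qed
  have s_mpc: "s v \<in> mpc ?V" if "v \<in> ?V" for v
  proof -
    obtain i \<alpha> where v: "v = (i, \<alpha>)" by (cases v)
    have "gin (mpc ?V) (xvar i :: (_, 'k) mpoly gr)" by (rule gin_mpc_xpow) simp
    with ginz[of i] show ?thesis by (simp add: s_def v gin_def)
  qed
  have s_eqs: "msubst s f \<in> vanishing1 JG" if f: "f \<in> eqs JG" for f
  proof -
    obtain \<alpha> where \<alpha>: "f = cf (jac n (univ n) - 1) \<alpha>" using f by (auto simp: eqs_Jacobian_group)
    \<comment> \<open>From J(z) z(J(univ)) = 1 follows J(z) - 1 = - J(z) z(J(univ) - 1), which lies
      in the ideal.\<close>
    have one: "jac n z * endo n z (jac n (univ n)) = 1"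
      unfolding jac_gcomp[OF z(1) Pts_pt, symmetric] z(2) by (rule jac_xvar)
    have "gin (vanishing1 JG) (endo n z (jac n (univ n) - 1))"
      by (rule gin_endo[OF I1 gin_vanishing1 ginz])
    then have "gin (vanishing1 JG) (jac n z * endo n z (jac n (univ n) - 1))"
      by (rule gin_mult_left[OF I1]) (intro gin_mpc_jac z ginz)
    then have "gin (vanishing1 JG) (- (jac n z * endo n z (jac n (univ n) - 1)))" by (rule gin_uminus[OF I1])
    moreover have "- (jac n z * endo n z (jac n (univ n) - 1)) = jac n z - 1"
      using one by (simp add: ghomD[OF ghom_endo_Pts[OF z(1)]] right_diff_distrib)
    ultimately have "gin (vanishing1 JG) (jac n z - 1)" by simp
    then show ?thesis
      unfolding \<alpha> rhom_jac_pt[OF rhom_msubst] msubst_mvar pts by (simp only: gin_def)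
  qed
  have unit: "msubst (case_sum (\<lambda>w. mconst 0) mvar) (?m v) = mvar v"
      "msubst (case_sum mvar (\<lambda>w. mconst 0)) (?m v) = mvar v"
      and inv: "msubst (case_sum s mvar) (?m v) = 0" "msubst (case_sum mvar s) (?m v) = 0"
    if v: "v \<in> ?V" for v
  proof -
    obtain i \<alpha> where i: "v = (i, \<alpha>)" by (cases v)
    note v' = v[unfolded i]
    have 0: "mconst 0 = (0 :: (nat \<times> nat set, 'k) mpoly)" by (simp add: mconst_def)
    show "msubst (case_sum (\<lambda>w. mconst 0) mvar) (?m v) = mvar v"
      "msubst (case_sum mvar (\<lambda>w. mconst 0)) (?m v) = mvar v"
      "msubst (case_sum s mvar) (?m v) = 0" "msubst (case_sum mvar s) (?m v) = 0"
      unfolding i rhom_mul[OF rhom_msubst v'] msubst_mvar sum.case 0 pt_zero gcomp_xvar[OF Pts_pt] pt_coord[OF v'] pts z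
      by simp_all
  qed
  have id_eqs: "meval (\<lambda>c. c) (\<lambda>_. 0) f = 0" if f: "f \<in> eqs (JG :: (_, 'k) mult_scheme)" for f
  proof -
    obtain \<alpha> where \<alpha>: "f = cf (jac n (univ n) - 1) \<alpha>" using f by (auto simp: eqs_Jacobian_group)
    show ?thesis
      unfolding \<alpha> rhom_jac_pt[OF rhom_meval[OF rhom_id]] meval_mvar[OF rhom_id] pt_zero jac_xvar by simp
  qed
  have m0: "mconst 0 = (0 :: (nat \<times> nat set, 'k) mpoly)" by (simp add: mconst_def)
  show ?thesis
    unfolding algebraic_group_def vars_Jacobian_group mpoly_ring_simps
  proof (intro conjI ballI exI[of _ "\<lambda>_. 0 :: 'k"] exI[of _ s])
    show "eqs JG \<subseteq> mpc ?V" by (rule eqs_mpc)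
  qed (use mul_mpc msubst_mul_vanishing2 assoc id_eqs s_mpc s_eqs unit inv m0 is_idealD(2)[OF I1] in simp_all)
qed

section \<open>The unitriangular representation\<close>

text \<open>The matrix of \<open>endo n y\<close> in the monomial basis, with row \<beta> and column
  \<alpha>.\<close>

definition mat_entry :: "(nat \<Rightarrow> 'a::comm_ring_1 gr) \<Rightarrow> nat set \<Rightarrow> nat set \<Rightarrow> 'a" where
  "mat_entry y \<beta> \<alpha> = cf (endo n y (xpow \<alpha>)) \<beta>"

lemma mat_entry_gcomp:
  assumes "Pts n y" "Pts n z" "\<alpha> \<subseteq> {1..n}"
  shows "mat_entry (gcomp n y z) \<beta> \<alpha> = (\<Sum>\<gamma>\<in>Pow {1..n}. mat_entry y \<beta> \<gamma> * mat_entry z \<gamma> \<alpha>)"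
  unfolding mat_entry_def endo_gcomp[OF assms(1)]
  by (subst endo_def[of n y "endo n z (xpow \<alpha>)"]) (simp add: cf_sum endo_xpow mult.commute)

lemma mat_entry_triangular:
  assumes "Pts n y" "\<alpha> \<subseteq> {1..n}" "card \<beta> \<le> card \<alpha>"
  shows "mat_entry y \<beta> \<alpha> = (if \<beta> = \<alpha> then 1 else 0)"
proof -
  have fin: "finite \<alpha>" using assms(2) by (rule finite_subset) simp
  have "fil (card \<alpha> + 2) (endo n y (xpow \<alpha>) - xpow \<alpha>)"
    by (rule fil_endo_minus[OF assms(1)]) (use assms fin in \<open>auto simp: grn_xpow fil_xpow\<close>)
  then have "cf (endo n y (xpow \<alpha>) - xpow \<alpha>) \<beta> = 0" using assms(3) unfolding fil_def by (elim allE[of _ \<beta>]) simp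
  then show ?thesis by (simp add: mat_entry_def cf_xpow fin)
qed

lemma mat_entry_rhom:
  assumes "rhom \<phi>" "\<alpha> \<subseteq> {1..n}"
  shows "\<phi> (mat_entry y \<beta> \<alpha>) = mat_entry (\<lambda>i. gmap \<phi> (y i)) \<beta> \<alpha>"
  using finite_subset[OF assms(2)]
  by (simp add: mat_entry_def cf_gmap[OF assms(1), symmetric] gmap_endo[OF assms(1)] gmap_xpow[OF assms(1)])

text \<open>The action adds terms of higher degree, so the row of a nonzero off-diagonal entry is
  larger than its column. Listing large sets first puts these entries above the diagonal.\<close>

lemma subsets_by_decreasing_card:
  "\<exists>(e :: nat \<Rightarrow> nat set) N. bij_betw e {..<N} (Pow {1..n}) \<and>
    (\<forall>a b. a \<le> b \<longrightarrow> b < N \<longrightarrow> card (e b) \<le> card (e a))"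
proof -
  obtain xs where xs: "set xs = Pow {1..n}" "distinct xs" using finite_distinct_list[of "Pow {1..n}"] by auto
  define ys where "ys = rev (sort_key card xs)"
  have ys: "set ys = Pow {1..n}" "distinct ys" using xs by (simp_all add: ys_def)
  have "card (ys ! b) \<le> card (ys ! a)" if "a \<le> b" "b < length ys" for a b
  proof -
    have "sorted (map card (rev ys))" by (simp add: ys_def)
    then have "sorted (rev (map card ys))" by (simp add: rev_map)
    then have "map card ys ! b \<le> map card ys ! a"
      using sorted_rev_nth_mono[of "map card ys" a b] that by simp
    then show ?thesis using that by simp
  qed
  moreover have "bij_betw ((!) ys) {..<length ys} (Pow {1..n})" using bij_betw_nth[OF ys(2)] ys(1) by simp
  ultimately show ?thesis by blast
qed

lemma unipotent_JG: "unipotent_group (JG :: (_, 'k::comm_ring_1) mult_scheme)"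
proof -
  let ?V = "Gamma_index n"
  obtain e :: "nat \<Rightarrow> nat set" and N where e: "bij_betw e {..<N} (Pow {1..n})"
    "\<And>a b. a \<le> b \<Longrightarrow> b < N \<Longrightarrow> card (e b) \<le> card (e a)" using subsets_by_decreasing_card by blast
  have eN: "e a \<subseteq> {1..n}" if "a < N" for a using e(1) that by (auto simp: bij_betw_def)
  have inj: "e a = e b \<longleftrightarrow> a = b" if "a < N" "b < N" for a b
    using bij_betw_imp_inj_on[OF e(1)] that by (auto simp: inj_on_def)
  let ?u = "univ n :: nat \<Rightarrow> (_, 'k) mpoly gr"
  define \<phi> where "\<phi> = (\<lambda>(a, b). mat_entry ?u (e a) (e b))"
  have tri: "mat_entry y (e a) (e b) = (if a = b then 1 else 0)"
    if "Pts n y" "b \<le> a" "a < N" for y :: "nat \<Rightarrow> 'r::comm_ring_1 gr" and a b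
    using mat_entry_triangular[OF that(1) eN e(2)[OF that(2,3)]] that inj by auto
  have prod: "mat_entry (gcomp n y z) (e a) (e b) = mat_entry y (e a) (e b) + mat_entry z (e a) (e b) +
      (\<Sum>c\<in>{a<..<b}. mat_entry y (e a) (e c) * mat_entry z (e c) (e b))"
    if "Pts n y" "Pts n z" "a < b" "b < N" for y z :: "nat \<Rightarrow> 'r::comm_ring_1 gr" and a b
  proof -
    let ?f = "\<lambda>c. mat_entry y (e a) (e c) * mat_entry z (e c) (e b)"
    have "mat_entry (gcomp n y z) (e a) (e b) = (\<Sum>c<N. ?f c)"
      unfolding mat_entry_gcomp[OF that(1,2) eN[OF that(4)]]
      by (rule sum.reindex_bij_betw[OF e(1), symmetric])
    also have "\<dots> = (\<Sum>c\<in>insert a (insert b {a<..<b}). ?f c)"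
    proof (rule sum.mono_neutral_right)
      show "\<forall>c\<in>{..<N} - insert a (insert b {a<..<b}). ?f c = 0"
      proof
        fix c assume c: "c \<in> {..<N} - insert a (insert b {a<..<b})"
        then consider "c < a" "c < N" | "b < c" "c < N" using that by force
        then show "?f c = 0"
          using tri[OF that(1), of c a] tri[OF that(2), of b c] that by cases auto
      qed
    qed (use that in auto)
    also have "\<dots> = ?f a + (?f b + (\<Sum>c\<in>{a<..<b}. ?f c))" using that by simp
    also have "?f a = mat_entry z (e a) (e b)" using tri[OF that(1), of a a] that by simp
    also have "?f b = mat_entry y (e a) (e b)" using tri[OF that(2), of b b] that by simp
    finally show ?thesis by (simp add: add_ac)
  qed
  have phi: "msubst g (\<phi> (a, b)) = mat_entry (pt n g) (e a) (e b)" if "b < N" for a b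
    and g :: "nat \<times> nat set \<Rightarrow> ('w, 'k) mpoly"
    using mat_entry_rhom[OF rhom_msubst eN[OF that], of g ?u "e a"] by (simp add: \<phi>_def gmap_pt[OF rhom_msubst])
  have mpc: "\<phi> w \<in> mpc ?V" if "w \<in> {(a, b). a < b \<and> b < N}" for w
  proof -
    have "gin (mpc ?V) (endo n ?u (xpow (e (snd w))))"
      using finite_subset[OF eN[of "snd w"]] that by (intro gin_mpc_endo gin_mpc_pt gin_mpc_xpow) auto
    then show ?thesis using that by (auto simp: gin_def \<phi>_def mat_entry_def)
  qed
  have hom: "group_scheme_hom JG (unitriangular N) \<phi>"
    unfolding group_scheme_hom_def
  proof (intro conjI ballI)
    fix w assume w: "w \<in> vars (unitriangular N :: (_, 'k) mult_scheme)"
    then obtain a b where ab: "w = (a, b)" "a < b" "b < N" by (auto simp: unitriangular_def)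
    show "\<phi> w \<in> carrier (mpoly_ring (vars (JG :: (_, 'k) mult_scheme)))" using mpc ab by simp
    let ?l = "pt n (\<lambda>v. mvar (Inl v)) :: nat \<Rightarrow> (_, 'k) mpoly gr"
      and ?r = "pt n (\<lambda>v. mvar (Inr v)) :: nat \<Rightarrow> (_, 'k) mpoly gr"
    have ren: "mrename r (\<phi> (c, d)) = mat_entry (pt n (\<lambda>v. mvar (r v))) (e c) (e d)" if "d < N"
      for c d and r :: "nat \<times> nat set \<Rightarrow> (nat \<times> nat set) + (nat \<times> nat set)"
      unfolding mrename_def by (rule phi[OF that])
    have "msubst (mul JG) (\<phi> w) = mat_entry (gcomp n ?l ?r) (e a) (e b)"
      using ab phi[of b "mul JG" a] by (simp add: pt_mul_Jacobian_group)
    also have "\<dots> = mat_entry ?l (e a) (e b) + mat_entry ?r (e a) (e b) +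
        (\<Sum>c\<in>{a<..<b}. mat_entry ?l (e a) (e c) * mat_entry ?r (e c) (e b))"
      by (rule prod[OF Pts_pt Pts_pt ab(2,3)])
    also have "\<dots> = msubst (case_sum (\<lambda>u. mrename Inl (\<phi> u)) (\<lambda>u. mrename Inr (\<phi> u))) (mul (unitriangular N) w)"
      using ab by (simp add: unitriangular_def rhomD[OF rhom_msubst] rhom_sum[OF rhom_msubst] ren)
    finally show "msubst (mul JG) (\<phi> w) - msubst (case_sum (\<lambda>u. mrename Inl (\<phi> u)) (\<lambda>u. mrename Inr (\<phi> u)))
        (mul (unitriangular N) w) \<in> vanishing2 JG"
      using is_idealD(2)[OF vanishing2_JG(1)[where ?'k = 'k]] by simp
  qed (simp add: unitriangular_def)
  have surj: "\<exists>q\<in>mpc {(a, b). a < b \<and> b < N}. msubst \<phi> q - p \<in> vanishing1 JG" if p: "p \<in> mpc ?V" for p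
  proof -
    \<comment> \<open>The coordinate (i, \<beta>) is itself a matrix entry, in row \<beta> and
      column {i}: the coefficient of x^\<beta> in the image of x_i. So the comorphism reaches all
      variables.\<close>
    have "\<exists>w\<in>{(a, b). a < b \<and> b < N}. \<phi> w = mvar v" if v: "v \<in> ?V" for v
    proof -
      obtain i \<beta> where i: "v = (i, \<beta>)" "i \<in> {1..n}" "\<beta> \<subseteq> {1..n}" "3 \<le> card \<beta>"
        using v by (auto simp: Gamma_index_def)
      then have "\<beta> \<in> e ` {..<N}" "{i} \<in> e ` {..<N}" using e(1) by (auto simp: bij_betw_def)
      then obtain a b where ab: "a < N" "b < N" "e a = \<beta>" "e b = {i}" by blast
      have "a < b"
      proof (rule ccontr)
        assume "\<not> a < b"
        then have "card (e a) \<le> card (e b)" using e(2)[of b a] ab by simp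
        then show False using i ab by simp
      qed
      moreover have "\<phi> (a, b) = mvar v"
      proof -
        have "\<beta> \<noteq> {i}" using i by auto
        then show ?thesis using i v ab by (simp add: \<phi>_def mat_entry_def endo_xvar cf_pt cf_xpow)
      qed
      ultimately show ?thesis using ab by (intro bexI[of _ "(a, b)"]) auto
    qed
    then obtain pos where pos: "\<And>v. v \<in> ?V \<Longrightarrow> pos v \<in> {(a, b). a < b \<and> b < N}" "\<And>v. v \<in> ?V \<Longrightarrow> \<phi> (pos v) = mvar v"
      by metis
    let ?q = "msubst (\<lambda>v. mvar (pos v)) p"
    have "?q \<in> mpc {(a, b). a < b \<and> b < N}" by (rule msubst_mpc[OF p]) (use pos in auto)
    moreover have "msubst \<phi> ?q = p" unfolding msubst_msubst by (rule msubst_id[OF p]) (simp add: pos)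
    ultimately show ?thesis using is_idealD(2)[OF is_ideal_vanishing1[where ?'k = 'k]] by (intro bexI[of _ ?q]) auto
  qed
  have "closed_immersion_hom JG (unitriangular N) \<phi>"
    unfolding closed_immersion_hom_def using hom surj by (simp add: unitriangular_def)
  then show ?thesis unfolding unipotent_group_def using algebraic_group_JG by blast
qed

end

section \<open>Solving the equations\<close>

text \<open>Here J = 1 + c x_1 ... x_n. Its inverse u satisfies u + c u x_1 ... x_n = 1, so u has
  constant coefficient 1 and top coefficient - c. The Berezin identity for f = 1 makes the latter
  zero.\<close>

lemma top_coefficient_Jacobian:
  assumes y: "Pts n y" and n: "n \<noteq> 0"
    and lower: "\<And>\<alpha>. \<alpha> \<subset> {1..n} \<Longrightarrow> cf (jac n y - 1) \<alpha> = 0"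
  shows "jac n y = 1"
proof -
  let ?N = "{1..n}"
  define c where "c = cf (jac n y - 1) ?N"
  have "jac n y - 1 = sc c * xpow ?N"
  proof (rule gr_eqI)
    fix \<alpha> :: "nat set"
    have "grn n (jac n y - 1)" using grn_jac_Pts[OF y] by simp
    then have "cf (jac n y - 1) \<alpha> = 0" if "\<not> \<alpha> \<subseteq> ?N" using that unfolding grn_def by blast
    then show "cf (jac n y - 1) \<alpha> = cf (sc c * xpow ?N) \<alpha>"
      using lower[of \<alpha>] by (cases "\<alpha> = ?N") (auto simp: cf_xpow c_def simp del: cf_minus)
  qed
  then have jac: "jac n y = 1 + sc c * xpow ?N" by (simp add: algebra_simps)
  obtain u where u: "u * jac n y = 1" "\<And>f. grn n f \<Longrightarrow> cf (u * endo n y f) ?N = cf f ?N"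
    using berezin[OF y] by blast
  have top: "cf u ?N = 0"
    using u(2)[of 1] n by (simp add: ghomD[OF ghom_endo_Pts[OF y]] cf_one gmonom_def)
  have eq: "u + sc c * (u * xpow ?N) = 1" using u(1) by (simp add: jac distrib_left sc_mult)
  have coef: "cf (u * xpow ?N) \<beta> = (if \<beta> = ?N then cf u {} else 0)" if "\<beta> \<subseteq> ?N" for \<beta>
  proof -
    have "finite \<beta>" using that by (rule finite_subset) simp
    have "gsign \<alpha> (\<beta> - \<alpha>) * cf u \<alpha> * cf (xpow ?N) (\<beta> - \<alpha>) = (if \<alpha> = {} \<and> \<beta> = ?N then cf u {} else 0)"
      if "\<alpha> \<in> Pow \<beta>" for \<alpha>
    proof -
      have "\<beta> - \<alpha> = ?N \<longleftrightarrow> \<alpha> = {} \<and> \<beta> = ?N" using that \<open>\<beta> \<subseteq> ?N\<close> by blast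
      then show ?thesis by (simp add: cf_xpow)
    qed
    then have "cf (u * xpow ?N) \<beta> = (\<Sum>\<alpha>\<in>Pow \<beta>. if \<alpha> = {} \<and> \<beta> = ?N then cf u {} else 0)"
      unfolding cf_times by (rule sum.cong[OF refl])
    also have "\<dots> = (\<Sum>\<alpha>\<in>{{} :: nat set}. if \<alpha> = {} \<and> \<beta> = ?N then cf u {} else 0)"
      by (rule sum.mono_neutral_right) (use \<open>finite \<beta>\<close> in auto)
    finally show ?thesis by simp
  qed
  have "{} \<noteq> ?N" using n by auto
  then have "cf u {} = 1" using arg_cong[OF eq, of "\<lambda>a. cf a {}"] coef[of "{}"]
    by (simp add: cf_one gmonom_def)
  moreover have "c * cf u {} = 0"
    using arg_cong[OF eq, of "\<lambda>a. cf a ?N"] coef[of ?N] top n by (simp add: cf_one gmonom_def)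
  ultimately show ?thesis using jac by (simp add: sc_simps)
qed

section \<open>Pivot coordinates\<close>

definition pivots :: "nat \<Rightarrow> nat set set" where
  "pivots n = {\<alpha>. \<alpha> \<subset> {1..n} \<and> even (card \<alpha>) \<and> \<alpha> \<noteq> {}}"

lemma pivotsD:
  assumes "\<alpha> \<in> pivots n"
  shows "\<alpha> \<subset> {1..n}" "finite \<alpha>" "even (card \<alpha>)" "2 \<le> card \<alpha>"
proof -
  show *: "\<alpha> \<subset> {1..n}" "even (card \<alpha>)" using assms by (auto simp: pivots_def)
  show fin: "finite \<alpha>" using *(1) by (meson finite_atLeastAtMost finite_subset psubset_imp_subset)
  have "card \<alpha> \<noteq> 0" using fin assms by (auto simp: pivots_def)
  then show "2 \<le> card \<alpha>" using *(2) by (cases "card \<alpha> = 1") auto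
qed

definition pivot :: "nat \<Rightarrow> nat set \<Rightarrow> nat \<times> nat set" where
  "pivot n \<alpha> = (Min ({1..n} - \<alpha>), insert (Min ({1..n} - \<alpha>)) \<alpha>)"

lemma pivot_mem:
  assumes "\<alpha> \<in> pivots n"
  shows "Min ({1..n} - \<alpha>) \<in> {1..n}" "Min ({1..n} - \<alpha>) \<notin> \<alpha>" "pivot n \<alpha> \<in> Gamma_index n"
proof -
  have "{1..n} - \<alpha> \<noteq> {}" using pivotsD(1)[OF assms] by blast
  then have m: "Min ({1..n} - \<alpha>) \<in> {1..n} - \<alpha>" by (intro Min_in) simp_all
  then show *: "Min ({1..n} - \<alpha>) \<in> {1..n}" "Min ({1..n} - \<alpha>) \<notin> \<alpha>" by simp_all
  show "pivot n \<alpha> \<in> Gamma_index n"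
    using * pivotsD[OF assms] unfolding pivot_def Gamma_index_def by auto
qed

text \<open>Deleting i from the set recovers the equation. So different equations have different
  pivots, and among the coordinates (i, \<open>insert i \<beta>\<close>) met by the divergence at
  \<beta> only one can be a pivot.\<close>

lemma pivot_eqD:
  assumes "\<alpha> \<in> pivots n" "pivot n \<alpha> = (i, insert i \<beta>)" "i \<notin> \<beta>"
  shows "\<alpha> = \<beta>" "i = Min ({1..n} - \<alpha>)"
proof -
  show i: "i = Min ({1..n} - \<alpha>)" using assms(2) by (simp add: pivot_def)
  then have "insert i \<alpha> = insert i \<beta>" "i \<notin> \<alpha>"
    using assms(2) pivot_mem(2)[OF assms(1)] by (simp_all add: pivot_def)
  then show "\<alpha> = \<beta>" using assms(3) by (simp add: insert_ident)
qed

lemma inj_pivot: "inj_on (pivot n) (pivots n)"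
proof (rule inj_onI)
  fix \<alpha> \<beta> assume *: "\<alpha> \<in> pivots n" "\<beta> \<in> pivots n" "pivot n \<alpha> = pivot n \<beta>"
  show "\<alpha> = \<beta>"
    by (rule pivot_eqD(1)[OF *(1) _ pivot_mem(2)[OF *(2)]]) (simp only: *(3) pivot_def[of n \<beta>])
qed

definition free_index :: "nat \<Rightarrow> (nat \<times> nat set) set" where
  "free_index n = Gamma_index n - pivot n ` pivots n"

text \<open>The coordinates available when the equations of degree k are solved: the free ones and
  the pivots of the equations of lower degree.\<close>

definition before :: "nat \<Rightarrow> nat \<Rightarrow> (nat \<times> nat set) set" where
  "before n k = free_index n \<union> pivot n ` {\<alpha> \<in> pivots n. card \<alpha> < k}"

lemma before_sub: "before n k \<subseteq> Gamma_index n"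
  using pivot_mem(3) by (auto simp: before_def free_index_def)

definition jeq :: "nat \<Rightarrow> nat set \<Rightarrow> (nat \<times> nat set, 'k::comm_ring_1) mpoly" where
  "jeq n \<alpha> = cf (jac n (univ n) - 1) \<alpha>"

definition jrest :: "nat \<Rightarrow> nat set \<Rightarrow> (nat \<times> nat set, 'k::comm_ring_1) mpoly" where
  "jrest n \<alpha> = jeq n \<alpha> - gsign {Min ({1..n} - \<alpha>)} \<alpha> * mvar (pivot n \<alpha>)"

text \<open>Setting the coordinates outside \<open>before\<close> to zero alters the universal point
  only in degrees above |\<alpha>|. By \<open>jac_diff\<close> the coefficient of J at \<alpha> then
  changes by the divergence of the removed part, and there only the pivot of \<alpha> occurs, with
  coefficient \<open>gsign\<close>.\<close>

lemma jrest_mpc: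
  assumes \<alpha>: "\<alpha> \<in> pivots n"
  shows "jrest n \<alpha> \<in> mpc (before n (card \<alpha>))"
proof -
  let ?U = "before n (card \<alpha>)" and ?m = "Min ({1..n} - \<alpha>)"
  let ?y = "univ n :: nat \<Rightarrow> (nat \<times> nat set, 'a) mpoly gr" and ?z = "pt n (\<lambda>v. mkill ?U (mvar v)) :: nat \<Rightarrow> (nat \<times> nat set, 'a) mpoly gr"
  note a = pivotsD[OF \<alpha>] and m = pivot_mem[OF \<alpha>]
  have cf: "cf (?y i - ?z i) \<gamma> = (if (i, \<gamma>) \<in> Gamma_index n - ?U then mvar (i, \<gamma>) else 0)" for i \<gamma>
    by (simp add: cf_pt)
  have low: "(i, \<gamma>) \<in> ?U" if "(i, \<gamma>) \<in> Gamma_index n" "card \<gamma> \<le> card \<alpha>" for i \<gamma>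
  proof (cases "(i, \<gamma>) \<in> pivot n ` pivots n")
    case True
    then obtain \<beta> where \<beta>: "\<beta> \<in> pivots n" "(i, \<gamma>) = pivot n \<beta>" by blast
    then have "card \<gamma> = Suc (card \<beta>)" using pivot_mem(2)[OF \<beta>(1)] pivotsD(2)[OF \<beta>(1)] by (simp add: pivot_def)
    then show ?thesis using \<beta> that by (auto simp: before_def)
  qed (use that in \<open>auto simp: before_def free_index_def\<close>)
  have "fil (Suc (card \<alpha>)) (?y i - ?z i)" for i
    unfolding fil_def
  proof (intro allI impI)
    fix \<gamma> :: "nat set" assume "card \<gamma> < Suc (card \<alpha>)"
    then have "(i, \<gamma>) \<notin> Gamma_index n - ?U" using low[of i \<gamma>] by auto
    then show "cf (?y i - ?z i) \<gamma> = 0" by (simp only: cf if_False)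
  qed
  then have "fil (card \<alpha> + 1) (jac n ?y - jac n ?z - (\<Sum>i\<in>{1..n}. dd i (?y i - ?z i)))"
    by (intro jac_diff Pts_pt)
  then have "cf (jac n ?y) \<alpha> - cf (jac n ?z) \<alpha> = (\<Sum>i\<in>{1..n}. cf (dd i (?y i - ?z i)) \<alpha>)"
    by (simp add: fil_def cf_sum del: cf_minus) (simp add: cf_sum)
  also have "\<dots> = (\<Sum>i\<in>{1..n}. if i = ?m then gsign {?m} \<alpha> * mvar (pivot n \<alpha>) else 0)"
  proof (rule sum.cong[OF refl])
    fix i assume i: "i \<in> {1..n}"
    have piv: "(i, insert i \<alpha>) \<in> Gamma_index n - ?U \<longleftrightarrow> i = ?m" if "i \<notin> \<alpha>"
    proof
      assume "(i, insert i \<alpha>) \<in> Gamma_index n - ?U"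
      then have "(i, insert i \<alpha>) \<in> pivot n ` pivots n" by (auto simp: before_def free_index_def)
      then obtain \<beta> where "\<beta> \<in> pivots n" "pivot n \<beta> = (i, insert i \<alpha>)" by force
      from pivot_eqD[OF this that] show "i = ?m" by simp
    next
      assume i: "i = ?m"
      have "pivot n \<alpha> \<notin> ?U"
      proof
        assume "pivot n \<alpha> \<in> ?U"
        then obtain \<beta> where "\<beta> \<in> pivots n" "card \<beta> < card \<alpha>" "pivot n \<alpha> = pivot n \<beta>"
          using \<alpha> by (auto simp: before_def free_index_def)
        then show False using inj_onD[OF inj_pivot, of n \<alpha> \<beta>] \<alpha> by auto
      qed
      then show "(i, insert i \<alpha>) \<in> Gamma_index n - ?U" using m(3) i by (simp add: pivot_def)
    qed
    show "cf (dd i (?y i - ?z i)) \<alpha> = (if i = ?m then gsign {?m} \<alpha> * mvar (pivot n \<alpha>) else 0)"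
    proof (cases "i \<in> \<alpha>")
      case True
      then show ?thesis using m(2) by (auto simp: cf_dd)
    next
      case False
      then show ?thesis unfolding cf_dd cf piv[OF False] by (simp add: pivot_def)
    qed
  qed
  also have "\<dots> = gsign {?m} \<alpha> * mvar (pivot n \<alpha>)" using m(1) by (simp only: sum.delta finite_atLeastAtMost if_True)
  finally have diff: "cf (jac n ?y) \<alpha> - cf (jac n ?z) \<alpha> = gsign {?m} \<alpha> * mvar (pivot n \<alpha>)" .
  have "jrest n \<alpha> = cf (jac n ?z - 1) \<alpha>" using diff by (simp add: jrest_def jeq_def algebra_simps)
  moreover have "gin (mpc ?U) (jac n ?z)" by (intro gin_mpc_jac gin_mpc_pt Pts_pt) simp
  moreover have "gin (mpc ?U) (1 :: (nat \<times> nat set, 'a) mpoly gr)" unfolding gin_mpc_iff gmap_simps[OF rhom_mkill] ..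
  ultimately show ?thesis by (simp add: gin_def)
qed

section \<open>Elimination of the pivots\<close>

lemma msubst_jeq: "msubst g (jeq n \<alpha>) = cf (jac n (pt n g) - 1) \<alpha>"
  unfolding jeq_def rhom_jac_pt[OF rhom_msubst] msubst_mvar ..

lemma rhom_gsign_msubst: "msubst g (gsign \<alpha> \<beta>) = gsign \<alpha> \<beta>"
  by (rule rhom_gsign[OF rhom_msubst])

text \<open>\<open>t\<close> expresses the coordinates by free parameters, \<rho> names the free
  coordinates by parameters, and \<iota> leads back. Each stage solves the equations of one degree;
  the sign of the pivot is its own inverse, so no division occurs. The middle clause says that
  \<open>t\<close> followed by \<iota> is the identity modulo \<open>I\<close>, that is, the
  solution is forced.\<close>

lemma elimination:
  fixes \<rho> :: "nat \<times> nat set \<Rightarrow> 'w" and \<iota> :: "'w \<Rightarrow> nat \<times> nat set"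
  assumes I: "is_ideal (Gamma_index n) I" "\<And>\<alpha>. \<alpha> \<in> pivots n \<Longrightarrow> jeq n \<alpha> \<in> I"
    and \<rho>: "\<And>v. v \<in> free_index n \<Longrightarrow> \<rho> v \<in> D \<and> \<iota> (\<rho> v) = v" and \<iota>: "\<And>j. j \<in> D \<Longrightarrow> \<iota> j \<in> Gamma_index n"
  shows "\<exists>t :: nat \<times> nat set \<Rightarrow> ('w, 'k::comm_ring_1) mpoly. (\<forall>v\<in>free_index n. t v = mvar (\<rho> v)) \<and>
    (\<forall>v\<in>before n k. t v \<in> mpc D \<and> mvar v - msubst (\<lambda>j. mvar (\<iota> j)) (t v) \<in> I) \<and>
    (\<forall>\<alpha>\<in>pivots n. card \<alpha> < k \<longrightarrow> msubst t (jeq n \<alpha>) = 0)"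
proof (induction k)
  case 0
  then show ?case using \<rho> is_idealD(2)[OF I(1)]
    by (intro exI[of _ "\<lambda>v. mvar (\<rho> v)"]) (auto simp: before_def)
next
  case (Suc k)
  let ?\<iota> = "msubst (\<lambda>j. mvar (\<iota> j)) :: ('w, 'k) mpoly \<Rightarrow> _"
  from Suc obtain t :: "nat \<times> nat set \<Rightarrow> ('w, 'k) mpoly" where t: "\<And>v. v \<in> free_index n \<Longrightarrow> t v = mvar (\<rho> v)"
    "\<And>v. v \<in> before n k \<Longrightarrow> t v \<in> mpc D" "\<And>v. v \<in> before n k \<Longrightarrow> mvar v - ?\<iota> (t v) \<in> I"
    "\<And>\<alpha>. \<alpha> \<in> pivots n \<Longrightarrow> card \<alpha> < k \<Longrightarrow> msubst t (jeq n \<alpha>) = 0" by blast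
  \<comment> \<open>A pivot determines its \<alpha> by injectivity. All values outside the pivots of
    degree k are kept; those of the pivots of higher degree are still arbitrary.\<close>
  define t' where "t' v = (if v \<in> pivot n ` {\<alpha> \<in> pivots n. card \<alpha> = k}
      then (let \<alpha> = the_inv_into (pivots n) (pivot n) v in - (gsign {Min ({1..n} - \<alpha>)} \<alpha> * msubst t (jrest n \<alpha>)))
      else t v)" for v
  have t'_piv: "t' (pivot n \<alpha>) = - (gsign {Min ({1..n} - \<alpha>)} \<alpha> * msubst t (jrest n \<alpha>))"
    if "\<alpha> \<in> pivots n" "card \<alpha> = k" for \<alpha>
    using that the_inv_into_f_f[OF inj_pivot, of \<alpha> n] by (auto simp: t'_def Let_def)
  have t'_before: "t' v = t v" if v: "v \<in> before n k" for v
  proof -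
    have "v \<noteq> pivot n \<alpha>" if "\<alpha> \<in> pivots n" "card \<alpha> = k" for \<alpha>
      using v that inj_onD[OF inj_pivot, of n \<alpha>] by (auto simp: before_def free_index_def)
    then show ?thesis by (auto simp: t'_def)
  qed
  have rest: "jrest n \<alpha> \<in> mpc (before n k)" if "\<alpha> \<in> pivots n" "card \<alpha> \<le> k" for \<alpha>
    by (rule mpc_mono[OF _ jrest_mpc[OF that(1)]]) (use that in \<open>auto simp: before_def\<close>)
  have eq': "msubst t' (jeq n \<alpha>) = gsign {Min ({1..n} - \<alpha>)} \<alpha> * t' (pivot n \<alpha>) + msubst t (jrest n \<alpha>)"
    if "\<alpha> \<in> pivots n" "card \<alpha> \<le> k" for \<alpha>
  proof -
    have "msubst t' (jeq n \<alpha>) = msubst t' (gsign {Min ({1..n} - \<alpha>)} \<alpha> * mvar (pivot n \<alpha>) + jrest n \<alpha>)"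
      by (simp add: jrest_def)
    also have "\<dots> = gsign {Min ({1..n} - \<alpha>)} \<alpha> * t' (pivot n \<alpha>) + msubst t' (jrest n \<alpha>)"
      by (simp add: rhomD[OF rhom_msubst] rhom_gsign_msubst)
    also have "msubst t' (jrest n \<alpha>) = msubst t (jrest n \<alpha>)"
      by (rule msubst_cong[OF rest[OF that] t'_before])
    finally show ?thesis .
  qed
  have "t' v \<in> mpc D \<and> mvar v - ?\<iota> (t' v) \<in> I" if v: "v \<in> before n (Suc k)" for v
  proof (cases "v \<in> before n k")
    case True
    then show ?thesis using t by (simp add: t'_before)
  next
    case False
    then obtain \<alpha> where \<alpha>: "\<alpha> \<in> pivots n" "card \<alpha> = k" "v = pivot n \<alpha>"
      using v by (auto simp: before_def less_Suc_eq)
    let ?s = "gsign {Min ({1..n} - \<alpha>)} \<alpha>"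
    note r = rest[OF \<alpha>(1) eq_refl[OF \<alpha>(2)]]
    have tr: "msubst t (jrest n \<alpha> :: (_, 'k) mpoly) \<in> mpc D" by (rule msubst_mpc[OF r t(2)])
    have "jrest n \<alpha> - msubst (\<lambda>v. ?\<iota> (t v)) (jrest n \<alpha>) \<in> I"
    proof (rule msubst_congruent[OF I(1) r before_sub])
      fix v assume v: "v \<in> before n k"
      show "?\<iota> (t v) \<in> mpc (Gamma_index n)" by (rule msubst_mpc[OF t(2)[OF v]]) (use \<iota> in auto)
    qed (rule t(3))
    \<comment> \<open>Write s for the sign. Multiplying the equation s v + \<open>jrest\<close> by s
      turns the coefficient of v into s^2 = 1; in the remainder the earlier coordinates may be
      replaced by their solutions modulo \<open>I\<close>.\<close>
    from is_idealD(7)[OF I(1) is_idealD(4)[OF I(1) I(2)[OF \<alpha>(1)] mpc_gsign] is_idealD(4)[OF I(1) this mpc_gsign]]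
    have "?s * jeq n \<alpha> - ?s * (jrest n \<alpha> - msubst (\<lambda>v. ?\<iota> (t v)) (jrest n \<alpha>)) \<in> I" .
    also have "?s * jeq n \<alpha> - ?s * (jrest n \<alpha> - msubst (\<lambda>v. ?\<iota> (t v)) (jrest n \<alpha>)) = mvar v - ?\<iota> (t' v)"
      unfolding \<alpha>(3) t'_piv[OF \<alpha>(1,2)]
      by (simp add: jrest_def rhomD[OF rhom_msubst] rhom_gsign_msubst msubst_msubst right_diff_distrib)
    finally show ?thesis using \<alpha> tr by (simp add: t'_piv)
  qed
  moreover have "t' v = mvar (\<rho> v)" if "v \<in> free_index n" for v
    using that t(1)[OF that] t'_before[of v] by (simp add: before_def)
  moreover have "msubst t' (jeq n \<alpha>) = 0" if \<alpha>: "\<alpha> \<in> pivots n" "card \<alpha> < Suc k" for \<alpha>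
  proof (cases "card \<alpha> = k")
    case True
    then show ?thesis using eq'[OF \<alpha>(1)] t'_piv[OF \<alpha>(1)] by simp
  next
    case False
    then have k: "card \<alpha> < k" using \<alpha> by simp
    then have "t' (pivot n \<alpha>) = t (pivot n \<alpha>)" using \<alpha> by (intro t'_before) (auto simp: before_def)
    then have "msubst t' (jeq n \<alpha>) = gsign {Min ({1..n} - \<alpha>)} \<alpha> * t (pivot n \<alpha>) + msubst t (jrest n \<alpha>)"
      using eq'[OF \<alpha>(1)] k by simp
    also have "\<dots> = msubst t (gsign {Min ({1..n} - \<alpha>)} \<alpha> * mvar (pivot n \<alpha>) + jrest n \<alpha>)"
      by (simp add: rhomD[OF rhom_msubst] rhom_gsign_msubst)
    also have "\<dots> = 0" using t(4)[OF \<alpha>(1) k] by (simp add: jrest_def)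
    finally show ?thesis .
  qed
  ultimately show ?case by blast
qed

section \<open>Counting coordinates and equations\<close>

lemma card_even_subsets:
  assumes "n \<noteq> 0"
  shows "card {\<alpha>. \<alpha> \<subseteq> {1..n} \<and> even (card \<alpha>)} = 2 ^ (n - 1)" "card {\<alpha>. \<alpha> \<subseteq> {1..n} \<and> odd (card \<alpha>)} = 2 ^ (n - 1)"
proof -
  let ?E = "{\<alpha>. \<alpha> \<subseteq> {1..n} \<and> even (card \<alpha>)}" and ?O = "{\<alpha>. \<alpha> \<subseteq> {1..n} \<and> odd (card \<alpha>)}"
  have "{} \<subset> {1..n}" using assms by (auto simp: psubset_eq)
  then have "card ?E = card ?O" using card_subsupersets_even_odd[of "{1..n}" "{}"] by simp
  moreover have "card ?E + card ?O = card (?E \<union> ?O)" by (rule card_Un_disjoint[symmetric]) auto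
  moreover have "?E \<union> ?O = Pow {1..n}" by auto
  moreover have "(2::nat) ^ n = 2 * 2 ^ (n - 1)" using assms by (cases n) auto
  ultimately show "card ?E = 2 ^ (n - 1)" "card ?O = 2 ^ (n - 1)" by (simp_all add: card_Pow)
qed

text \<open>For each i all odd subsets except the n singletons occur. The additive form avoids
  truncated subtraction.\<close>

lemma card_Gamma_index:
  assumes "n \<noteq> 0"
  shows "card (Gamma_index n) + n * n = n * 2 ^ (n - 1)"
proof -
  let ?O = "{\<alpha>. \<alpha> \<subseteq> {1..n} \<and> odd (card \<alpha>)}" and ?O3 = "{\<alpha>. \<alpha> \<subseteq> {1..n} \<and> odd (card \<alpha>) \<and> 3 \<le> card \<alpha>}"
  have "Gamma_index n = {1..n} \<times> ?O3" by (auto simp: Gamma_index_def)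
  then have G: "card (Gamma_index n) = n * card ?O3" by (simp add: card_cartesian_product)
  have "?O = ?O3 \<union> (\<lambda>i. {i}) ` {1..n}"
  proof (intro equalityI subsetI)
    fix \<alpha> assume "\<alpha> \<in> ?O"
    then have \<alpha>: "\<alpha> \<subseteq> {1..n}" "odd (card \<alpha>)" by auto
    have "card \<alpha> = 1" if "card \<alpha> < 3"
    proof -
      have "card \<alpha> \<noteq> 0" "card \<alpha> \<noteq> 2" using \<alpha>(2) by (auto intro: ccontr)
      with that show ?thesis by linarith
    qed
    then show "\<alpha> \<in> ?O3 \<union> (\<lambda>i. {i}) ` {1..n}"
      using \<alpha> by (cases "card \<alpha> < 3") (auto simp: card_1_singleton_iff)
  qed auto
  then have "card ?O = card ?O3 + card ((\<lambda>i. {i}) ` {1..n})"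
    by (simp only:) (rule card_Un_disjoint, auto)
  also have "card ((\<lambda>i. {i}) ` {1..n}) = n" by (subst card_image) (auto simp: inj_on_def)
  finally have "2 ^ (n - 1) = card ?O3 + n" using card_even_subsets(2)[OF assms] by simp
  then show ?thesis by (simp add: G algebra_simps)
qed

lemma finite_pivots: "finite (pivots n)"
  by (rule finite_subset[of _ "Pow {1..n}"]) (auto simp: pivots_def)

text \<open>The even subsets that carry no pivot are {} and, when n is even, {1..n}.\<close>

lemma card_pivots:
  assumes "n \<noteq> 0"
  shows "card (pivots n) + (if even n then 2 else 1) = 2 ^ (n - 1)"
proof -
  let ?E = "{\<alpha>. \<alpha> \<subseteq> {1..n} \<and> even (card \<alpha>)}"
  let ?X = "if even n then {{}, {1..n}} else {{}}"
  have ne: "{} \<noteq> {1..n}" using assms by auto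
  have "?E = pivots n \<union> ?X" by (auto simp: pivots_def)
  moreover have "card (pivots n \<union> ?X) = card (pivots n) + card ?X"
    by (rule card_Un_disjoint[OF finite_pivots]) (auto simp: pivots_def)
  moreover have "card ?X = (if even n then 2 else 1)" using ne by auto
  ultimately show ?thesis using card_even_subsets(1)[OF assms] by simp
qed

lemma card_free_index:
  assumes "4 \<le> n"
  shows "card (free_index n) = (if even n then (n - 1) * 2 ^ (n - 1) - n ^ 2 + 2 else (n - 1) * 2 ^ (n - 1) - n ^ 2 + 1)"
proof -
  have n0: "n \<noteq> 0" using assms by simp
  have "card (free_index n) = card (Gamma_index n) - card (pivot n ` pivots n)"
    unfolding free_index_def by (rule card_Diff_subset) (use finite_pivots pivot_mem(3) in auto)
  then have f: "card (free_index n) = card (Gamma_index n) - card (pivots n)"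
    by (simp add: card_image[OF inj_pivot])
  \<comment> \<open>This is n^2 \<le> (n - 1) 2^(n - 1), which makes the truncated subtraction in
    the dimension formula exact. The induction starts at n = 4 with equality, 2 \<cdot> 4 =
    2^3.\<close>
  have pow: "n * n + 2 ^ (n - 1) \<le> n * 2 ^ (n - 1)"
  proof -
    obtain k where k: "n = Suc k" using n0 by (cases n) auto
    have "2 * Suc k \<le> 2 ^ k" if "3 \<le> k" for k :: nat
      using that by (induction k rule: dec_induct) auto
    then have "k * (2 * Suc k) \<le> k * 2 ^ k" using assms k by (intro mult_le_mono2) simp
    moreover have "Suc k * Suc k \<le> k * (2 * Suc k)"
      using mult_le_mono1[of "Suc k" "2 * k" "Suc k"] assms k by (simp add: mult_ac)
    ultimately have "Suc k * Suc k \<le> k * 2 ^ k" by (rule le_trans[rotated])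
    then show ?thesis by (simp only: k diff_Suc_1 mult_Suc add_le_cancel_left add.commute)
  qed
  have A: "(n - 1) * 2 ^ (n - 1) + 2 ^ (n - 1) = n * 2 ^ (n - 1)" using n0 by (cases n) auto
  have "g - p = a - m + r" if "a + q = b" "g + m = b" "p + r = q" "m + q \<le> b" for a b g m p q r :: nat
    using that by arith
  from this[OF A card_Gamma_index[OF n0] card_pivots[OF n0] pow] show ?thesis
    by (simp add: f power2_eq_square)
qed

section \<open>The algebra of regular functions\<close>

text \<open>\<open>h\<close> substitutes the solution and \<open>g\<close> inserts the free
  coordinates. Then \<open>h\<close> after \<open>g\<close> is the identity, and \<open>g\<close>
  after \<open>h\<close> is the identity modulo the ideal; so \<open>h\<close> is surjective with
  the ideal as its kernel and induces the isomorphism.\<close>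

lemma affine_JG:
  assumes n: "4 \<le> n" and d: "card (free_index n) = d"
  shows "affine_of_dimension (Jacobian_group n :: (nat \<times> nat set, 'k::comm_ring_1) mult_scheme) d"
proof -
  let ?V = "Gamma_index n" and ?D = "{1..d}"
  let ?X = "Jacobian_group n :: (nat \<times> nat set, 'k) mult_scheme"
  let ?I = "vanishing1 ?X"
  have "finite (free_index n)" by (simp add: free_index_def)
  then obtain \<rho> where \<rho>: "bij_betw \<rho> (free_index n) ?D"
    using d finite_same_card_bij[of "free_index n" ?D] by auto
  define \<iota> where "\<iota> = inv_into (free_index n) \<rho>"
  have \<rho>1: "\<rho> v \<in> ?D \<and> \<iota> (\<rho> v) = v" if "v \<in> free_index n" for v
    using bij_betw_apply[OF \<rho> that] bij_betw_inv_into_left[OF \<rho> that] by (simp add: \<iota>_def)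
  have \<rho>2: "\<iota> j \<in> free_index n \<and> \<rho> (\<iota> j) = j" if "j \<in> ?D" for j
    using that \<rho> by (simp add: \<iota>_def bij_betw_inv_into_right bij_betw_apply[OF bij_betw_inv_into])
  have free: "free_index n \<subseteq> ?V" by (auto simp: free_index_def)
  note I = is_ideal_vanishing1[of n, where ?'k = 'k]
  have jI: "jeq n \<alpha> \<in> ?I" for \<alpha>
    using gin_vanishing1[of n, where ?'k = 'k] unfolding gin_def jeq_def by blast
  obtain t :: "nat \<times> nat set \<Rightarrow> (nat, 'k) mpoly" where t: "\<And>v. v \<in> free_index n \<Longrightarrow> t v = mvar (\<rho> v)"
    "\<And>v. v \<in> before n (Suc n) \<Longrightarrow> t v \<in> mpc ?D"
    "\<And>v. v \<in> before n (Suc n) \<Longrightarrow> mvar v - msubst (\<lambda>j. mvar (\<iota> j)) (t v) \<in> ?I"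
    "\<And>\<alpha>. \<alpha> \<in> pivots n \<Longrightarrow> card \<alpha> < Suc n \<Longrightarrow> msubst t (jeq n \<alpha> :: (_, 'k) mpoly) = 0"
    using elimination[OF I jI \<rho>1, where k = "Suc n"] \<rho>2 free by blast
  have all: "before n (Suc n) = ?V"
  proof (intro equalityI before_sub subsetI)
    fix v assume "v \<in> ?V"
    moreover have "card \<alpha> < Suc n" if "\<alpha> \<in> pivots n" for \<alpha>
      using card_mono[of "{1..n}" \<alpha>] pivotsD(1)[OF that] by auto
    ultimately show "v \<in> before n (Suc n)" by (auto simp: before_def free_index_def)
  qed
  have t4: "msubst t (jeq n \<alpha> :: (_, 'k) mpoly) = 0" if "\<alpha> \<in> pivots n" for \<alpha>
    using t(4)[OF that] card_mono[of "{1..n}" \<alpha>] pivotsD(1)[OF that] by auto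
  let ?y = "pt n t"
  \<comment> \<open>The constant coefficient of J is 1 for every point: y - x starts in degree 3, so
    its divergence starts in degree 2.\<close>
  have fil0: "cf (jac n ?y - 1) {} = 0"
  proof -
    have "fil 1 (?y i - xvar i)" for i using PtsD(3)[OF Pts_pt[of n t], of i] by (rule fil_antimono) simp
    then have "fil (0 + 1) (jac n ?y - jac n xvar - (\<Sum>i\<in>{1..n}. dd i (?y i - xvar i)))"
      by (intro jac_diff) (simp_all add: Pts_pt)
    moreover have "fil 2 (\<Sum>i\<in>{1..n}. dd i (?y i - xvar i))"
      using PtsD(3)[OF Pts_pt[of n t]] by (intro fil_sum fil_dd) (simp add: eval_nat_numeral)
    ultimately show ?thesis by (simp add: fil_def jac_xvar del: cf_minus) (simp add: fil_def)
  qed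
  \<comment> \<open>The solved point satisfies all equations, not only those with a pivot:
    coefficients of odd degree vanish by parity, the constant one by \<open>fil0\<close>, and the
    top one by the Berezin argument. Hence \<open>h\<close> kills the whole ideal.\<close>
  have jac1: "jac n ?y = 1"
  proof (rule top_coefficient_Jacobian[OF Pts_pt])
    fix \<alpha> assume \<alpha>: "\<alpha> \<subset> {1..n}"
    show "cf (jac n ?y - 1) \<alpha> = 0"
    proof (cases "\<alpha> \<in> pivots n")
      case True
      then show ?thesis using t4[OF True] by (simp only: msubst_jeq)
    next
      case False
      then consider "odd (card \<alpha>)" | "\<alpha> = {}" using \<alpha> by (auto simp: pivots_def)
      then show ?thesis
      proof cases
        case 1
        have "evn (jac n ?y - 1)" by simp
        then show ?thesis using 1 unfolding evn_def by blast
      qed (simp only: fil0)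
    qed
  qed (use n in simp)
  define h where "h = (msubst t :: (_, 'k) mpoly \<Rightarrow> _)"
  define g where "g = (msubst (\<lambda>j. mvar (\<iota> j)) :: (nat, 'k) mpoly \<Rightarrow> _)"
  have rh: "rhom h" unfolding h_def by (rule rhom_msubst)
  have hI: "h p = 0" if "p \<in> ?I" for p
  proof (rule genideal_kernel[OF rh eqs_mpc])
    show "h f = 0" if "f \<in> eqs ?X" for f
      using that jac1 by (auto simp: eqs_Jacobian_group h_def rhom_jac_pt[OF rhom_msubst] simp del: cf_minus)
    show "p \<in> Idl\<^bsub>mpoly_ring ?V\<^esub> eqs ?X" using that by (simp add: vanishing1_def)
  qed
  have hD: "h p \<in> mpc ?D" if "p \<in> mpc ?V" for p
    unfolding h_def by (rule msubst_mpc[OF that]) (use t(2) all in simp)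
  have gV: "g q \<in> mpc ?V" if "q \<in> mpc ?D" for q
    unfolding g_def by (rule msubst_mpc[OF that]) (use \<rho>2 free in \<open>auto intro!: mpc_mvar\<close>)
  have hg: "h (g q) = q" if "q \<in> mpc ?D" for q
    unfolding h_def g_def msubst_msubst by (rule msubst_id[OF that]) (use \<rho>2 t(1) in simp)
  have gh: "p - g (h p) \<in> ?I" if "p \<in> mpc ?V" for p
    unfolding h_def g_def msubst_msubst
  proof (rule msubst_congruent[OF I that order_refl])
    fix v assume v: "v \<in> ?V"
    show "msubst (\<lambda>j. mvar (\<iota> j)) (t v) \<in> mpc ?V" using gV[of "t v"] t(2)[of v] v all by (simp add: g_def)
    show "mvar v - msubst (\<lambda>j. mvar (\<iota> j)) (t v) \<in> ?I" using t(3)[of v] v all by simp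
  qed
  interpret ring_hom_ring "mpoly_ring ?V :: (_, 'k) mpoly ring" "mpoly_ring ?D :: (nat, 'k) mpoly ring" h
    by (rule ring_hom_ringI) (simp_all add: cring.axioms(1) cring_mpoly_ring hD[unfolded One_nat_def] rhomD[OF rh])
  have "h ` mpc ?V = mpc ?D"
  proof (intro equalityI subsetI)
    fix q :: "(nat, 'k) mpoly" assume "q \<in> mpc ?D"
    then show "q \<in> h ` mpc ?V" using hg[of q] gV[of q] by (intro image_eqI[of q h "g q"]) simp_all
  qed (elim imageE, simp only: hD)
  then have "h ` carrier (mpoly_ring ?V) = carrier (mpoly_ring ?D)" by (simp only: mpoly_ring_simps)
  note iso = FactRing_iso_set[OF this]
  have "a_kernel (mpoly_ring ?V) (mpoly_ring ?D) h = ?I"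
    unfolding a_kernel_def'
  proof (intro equalityI subsetI)
    fix p assume "p \<in> {p \<in> carrier (mpoly_ring ?V). h p = \<zero>\<^bsub>mpoly_ring ?D\<^esub>}"
    then have "p \<in> mpc ?V" "h p = 0" by simp_all
    then show "p \<in> ?I" using gh[of p] by (simp add: g_def rhomD[OF rhom_msubst])
  qed (use hI is_idealD(1)[OF I] in simp_all)
  note ker = this
  have c: "the_elem (h ` (?I +>\<^bsub>mpoly_ring ?V\<^esub> mconst c)) = mconst c" for c
    using the_elem_simp[of "mconst c"] unfolding ker by (simp add: h_def)
  show ?thesis
    unfolding affine_of_dimension_def regular_functions_def vars_Jacobian_group
    by (rule bexI[OF _ iso[unfolded ker]]) (use c in blast)
qed

theorem theorem6p3:
  fixes n :: nat
  assumes "4 \<le> n"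
  shows "unipotent_group (Jacobian_group n :: (nat \<times> nat set, 'k::comm_ring_1) mult_scheme) \<and>
    affine_of_dimension (Jacobian_group n :: (nat \<times> nat set, 'k) mult_scheme)
      (if even n then (n - 1) * 2 ^ (n - 1) - n ^ 2 + 2
       else (n - 1) * 2 ^ (n - 1) - n ^ 2 + 1)"
  using unipotent_JG affine_JG[OF assms card_free_index[OF assms]] by blast

end
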